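(* Let $\mathcal{A}$ be a bounded convex complete separable metrizable subset of some locally convex space. The following properties are equivalent: (i) the set $\mathcal{A}$ is $\mu$-compact; (ii) for an arbitrary increasing sequence $\{f_n\}\subset C(\mathcal{A})$ converging pointwise to a function $f_0\in C(\mathcal{A})$, the sequence $\{\overline{\mathrm{co}}f_n\}$ converges pointwise to the function $\overline{\mathrm{co}}f_0$; (iii) for an arbitrary increasing sequence $\{f_n\}$ of lower semicontinuous lower bounded functions on $\mathcal{A}$ (with values in $(-\infty,+\infty]$) converging pointwise to a function $f_0$, the sequence $\{\overline{\mathrm{co}}f_n\}$ converges pointwise to the function $\overline{\mathrm{co}}f_0$. If these equivalent properties hold, then for an arbitrary decreasing sequence $\{f_n\}$ of lower semicontinuous bounded functions on $\mathcal{A}$ converging pointwise to a lower semicontinuous bounded function $f_0$, the sequence $\{\overline{\mathrm{co}}f_n\}$ converges pointwise to the function $\overline{\mathrm{co}}f_0$.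
   Context: "Bounded convex complete separable metrizable subset of a locally convex space" means: $\mathcal{A}$ is a bounded convex subset, the topology on $\mathcal{A}$ is defined by a countable subset of the family of seminorms generating the topology of the entire locally convex space, and $\mathcal{A}$ is separable and complete in the metric generated by this countable subset of seminorms. $C(\mathcal{A})$ is the set of all continuous bounded (real-valued) functions on $\mathcal{A}$. $M(\mathcal{A})$ is the set of all Borel probability measures on $\mathcal{A}$ endowed with the weak convergence topology (convergence of integrals of all functions in $C(\mathcal{A})$). The barycenter of $\mu\in M(\mathcal{A})$ is the point $\mathbf{b}(\mu)=\int_{\mathcal{A}}x\,\mu(dx)\in\mathcal{A}$ defined by the Pettis integral, i.e. $\ell(\mathbf{b}(\mu))=\int_{\mathcal{A}}\ell(x)\,\mu(dx)$ for every continuous linear functional $\ell$ on the locally convex space. The barycenter map $M(\mathcal{A})\ni\mu\mapsto\mathbf{b}(\mu)\in\mathcal{A}$ is continuous. The set $\mathcal{A}$ is called $\mu$-compact if the preimage of any compact subset of $\mathcal{A}$ under the barycenter map is a compact subset of $M(\mathcal{A})$. For a function $f$ on $\mathcal{A}$, the convex closure $\overline{\mathrm{co}}f$ is the maximal convex closed (that is, lower semicontinuous) function on $\mathcal{A}$ majorized by $f$ (i.e. $\le f$ pointwise). Values $+\infty$ are allowed for lower semicontinuous lower bounded functions, for their pointwise limits and for convex closures. "Increasing" and "decreasing" sequences of functions are understood pointwise: $f_n\le f_{n+1}$ (respectively $f_n\ge f_{n+1}$) on $\mathcal{A}$ for all $n$. *)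

theory Defs
  imports "HOL-Probability.Probability"
begin

definition seminorm :: "('a::real_vector \<Rightarrow> real) \<Rightarrow> bool" where
  "seminorm p \<longleftrightarrow>
     (\<forall>x y. p (x + y) \<le> p x + p y) \<and> (\<forall>c x. p (c *\<^sub>R x) = \<bar>c\<bar> * p x)"

text \<open>A locally convex space is a real vector space, given as a type, with a family \<open>P\<close> of seminorms
  generating its topology. The set \<open>UNIV\<close> in the subbase matters only for \<open>P = {}\<close>.\<close>

definition seminorm_topology :: "('a::real_vector \<Rightarrow> real) set \<Rightarrow> 'a topology" where
  "seminorm_topology P =
     topology_generated_by (insert UNIV {{y. p (y - x) < e} |p x e. p \<in> P \<and> e > 0})"

text \<open>The metric generated by a countable family \<open>Q\<close> of seminorms: with an enumeration
  \<open>q\<^sub>0, q\<^sub>1, \<dots>\<close> of \<open>Q\<close> (finite or infinite), it is the sum of the \<open>2\<^sup>-\<^sup>k min (1, q\<^sub>k (x - y))\<close>.\<close>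

definition seminorm_dist :: "('a::real_vector \<Rightarrow> real) set \<Rightarrow> 'a \<Rightarrow> 'a \<Rightarrow> real" where
  "seminorm_dist Q x y = (\<Sum>\<^sub>\<infinity>q\<in>Q. (1/2) ^ to_nat_on Q q * min 1 (q (x - y)))"

text \<open>Bounded convex complete separable metrizable subsets of the locally convex space \<open>P\<close>.
  The ambient space itself need not be Hausdorff; that the topology of \<open>A\<close> is metrizable, hence
  Hausdorff, is the condition that \<open>seminorm_dist Q\<close> is a metric on \<open>A\<close>.\<close>

definition bccsm_subset :: "('a::real_vector \<Rightarrow> real) set \<Rightarrow> 'a set \<Rightarrow> bool" where
  "bccsm_subset P A \<longleftrightarrow>
     (\<forall>p\<in>P. bounded (p ` A)) \<and> convex A \<and>
     separable_space (subtopology (seminorm_topology P) A) \<and>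
     (\<exists>Q\<subseteq>P. countable Q \<and>
        subtopology (seminorm_topology P) A = subtopology (seminorm_topology Q) A \<and>
        Metric_space A (seminorm_dist Q) \<and>
        Metric_space.mcomplete A (seminorm_dist Q))"

text \<open>\<open>C(X)\<close>. Values outside the space \<open>X\<close> are irrelevant.\<close>

definition Cb :: "'a topology \<Rightarrow> ('a \<Rightarrow> real) set" where
  "Cb X = {f. continuous_map X euclideanreal f \<and> bounded (f ` topspace X)}"

definition borel_prob_measures :: "'a topology \<Rightarrow> 'a measure set" where
  "borel_prob_measures X =
     {\<mu>. prob_space \<mu> \<and> sets \<mu> = sets (sigma (topspace X) {U. openin X U})}"

text \<open>The initial topology of the maps \<open>\<mu> \<mapsto> \<integral>f d\<mu>\<close>, for \<open>f\<close> continuous and bounded.\<close>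

definition weak_topology :: "'a topology \<Rightarrow> 'a measure topology" where
  "weak_topology X = topology_generated_by
     {{\<mu> \<in> borel_prob_measures X. (\<integral>x. f x \<partial>\<mu>) \<in> U} |f U. f \<in> Cb X \<and> open U}"

definition barycenter :: "('a::real_vector \<Rightarrow> real) set \<Rightarrow> 'a set \<Rightarrow> 'a measure \<Rightarrow> 'a" where
  "barycenter P A \<mu> = (THE b. b \<in> A \<and>
     (\<forall>l. linear l \<and> continuous_map (seminorm_topology P) euclideanreal l \<longrightarrow>
          l b = (\<integral>x. l x \<partial>\<mu>)))"

definition mu_compact :: "('a::real_vector \<Rightarrow> real) set \<Rightarrow> 'a set \<Rightarrow> bool" where
  "mu_compact P A \<longleftrightarrow>
     (let X = subtopology (seminorm_topology P) A in
      \<forall>K. compactin X K \<longrightarrow>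
        compactin (weak_topology X) {\<mu> \<in> borel_prob_measures X. barycenter P A \<mu> \<in> K})"

definition lsc_on :: "'a topology \<Rightarrow> ('a \<Rightarrow> 'b::linorder) \<Rightarrow> bool" where
  "lsc_on X f \<longleftrightarrow> (\<forall>c. openin X {x \<in> topspace X. c < f x})"

text \<open>Convexity for functions with values in \<open>(-\<infinity>, +\<infinity>]\<close>; note that \<open>0 * \<infinity> = 0\<close> in \<open>ereal\<close>.\<close>

definition ereal_convex_on :: "'a::real_vector set \<Rightarrow> ('a \<Rightarrow> ereal) \<Rightarrow> bool" where
  "ereal_convex_on A f \<longleftrightarrow>
     (\<forall>x\<in>A. f x \<noteq> -\<infinity>) \<and>
     (\<forall>x\<in>A. \<forall>y\<in>A. \<forall>u\<ge>0. \<forall>v\<ge>0. u + v = 1 \<longrightarrow>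
        f (u *\<^sub>R x + v *\<^sub>R y) \<le> ereal u * f x + ereal v * f y)"

definition convex_closed_minorants ::
    "('a::real_vector \<Rightarrow> real) set \<Rightarrow> 'a set \<Rightarrow> ('a \<Rightarrow> ereal) \<Rightarrow> ('a \<Rightarrow> ereal) set" where
  "convex_closed_minorants P A f =
     {g. ereal_convex_on A g \<and> lsc_on (subtopology (seminorm_topology P) A) g \<and>
         (\<forall>x\<in>A. g x \<le> f x)}"

text \<open>The maximal convex closed function majorized by \<open>f\<close> is the pointwise supremum of all of them;
  that it is itself one of them, and hence the maximal one, is shown below for every
  lower bounded \<open>f\<close>.\<close>

definition convex_closure ::
    "('a::real_vector \<Rightarrow> real) set \<Rightarrow> 'a set \<Rightarrow> ('a \<Rightarrow> ereal) \<Rightarrow> 'a \<Rightarrow> ereal" where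
  "convex_closure P A f x = (SUP g\<in>convex_closed_minorants P A f. g x)"

lemma topspace_seminorm_topology [simp]: "topspace (seminorm_topology P) = UNIV"
  by (auto simp: seminorm_topology_def topology_generated_by_topspace)

lemma convex_closure_maximal:
  assumes A: "convex A" and c: "\<And>x. x \<in> A \<Longrightarrow> ereal c \<le> f x"
  shows "convex_closure P A f \<in> convex_closed_minorants P A f"
    and "\<And>g x. g \<in> convex_closed_minorants P A f \<Longrightarrow> x \<in> A \<Longrightarrow> g x \<le> convex_closure P A f x"
proof -
  let ?S = "convex_closed_minorants P A f" and ?h = "convex_closure P A f"
  let ?X = "subtopology (seminorm_topology P) A"
  show upper: "\<And>g x. g \<in> ?S \<Longrightarrow> x \<in> A \<Longrightarrow> g x \<le> ?h x"
    unfolding convex_closure_def by (rule SUP_upper)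
  have top: "topspace ?X = A" by simp
  have "openin ?X {x \<in> topspace ?X. d < ereal c}" for d :: ereal
    by (cases "d < ereal c") (auto intro: openin_topspace[of ?X, simplified])
  moreover have "ereal_convex_on A (\<lambda>_. ereal c)"
    by (auto simp: ereal_convex_on_def simp flip: distrib_right)
  ultimately have cS: "(\<lambda>_. ereal c) \<in> ?S"
    using c by (auto simp: convex_closed_minorants_def lsc_on_def)
  have low: "ereal c \<le> ?h x" if "x \<in> A" for x
    using upper[OF cS that] .
  have "ereal_convex_on A ?h"
    unfolding ereal_convex_on_def
  proof (intro conjI ballI allI impI)
    show "?h x \<noteq> -\<infinity>" if "x \<in> A" for x
      using low[OF that] by auto
    fix x y and u v :: real
    assume *: "x \<in> A" "y \<in> A" "0 \<le> u" "0 \<le> v" "u + v = 1"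
    have "g (u *\<^sub>R x + v *\<^sub>R y) \<le> ereal u * ?h x + ereal v * ?h y" if g: "g \<in> ?S" for g
    proof -
      have "g (u *\<^sub>R x + v *\<^sub>R y) \<le> ereal u * g x + ereal v * g y"
        using g * by (auto simp: convex_closed_minorants_def ereal_convex_on_def)
      also have "\<dots> \<le> ereal u * ?h x + ereal v * ?h y"
        using * upper[OF g] by (intro add_mono ereal_mult_left_mono) auto
      finally show ?thesis .
    qed
    then show "?h (u *\<^sub>R x + v *\<^sub>R y) \<le> ereal u * ?h x + ereal v * ?h y"
      unfolding convex_closure_def[of P A f "u *\<^sub>R x + v *\<^sub>R y"] by (rule SUP_least)
  qed
  moreover have "lsc_on ?X ?h"
    unfolding lsc_on_def
  proof
    fix d :: ereal
    have "{x \<in> topspace ?X. d < ?h x} = (\<Union>g\<in>?S. {x \<in> topspace ?X. d < g x})"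
      by (auto simp: convex_closure_def less_SUP_iff)
    moreover have "openin ?X {x \<in> topspace ?X. d < g x}" if "g \<in> ?S" for g
      using that by (auto simp: convex_closed_minorants_def lsc_on_def)
    ultimately show "openin ?X {x \<in> topspace ?X. d < ?h x}"
      by (simp only:) (rule openin_Union, blast)
  qed
  moreover have "?h x \<le> f x" if "x \<in> A" for x
    unfolding convex_closure_def
    by (rule SUP_least) (use that in \<open>auto simp: convex_closed_minorants_def\<close>)
  ultimately show "?h \<in> ?S"
    by (simp add: convex_closed_minorants_def)
qed

end

theory Submission
  imports Defs
begin

text \<open>
  Under \<open>\<mu>\<close>-compactness the convex closure of a lower bounded lower semicontinuous \<open>f\<close> is its roof
  \<open>x \<mapsto> inf {\<integral>f d\<mu> | b(\<mu>) = x}\<close>: Jensen's inequality bounds every convex closed minorant by the roof, and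
  a cluster point of measures whose barycenters converge shows that the roof is itself closed. Increasing limits
  pass through the infimum by the same cluster argument, decreasing ones by exchanging two infima.

  Conversely, let \<open>K\<close> be compact and let continuous \<open>f\<^sub>n\<close> decrease to \<open>0\<close>. By (ii) the convex closures of
  \<open>-f\<^sub>n\<close> increase to \<open>0\<close>, uniformly on \<open>K\<close> by Dini's argument, so by Jensen \<open>\<integral>f\<^sub>n d\<mu>\<close> tends to \<open>0\<close>
  uniformly over all \<open>\<mu>\<close> with \<open>b(\<mu>) \<in> K\<close>. Hence each limit functional of such measures, which exists by
  Tychonoff's theorem, is sigma-smooth, and the Daniell representation turns it into a measure; no tightness
  argument is involved.
\<close>

subsection \<open>The Hahn--Banach theorem for a seminorm\<close>

text \<open>Two difficulties shape the development. Infinite values and signs are dealt with once: a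
  lower bound \<open>c\<close> is subtracted and the functions become \<open>ennreal\<close> valued,
  so that integrals, convex combinations and infima are always defined. And the ambient space is
  only a vector space with seminorms, complete on \<open>A\<close> alone: barycenters and Jensen's
  inequality both come from discretising a measure over finer and finer partitions and passing to a
  limit inside \<open>A\<close>. Hahn-Banach serves there to bound a seminorm of a difference of
  averages by averages of that seminorm, and to separate points of \<open>A\<close>.

  The convex closures in (ii) detect escaping mass: a measure with barycenter \<open>b\<close> whose
  integral of \<open>f n\<close> is at least \<open>e\<close> pushes the convex closure of
  \<open>- f n\<close> at \<open>b\<close> down to \<open>- e\<close> or below. The weak topology is
  not shown to be metrizable, so compactness in it is tested on arbitrary filters, and the
  barycenter of a limit measure is located through a cluster point in \<open>K\<close>.\<close>

definition sublinear :: "('a::real_vector \<Rightarrow> real) \<Rightarrow> bool" where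
  "sublinear p \<longleftrightarrow> (\<forall>x y. p (x + y) \<le> p x + p y) \<and> (\<forall>c\<ge>0. \<forall>x. p (c *\<^sub>R x) \<le> c * p x)"

lemma sublinearD:
  assumes "sublinear p"
  shows "p (x + y) \<le> p x + p y" "c \<ge> 0 \<Longrightarrow> p (c *\<^sub>R x) = c * p x" "- p (- x) \<le> p x"
proof -
  show sub: "p (x + y) \<le> p x + p y" for x y
    using assms by (auto simp: sublinear_def)
  have le: "p (c *\<^sub>R x) \<le> c * p x" if "c \<ge> 0" for c x
    using assms that by (auto simp: sublinear_def)
  have 0: "p 0 = 0"
    using sub[of 0 0] le[of 0 0] by simp
  show "p (c *\<^sub>R x) = c * p x" if "c \<ge> 0"
  proof (cases "c = 0")
    case False
    then have "p ((1/c) *\<^sub>R c *\<^sub>R x) \<le> 1/c * p (c *\<^sub>R x)"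
      using that by (intro le) auto
    then show ?thesis
      using le[OF that, of x] False that by (auto simp: field_simps)
  qed (simp add: 0)
  show "- p (- x) \<le> p x"
    using sub[of x "-x"] 0 by simp
qed

text \<open>This is the largest sublinear functional below \<open>p\<close> whose value at
  \<open>- y\<close> is at most \<open>- p y\<close>: any such \<open>r\<close> satisfies \<open>r x
  \<le> r (x + t *\<^sub>R y) + t * r (- y) \<le> p (x + t *\<^sub>R y) - t * p y\<close>.\<close>

definition sublinear_along :: "('a::real_vector \<Rightarrow> real) \<Rightarrow> 'a \<Rightarrow> 'a \<Rightarrow> real" where
  "sublinear_along p y x = (INF t\<in>{0..}. p (x + t *\<^sub>R y) - t * p y)"

lemma sublinear_along:
  assumes p: "sublinear p"
  shows "sublinear (sublinear_along p y)" "sublinear_along p y x \<le> p x"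
    "sublinear_along p y (- y) \<le> - p y"
proof -
  \<comment> \<open>The bound does not depend on \<open>t\<close>, so the real infimum is taken over
    a set bounded below.\<close>
  have "- p (- x) \<le> p (x + t *\<^sub>R y) - t * p y" if "t \<ge> 0" for t x
    using sublinearD(1)[OF p, of "x + t *\<^sub>R y" "- x"] sublinearD(2)[OF p that, of y] by simp
  then have bdd: "bdd_below ((\<lambda>t. p (x + t *\<^sub>R y) - t * p y) ` {0..})" for x
    by (auto intro!: bdd_belowI2[where m = "- p (- x)"])
  have le: "sublinear_along p y x \<le> p (x + t *\<^sub>R y) - t * p y" if "t \<ge> 0" for t x
    unfolding sublinear_along_def by (rule cINF_lower[OF bdd]) (use that in auto)
  have ge: "c \<le> sublinear_along p y x"
    if "\<And>t. t \<ge> 0 \<Longrightarrow> c \<le> p (x + t *\<^sub>R y) - t * p y" for c x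
    unfolding sublinear_along_def by (rule cINF_greatest) (use that in auto)
  show "sublinear_along p y x \<le> p x"
    using le[of 0 x] by simp
  show "sublinear_along p y (- y) \<le> - p y"
    using le[of 1 "-y"] sublinearD(2)[OF p, of 0 0] by simp
  show "sublinear (sublinear_along p y)"
    unfolding sublinear_def
  proof (intro conjI allI impI)
    fix x x'
    have st: "sublinear_along p y (x + x') \<le> (p (x + t *\<^sub>R y) - t * p y) + (p (x' + t' *\<^sub>R y) - t' * p y)"
      if t: "t \<ge> 0" "t' \<ge> 0" for t t'
      using le[of "t + t'" "x + x'"] t sublinearD(1)[OF p, of "x + t *\<^sub>R y" "x' + t' *\<^sub>R y"]
      by (simp add: algebra_simps)
    have "sublinear_along p y (x + x') - (p (x + t *\<^sub>R y) - t * p y) \<le> sublinear_along p y x'"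
      if "t \<ge> 0" for t
      by (rule ge) (use st[OF that] in \<open>simp add: algebra_simps\<close>)
    then have "sublinear_along p y (x + x') - sublinear_along p y x' \<le> sublinear_along p y x"
      by (intro ge) (simp add: algebra_simps)
    then show "sublinear_along p y (x + x') \<le> sublinear_along p y x + sublinear_along p y x'"
      by simp
  next
    fix c :: real and x
    assume c: "c \<ge> 0"
    show "sublinear_along p y (c *\<^sub>R x) \<le> c * sublinear_along p y x"
    proof (cases "c = 0")
      case True
      then show ?thesis
        using le[of 0 0] sublinearD(2)[OF p, of 0 0] by simp
    next
      case False
      have "sublinear_along p y (c *\<^sub>R x) / c \<le> p (x + t *\<^sub>R y) - t * p y" if "t \<ge> 0" for t
        using le[of "c * t" "c *\<^sub>R x"] sublinearD(2)[OF p c, of "x + t *\<^sub>R y"] c that False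
        by (simp add: field_simps)
      then have "sublinear_along p y (c *\<^sub>R x) / c \<le> sublinear_along p y x"
        by (intro ge)
      then show ?thesis
        using c False by (simp add: field_simps)
    qed
  qed
qed

text \<open>Provides the lower bounds of chains for Zorn's lemma. An infimum of sublinear
  functionals need not be subadditive; here it is, because two members of a chain have a common
  smaller member in the chain.\<close>

lemma sublinear_INF_chain:
  assumes C: "\<And>p. p \<in> C \<Longrightarrow> sublinear p \<and> p \<le> q" "C \<noteq> {}"
    and chain: "\<And>p p'. p \<in> C \<Longrightarrow> p' \<in> C \<Longrightarrow> p \<le> p' \<or> p' \<le> p"
  shows "sublinear (\<lambda>x. INF p\<in>C. p x)" "p \<in> C \<Longrightarrow> (INF p\<in>C. p x) \<le> p x"
proof -
  have "- q (- x) \<le> p x" if "p \<in> C" for p x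
    using C(1)[OF that] sublinearD(3)[of p x] le_funD[of p q "- x"] by auto
  then have bdd: "bdd_below ((\<lambda>p. p x) ` C)" for x
    by (auto intro!: bdd_belowI2[where m = "- q (- x)"])
  have le: "(INF p\<in>C. p x) \<le> p x" if "p \<in> C" for x p
    by (rule cINF_lower[OF bdd that])
  then show "p \<in> C \<Longrightarrow> (INF p\<in>C. p x) \<le> p x" .
  show "sublinear (\<lambda>x. INF p\<in>C. p x)"
    unfolding sublinear_def
  proof (intro conjI allI impI)
    fix x y
    have st: "(INF p\<in>C. p (x + y)) \<le> p x + p' y" if p: "p \<in> C" "p' \<in> C" for p p'
    proof -
      obtain r where "r \<in> C" "r \<le> p" "r \<le> p'"
        using chain[OF p] p by auto
      then show ?thesis
        using le[of r "x + y"] C(1)[of r] sublinearD(1)[of r x y] le_funD[of r p x] le_funD[of r p' y]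
        by auto
    qed
    have "(INF p\<in>C. p (x + y)) - p x \<le> (INF p\<in>C. p y)" if "p \<in> C" for p
      by (rule cINF_greatest[OF C(2)]) (use st[OF that] in \<open>simp add: algebra_simps\<close>)
    then have "(INF p\<in>C. p (x + y)) - (INF p\<in>C. p y) \<le> (INF p\<in>C. p x)"
      using C(2) by (intro cINF_greatest) (auto simp: algebra_simps)
    then show "(INF p\<in>C. p (x + y)) \<le> (INF p\<in>C. p x) + (INF p\<in>C. p y)"
      by simp
  next
    fix c :: real and x :: 'a
    assume c: "c \<ge> 0"
    have eq: "p (c *\<^sub>R x) = c * p x" if "p \<in> C" for p
      using C(1)[OF that] sublinearD(2) c by blast
    show "(INF p\<in>C. p (c *\<^sub>R x)) \<le> c * (INF p\<in>C. p x)"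
    proof (cases "c = 0")
      case True
      then show ?thesis
        using C(2) eq le[of _ 0] by fastforce
    next
      case False
      have "(INF p\<in>C. p (c *\<^sub>R x)) / c \<le> (INF p\<in>C. p x)"
        using C(2) c False le[of _ "c *\<^sub>R x"] eq
        by (intro cINF_greatest) (auto simp: field_simps)
      then show ?thesis
        using c False by (simp add: field_simps)
    qed
  qed
qed

text \<open>A minimal sublinear functional \<open>m\<close> coincides with all its \<open>sublinear_along m y\<close> and is
  therefore odd, hence linear.\<close>

lemma linear_below_sublinear:
  fixes q :: "'a::real_vector \<Rightarrow> real"
  assumes q: "sublinear q"
  obtains l where "linear l" "\<And>x. l x \<le> q x"
proof -
  define S where "S = {p. sublinear p \<and> p \<le> q}"
  have "\<exists>m\<in>S. \<forall>p\<in>S. p \<le> m \<longrightarrow> p = m"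
  \<comment> \<open>The order is reversed, so a maximal element is a minimal sublinear
    functional.\<close>
  proof (rule predicate_Zorn[of S "\<lambda>p p'. p' \<le> p"])
    show "partial_order_on S (relation_of (\<lambda>p p'. p' \<le> p) S)"
      by (rule partial_order_on_relation_ofI) auto
    fix C
    assume "C \<in> Chains (relation_of (\<lambda>p p'. p' \<le> p) S)"
    then have C: "p \<in> S" "p' \<in> S" "p \<le> p' \<or> p' \<le> p" if "p \<in> C" "p' \<in> C" for p p'
      using that by (auto simp: Chains_def relation_of_def)
    show "\<exists>u\<in>S. \<forall>a\<in>C. u \<le> a"
    proof (cases "C = {}")
      case True
      then show ?thesis using q by (auto simp: S_def)
    next
      case False
      have 1: "sublinear p \<and> p \<le> q" if "p \<in> C" for p
        using C(1)[OF that that] by (simp add: S_def)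
      note chain = sublinear_INF_chain[of C q, OF 1 False C(3)]
      have "(\<lambda>x. INF p\<in>C. p x) \<le> p" if "p \<in> C" for p
        using chain(2) that by (auto intro!: le_funI)
      moreover from this have "(\<lambda>x. INF p\<in>C. p x) \<in> S"
        using chain(1) False 1 unfolding S_def by (auto intro: order_trans)
      ultimately show ?thesis
        by (intro bexI[of _ "\<lambda>x. INF p\<in>C. p x"]) auto
    qed
  qed
  then obtain m where m: "sublinear m" "m \<le> q"
    and min: "\<And>p. sublinear p \<Longrightarrow> p \<le> m \<Longrightarrow> p = m"
    by (auto simp: S_def intro: order_trans)
  have "sublinear_along m y = m" for y
    by (rule min) (auto intro!: le_funI sublinear_along m)
  then have neg: "m (- y) = - m y" for y
    using sublinear_along(3)[OF m(1), of y] sublinearD(3)[OF m(1), of "-y"] by (auto intro!: antisym)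
  have "m (x + y) = m x + m y" for x y
    using sublinearD(1)[OF m(1), of x y] sublinearD(1)[OF m(1), of "x + y" "- y"] neg[of y]
    by simp
  moreover have "m (c *\<^sub>R x) = c * m x" for c x
  proof (cases "c \<ge> 0")
    case True
    then show ?thesis using sublinearD(2)[OF m(1)] by blast
  next
    case False
    then show ?thesis
      using sublinearD(2)[OF m(1), of "- c" "x"] neg[of "c *\<^sub>R x"] by simp
  qed
  ultimately have "linear m"
    by (auto intro!: linearI)
  with m(2) show ?thesis
    by (auto intro: that[of m] simp: le_fun_def)
qed

lemma seminormD:
  assumes "seminorm p"
  shows "p (x + y) \<le> p x + p y" "p (c *\<^sub>R x) = \<bar>c\<bar> * p x" "p 0 = 0" "p (- x) = p x"
    "0 \<le> p x" "p (x - y) = p (y - x)" "p (x - z) \<le> p (x - y) + p (y - z)"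
proof -
  show add: "p (x + y) \<le> p x + p y" and scale: "p (c *\<^sub>R x) = \<bar>c\<bar> * p x" for x y c
    using assms by (auto simp: seminorm_def)
  show 0: "p 0 = 0"
    using scale[of 0 0] by simp
  show neg: "p (- x) = p x" for x
    using scale[of "-1" x] by simp
  show "0 \<le> p x"
    using add[of x "-x"] 0 neg[of x] by simp
  show "p (x - y) = p (y - x)"
    using neg[of "x - y"] by simp
  show "p (x - z) \<le> p (x - y) + p (y - z)"
    using add[of "x - y" "y - z"] by simp
qed

text \<open>A linear functional below \<open>sublinear_along q x0\<close> lies below
  \<open>q\<close> and satisfies \<open>l (- x0) \<le> - q x0\<close>, which forces equality at
  \<open>x0\<close>. The domination by \<open>q\<close> makes \<open>l\<close> continuous as soon as
  \<open>q\<close> is one of the generating seminorms.\<close>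

theorem Hahn_Banach_seminorm:
  fixes q :: "'a::real_vector \<Rightarrow> real"
  assumes q: "seminorm q"
  obtains l where "linear l" "\<And>x. \<bar>l x\<bar> \<le> q x" "l x0 = q x0"
proof -
  have sq: "sublinear q"
    using seminormD[OF q] by (auto simp: sublinear_def)
  obtain l where l: "linear l" "\<And>x. l x \<le> sublinear_along q x0 x"
    using linear_below_sublinear[OF sublinear_along(1)[OF sq, of x0]] by auto
  have le: "l x \<le> q x" for x
    using l(2)[of x] sublinear_along(2)[OF sq, of x0 x] by simp
  show ?thesis
  proof
    show "linear l" by fact
    show "\<bar>l x\<bar> \<le> q x" for x
      using le[of x] le[of "-x"] linear_neg[OF l(1), of x] seminormD(4)[OF q, of x] by auto
    show "l x0 = q x0"
      using l(2)[of "-x0"] sublinear_along(3)[OF sq, of x0] le[of x0] linear_neg[OF l(1), of x0] by auto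
  qed
qed

subsection \<open>Compactness by cluster points of filters\<close>

lemma compactin_imp_cluster:
  assumes K: "compactin X K" and F: "F \<noteq> bot" "eventually (\<lambda>z. z \<in> K) F"
  obtains y where "y \<in> K" "\<And>U. openin X U \<Longrightarrow> y \<in> U \<Longrightarrow> frequently (\<lambda>z. z \<in> U) F"
proof (rule ccontr)
  assume "\<not> thesis"
  then have "\<forall>y\<in>K. \<exists>U. openin X U \<and> y \<in> U \<and> eventually (\<lambda>z. z \<notin> U) F"
    using that unfolding frequently_def by fastforce
  then obtain U where U: "\<And>y. y \<in> K \<Longrightarrow> openin X (U y) \<and> y \<in> U y \<and> eventually (\<lambda>z. z \<notin> U y) F"
    by metis
  have "\<exists>\<F>. finite \<F> \<and> \<F> \<subseteq> U ` K \<and> K \<subseteq> \<Union>\<F>"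
    by (rule compactinD[OF K]) (use U in auto)
  then obtain T where T: "finite T" "T \<subseteq> K" "K \<subseteq> \<Union>(U ` T)"
    by (metis finite_subset_image)
  have "eventually (\<lambda>z. \<forall>y\<in>T. z \<notin> U y) F"
    using T U by (auto simp: eventually_ball_finite_distrib)
  with F(2) have "eventually (\<lambda>z. False) F"
    by eventually_elim (use T in auto)
  with F(1) show False
    by (simp add: eventually_False)
qed

text \<open>If no finite part of an open cover covers \<open>K\<close>, the sets
  \<open>K - U\<close> generate a proper filter; a cluster point in \<open>K\<close> lies in some
  member \<open>U\<close> of the cover, which the filter eventually avoids.\<close>

lemma compactinI_cluster:
  assumes sub: "K \<subseteq> topspace X"
    and cl: "\<And>F. F \<noteq> bot \<Longrightarrow> eventually (\<lambda>z. z \<in> K) F \<Longrightarrow>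
      \<exists>y\<in>K. \<forall>U. openin X U \<longrightarrow> y \<in> U \<longrightarrow> frequently (\<lambda>z. z \<in> U) F"
  shows "compactin X K"
  unfolding compactin_def
proof (intro conjI allI impI sub)
  fix \<U>
  assume \<U>: "Ball \<U> (openin X) \<and> K \<subseteq> \<Union>\<U>"
  show "\<exists>\<F>. finite \<F> \<and> \<F> \<subseteq> \<U> \<and> K \<subseteq> \<Union>\<F>"
  proof (rule ccontr)
    assume no: "\<not> ?thesis"
    \<comment> \<open>The extra \<open>{}\<close> contributes \<open>principal K\<close>, so the
      filter lives on \<open>K\<close> even for an empty cover.\<close>
    define F where "F = (INF U\<in>insert {} \<U>. principal (K - U))"
    have "F \<noteq> bot"
      unfolding F_def
    proof (rule INF_filter_not_bot)
      fix \<V>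
      assume V: "\<V> \<subseteq> insert {} \<U>" "finite \<V>"
      have "K - \<Union>\<V> \<noteq> {}"
      proof
        assume *: "K - \<Union>\<V> = {}"
        have "finite (\<V> - {{}})" "\<V> - {{}} \<subseteq> \<U>" "K \<subseteq> \<Union>(\<V> - {{}})"
          using V * by auto
        with no show False by blast
      qed
      moreover have "principal (K - \<Union>\<V>) \<le> (INF U\<in>\<V>. principal (K - U))"
        by (intro INF_greatest) auto
      ultimately show "(INF U\<in>\<V>. principal (K - U)) \<noteq> bot"
        by (metis bot.extremum_uniqueI principal_eq_bot_iff)
    qed
    moreover have F: "F \<le> principal (K - U)" if "U \<in> insert {} \<U>" for U
      unfolding F_def using that by (rule INF_lower)
    then have "eventually (\<lambda>z. z \<in> K) F"
      using F[of "{}"] by (auto simp: le_principal)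
    ultimately obtain y where y: "y \<in> K" "\<And>U. openin X U \<Longrightarrow> y \<in> U \<Longrightarrow> frequently (\<lambda>z. z \<in> U) F"
      using cl by blast
    then obtain U where U: "U \<in> \<U>" "y \<in> U"
      using \<U> by auto
    have "eventually (\<lambda>z. z \<notin> U) F"
      using F[of U] U(1) by (auto simp: le_principal elim: eventually_mono)
    with y(2)[of U] U \<U> show False
      by (auto simp: frequently_def)
  qed
qed

subsection \<open>Bounded continuous and lower semicontinuous functions\<close>

lemma Cb_iff:
  "f \<in> Cb X \<longleftrightarrow> continuous_map X euclideanreal f \<and> (\<exists>B. \<forall>x\<in>topspace X. \<bar>f x\<bar> \<le> B)"
  by (auto simp: Cb_def bounded_iff)

lemma Cb_obtain_bound:
  assumes "f \<in> Cb X"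
  obtains B where "0 < B" "\<And>x. x \<in> topspace X \<Longrightarrow> \<bar>f x\<bar> \<le> B"
proof -
  obtain B where "\<forall>x\<in>topspace X. \<bar>f x\<bar> \<le> B"
    using assms by (auto simp: Cb_iff)
  then show ?thesis
    by (intro that[of "max B 1"]) fastforce+
qed

lemma Cb_const [simp]: "(\<lambda>_. c) \<in> Cb X"
  by (auto simp: Cb_iff)

lemma Cb_add:
  assumes f: "f \<in> Cb X" and g: "g \<in> Cb X"
  shows "(\<lambda>x. f x + g x) \<in> Cb X"
proof -
  obtain B where B: "\<And>x. x \<in> topspace X \<Longrightarrow> \<bar>f x\<bar> \<le> B" using Cb_obtain_bound[OF f] by metis
  obtain C where C: "\<And>x. x \<in> topspace X \<Longrightarrow> \<bar>g x\<bar> \<le> C" using Cb_obtain_bound[OF g] by metis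
  have "\<bar>f x + g x\<bar> \<le> B + C" if "x \<in> topspace X" for x
    using B[OF that] C[OF that] by linarith
  then show ?thesis
    using f g unfolding Cb_iff by (auto intro!: continuous_map_add)
qed

lemma Cb_cmult:
  assumes f: "f \<in> Cb X"
  shows "(\<lambda>x. c * f x) \<in> Cb X"
proof -
  obtain B where B: "\<And>x. x \<in> topspace X \<Longrightarrow> \<bar>f x\<bar> \<le> B" using Cb_obtain_bound[OF f] by metis
  have "\<bar>c * f x\<bar> \<le> \<bar>c\<bar> * B" if "x \<in> topspace X" for x
    using mult_left_mono[OF B[OF that], of "\<bar>c\<bar>"] by (simp add: abs_mult)
  then show ?thesis
    using f unfolding Cb_iff by (auto intro!: continuous_map_real_mult)
qed

lemma Cb_diff: "f \<in> Cb X \<Longrightarrow> g \<in> Cb X \<Longrightarrow> (\<lambda>x. f x - g x) \<in> Cb X"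
  using Cb_add[of f X "\<lambda>x. - 1 * g x"] Cb_cmult[of g X "-1"] by simp

lemma Cb_sum: "(\<And>i. i \<in> I \<Longrightarrow> f i \<in> Cb X) \<Longrightarrow> (\<lambda>x. \<Sum>i\<in>I. f i x) \<in> Cb X"
  by (induction I rule: infinite_finite_induct) (auto intro: Cb_add)

lemma Cb_min: "f \<in> Cb X \<Longrightarrow> g \<in> Cb X \<Longrightarrow> (\<lambda>x. min (f x) (g x)) \<in> Cb X"
proof -
  assume f: "f \<in> Cb X" and g: "g \<in> Cb X"
  obtain B where B: "\<And>x. x \<in> topspace X \<Longrightarrow> \<bar>f x\<bar> \<le> B" using Cb_obtain_bound[OF f] by metis
  obtain C where C: "\<And>x. x \<in> topspace X \<Longrightarrow> \<bar>g x\<bar> \<le> C" using Cb_obtain_bound[OF g] by metis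
  have "\<bar>min (f x) (g x)\<bar> \<le> max B C" if "x \<in> topspace X" for x
    using B[OF that] C[OF that] by linarith
  then show ?thesis
    using f g unfolding Cb_iff by (auto intro!: continuous_map_real_min)
qed

lemma continuous_map_mtopology_lipschitz:
  fixes f :: "'a \<Rightarrow> real"
  assumes "Metric_space M d" "C \<ge> 0"
    and lip: "\<And>x y. x \<in> M \<Longrightarrow> y \<in> M \<Longrightarrow> f x \<le> f y + C * d x y"
  shows "continuous_map (Metric_space.mtopology M d) euclideanreal f"
proof -
  interpret Metric_space M d by fact
  have "\<exists>\<delta>>0. \<forall>x. x \<in> M \<and> d a x < \<delta> \<longrightarrow> dist (f a) (f x) < e" if a: "a \<in> M" and e: "e > 0" for a e
  \<comment> \<open>The \<open>+ 1\<close> covers the Lipschitz constant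
    \<open>C = 0\<close>.\<close>
  proof (intro exI[of _ "e / (C + 1)"] conjI allI impI)
    show "0 < e / (C + 1)" using e \<open>C \<ge> 0\<close> by auto
    fix x assume x: "x \<in> M \<and> d a x < e / (C + 1)"
    have "dist (f a) (f x) \<le> C * d a x"
      using lip[of a x] lip[of x a] x a by (auto simp: dist_real_def commute)
    also have "\<dots> \<le> (C + 1) * d a x"
      using x a by (simp add: algebra_simps)
    also have "\<dots> < e"
      using x \<open>C \<ge> 0\<close> by (simp add: field_simps)
    finally show "dist (f a) (f x) < e" .
  qed
  then show ?thesis
    using metric_continuous_map[OF Met_TC.Metric_space_axioms, of f] by simp
qed

text \<open>The approximations are Pasch-Hausdorff envelopes: \<open>g k\<close> is the largest
  \<open>k\<close>-Lipschitz function below \<open>h\<close> truncated at \<open>k\<close>. The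
  truncation makes it real and bounded; lower semicontinuity gives the convergence. This is the
  bridge from semicontinuous functions to \<open>Cb X\<close>.\<close>

lemma lsc_on_approx:
  fixes h :: "'a \<Rightarrow> ennreal"
  assumes X: "metrizable_space X" and h: "lsc_on X h"
  obtains g :: "nat \<Rightarrow> 'a \<Rightarrow> real" where
    "\<And>k. g k \<in> Cb X" "\<And>k x. x \<in> topspace X \<Longrightarrow> 0 \<le> g k x"
    "\<And>k x. x \<in> topspace X \<Longrightarrow> g k x \<le> g (Suc k) x"
    "\<And>x. x \<in> topspace X \<Longrightarrow> (SUP k. ennreal (g k x)) = h x"
proof -
  obtain M d where M: "Metric_space M d" "X = Metric_space.mtopology M d"
    using X by (auto simp: metrizable_space_def)
  interpret Metric_space M d by fact
  have top: "topspace X = M" by (simp add: M)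
  define t where "t k y = enn2real (min (of_nat k) (h y))" for k :: nat and y
  have t_eq: "ennreal (t k y) = min (of_nat k) (h y)" for k y
    unfolding t_def by (rule ennreal_enn2real) (simp add: min_less_iff_disj of_nat_less_top)
  have t_nn: "0 \<le> t k y" for k y by (simp add: t_def)
  have t_le: "t k y \<le> k" for k y
    unfolding t_def by (rule enn2real_leI) (simp_all add: ennreal_of_nat_eq_real_of_nat)
  have t_mono: "t k y \<le> t (Suc k) y" for k y
    unfolding t_def
    by (intro enn2real_mono min.mono of_nat_mono) (auto simp: min_less_iff_disj of_nat_less_top)
  define g where "g k x = (INF y\<in>M. t k y + k * d x y)" for k :: nat and x
  have bdd: "bdd_below ((\<lambda>y. t k y + k * d x y) ` M)" for k x
    by (auto intro!: bdd_belowI2[of _ 0] add_nonneg_nonneg t_nn)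
  have g_le: "g k x \<le> t k y + k * d x y" if "y \<in> M" for k x y
    unfolding g_def by (rule cINF_lower[OF bdd that])
  have g_ge: "c \<le> g k x" if "x \<in> M" "\<And>y. y \<in> M \<Longrightarrow> c \<le> t k y + k * d x y" for c k x
    unfolding g_def by (rule cINF_greatest) (use that in auto)
  have nn: "0 \<le> g k x" if "x \<in> M" for k x
    by (rule g_ge[OF that]) (auto intro!: add_nonneg_nonneg t_nn)
  have g_t: "g k x \<le> t k x" if "x \<in> M" for k x
    using g_le[OF that, of k x] that by simp
  show ?thesis
  proof
    show "g k \<in> Cb X" for k
    proof -
      have "g k x \<le> g k x' + k * d x x'" if x: "x \<in> M" "x' \<in> M" for x x'
      proof -
        have "g k x - k * d x x' \<le> g k x'"
        proof (rule g_ge[OF x(2)])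
          fix y assume y: "y \<in> M"
          have "real k * d x y \<le> real k * (d x x' + d x' y)"
            using triangle[OF x y] by (intro mult_left_mono) auto
          then show "g k x - k * d x x' \<le> t k y + k * d x' y"
            using g_le[OF y, of k x] by (simp add: algebra_simps)
        qed
        then show ?thesis by simp
      qed
      then have "continuous_map X euclideanreal (g k)"
        unfolding M(2) by (rule continuous_map_mtopology_lipschitz[OF M(1), rotated]) auto
      moreover have "\<bar>g k x\<bar> \<le> k" if "x \<in> M" for x
        using nn[OF that, of k] g_t[OF that, of k] t_le[of k x] by linarith
      ultimately show ?thesis
        by (auto simp: Cb_iff top)
    qed
    show "0 \<le> g k x" if "x \<in> topspace X" for k x
      using nn that top by simp
    show "g k x \<le> g (Suc k) x" if "x \<in> topspace X" for k x
    proof (rule g_ge)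
      show "x \<in> M" using that top by simp
      fix y assume y: "y \<in> M"
      show "g k x \<le> t (Suc k) y + Suc k * d x y"
      proof -
        have "real k * d x y \<le> Suc k * d x y"
          by (intro mult_right_mono) auto
        then show ?thesis
          using g_le[OF y, of k x] t_mono[of k y] by linarith
      qed
    qed
    show "(SUP k. ennreal (g k x)) = h x" if "x \<in> topspace X" for x
    proof (rule antisym)
      have x: "x \<in> M" using that top by simp
      show "(SUP k. ennreal (g k x)) \<le> h x"
      proof (rule SUP_least)
        fix k
        have "ennreal (g k x) \<le> ennreal (t k x)"
          by (rule ennreal_leI) (rule g_t[OF x])
        then show "ennreal (g k x) \<le> h x"
          unfolding t_eq by simp
      qed
      show "h x \<le> (SUP k. ennreal (g k x))"
      proof (rule dense_le)
        fix c assume c: "c < h x"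
        then obtain r where r: "c = ennreal r" "0 \<le> r"
          by (cases c) auto
        have "openin mtopology {y \<in> M. c < h y}"
          using h by (auto simp: lsc_on_def M(2))
        then obtain \<delta> where \<delta>: "\<delta> > 0" "mball x \<delta> \<subseteq> {y \<in> M. c < h y}"
          using x c unfolding openin_mtopology by blast
        \<comment> \<open>Both terms of the maximum are used: near \<open>x\<close> the truncation
          at \<open>k \<ge> r\<close> stays above \<open>r\<close>, and at distance at least
          \<open>\<delta>\<close> the penalty \<open>k * \<delta>\<close> alone reaches
          \<open>r\<close>.\<close>
        obtain k :: nat where k: "max r (r / \<delta>) \<le> k"
          using real_arch_simple by blast
        have "r \<le> g k x"
        proof (rule g_ge[OF x])
          fix y assume y: "y \<in> M"
          show "r \<le> t k y + k * d x y"
          proof (cases "d x y < \<delta>")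
            case True
            then have "c < h y" using \<delta> x y by auto
            then have "ennreal r \<le> ennreal (t k y)"
              using k r unfolding t_eq by (auto simp: ennreal_of_nat_eq_real_of_nat intro: ennreal_leI)
            then have "r \<le> t k y" using t_nn[of k y] by simp
            then show ?thesis by (simp add: add_increasing2)
          next
            case False
            then have "k * \<delta> \<le> k * d x y"
              by (intro mult_left_mono) auto
            moreover have "r \<le> k * \<delta>"
              using k \<delta> by (auto simp: field_simps)
            ultimately have "r \<le> k * d x y" by simp
            then show ?thesis using t_nn[of k y] by linarith
          qed
        qed
        then have "c \<le> ennreal (g k x)"
          unfolding r by (rule ennreal_leI)
        then show "c \<le> (SUP k. ennreal (g k x))"
          by (rule order_trans) (rule SUP_upper, simp)
      qed
    qed
  qed
qed

lemma lsc_on_indicator: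
  assumes "openin X U"
  shows "lsc_on X (indicator U :: 'a \<Rightarrow> ennreal)"
proof -
  have "{x \<in> topspace X. c < (indicator U x :: ennreal)} = (if c < 1 then U else {})" for c
    using openin_subset[OF assms] by (auto simp: indicator_def split: if_splits)
  then show ?thesis
    using assms by (simp add: lsc_on_def)
qed

lemma second_countable_if_separable_metrizable:
  assumes X: "metrizable_space X" and sep: "separable_space X"
  obtains B :: "nat \<Rightarrow> 'a set" where "\<And>i. openin X (B i)"
    "\<And>U x. openin X U \<Longrightarrow> x \<in> U \<Longrightarrow> \<exists>i. x \<in> B i \<and> B i \<subseteq> U"
proof -
  obtain M d where M: "Metric_space M d" "X = Metric_space.mtopology M d"
    using X by (auto simp: metrizable_space_def)
  interpret Metric_space M d by fact
  obtain C where C: "countable C" "C \<subseteq> M" "mtopology closure_of C = M"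
    using sep by (auto simp: separable_space_def M(2))
  \<comment> \<open>The empty set makes the family nonempty also when \<open>C\<close> is empty, as
    the enumeration by \<open>from_nat_into\<close> requires.\<close>
  define \<B> where "\<B> = insert {} ((\<lambda>(c, n). mball c (1 / Suc n)) ` (C \<times> (UNIV :: nat set)))"
  have "\<exists>b\<in>\<B>. x \<in> b \<and> b \<subseteq> U" if U: "openin X U" "x \<in> U" for U x
  proof -
    obtain r where r: "r > 0" "mball x r \<subseteq> U" and x: "x \<in> M"
      using U unfolding M(2) openin_mtopology by blast
    obtain n where n: "1 / Suc n < r / 2"
      using r nat_approx_posE[of "r / 2"] by auto
    have "\<forall>r>0. \<exists>y\<in>C. y \<in> mball x r"
      using C(3) x by (auto simp only: metric_closure_of)
    then obtain c where c: "c \<in> C" "c \<in> mball x (1 / Suc n)"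
      by (meson of_nat_0_less_iff zero_less_Suc zero_less_divide_1_iff)
    have "x \<in> mball c (1 / Suc n)"
      using c by (auto simp: commute)
    moreover have "mball c (1 / Suc n) \<subseteq> mball x r"
    proof
      fix y assume "y \<in> mball c (1 / Suc n)"
      then show "y \<in> mball x r"
        using triangle[of x c y] c n by auto
    qed
    ultimately show ?thesis
      using c r unfolding \<B>_def by (intro bexI[of _ "mball c (1 / Suc n)"]) auto
  qed
  moreover have "countable \<B>" "\<B> \<noteq> {}"
    unfolding \<B>_def using C by auto
  then have "range (from_nat_into \<B>) = \<B>"
    by (rule range_from_nat_into[rotated])
  moreover have "openin X b" if "b \<in> \<B>" for b
    using that unfolding \<B>_def M(2) by auto
  ultimately show ?thesis
    by (intro that[of "from_nat_into \<B>"]) (metis rangeI, metis rangeE)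
qed

subsection \<open>Borel probability measures\<close>

lemma borel_prob_measuresD:
  assumes "\<mu> \<in> borel_prob_measures X"
  shows "prob_space \<mu>" "sets \<mu> = sets (sigma (topspace X) {U. openin X U})" "space \<mu> = topspace X"
    "\<And>U. openin X U \<Longrightarrow> U \<in> sets \<mu>"
proof -
  show "prob_space \<mu>" and s: "sets \<mu> = sets (sigma (topspace X) {U. openin X U})"
    using assms by (auto simp: borel_prob_measures_def)
  have sub: "{U. openin X U} \<subseteq> Pow (topspace X)"
    by (auto dest: openin_subset)
  show "space \<mu> = topspace X"
    using sets_eq_imp_space_eq[OF s] by (simp add: space_measure_of[OF sub])
  show "U \<in> sets \<mu>" if "openin X U" for U
    unfolding s sets_measure_of[OF sub] using that by auto
qed

lemma Cb_measurable:
  assumes "\<mu> \<in> borel_prob_measures X" "continuous_map X euclideanreal f"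
  shows "f \<in> borel_measurable \<mu>"
proof (rule borel_measurableI)
  fix S :: "real set" assume "open S"
  then have "openin X {x \<in> topspace X. f x \<in> S}"
    using assms(2) by (auto simp: continuous_map_def)
  moreover have "f -` S \<inter> space \<mu> = {x \<in> topspace X. f x \<in> S}"
    by (auto simp: borel_prob_measuresD(3)[OF assms(1)])
  ultimately show "f -` S \<inter> space \<mu> \<in> sets \<mu>"
    using borel_prob_measuresD(4)[OF assms(1)] by simp
qed

lemma lsc_measurable:
  fixes h :: "'a \<Rightarrow> 'b::{linorder_topology, second_countable_topology}"
  assumes "\<mu> \<in> borel_prob_measures X" "lsc_on X h"
  shows "h \<in> borel_measurable \<mu>"
  using assms borel_prob_measuresD(3,4)[OF assms(1)]
  by (intro borel_measurableI_greater) (auto simp: lsc_on_def)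

lemma Cb_integrable:
  assumes "\<mu> \<in> borel_prob_measures X" "f \<in> Cb X"
  shows "integrable \<mu> f"
proof -
  interpret prob_space \<mu> using assms borel_prob_measuresD by blast
  obtain B where "\<And>x. x \<in> topspace X \<Longrightarrow> \<bar>f x\<bar> \<le> B"
    using Cb_obtain_bound[OF assms(2)] by metis
  then show ?thesis
    using assms Cb_measurable[OF assms(1)] borel_prob_measuresD(3)[OF assms(1)]
    by (intro integrable_const_bound[where B = B]) (auto simp: Cb_def)
qed

lemma nn_integral_Cb:
  assumes "\<mu> \<in> borel_prob_measures X" "f \<in> Cb X" "\<And>x. x \<in> topspace X \<Longrightarrow> 0 \<le> f x"
  shows "(\<integral>\<^sup>+x. ennreal (f x) \<partial>\<mu>) = ennreal (\<integral>x. f x \<partial>\<mu>)"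
  using assms by (intro nn_integral_eq_integral Cb_integrable) (auto simp: borel_prob_measuresD(3))

lemma nn_integral_lsc_eq_SUP:
  assumes \<mu>: "\<mu> \<in> borel_prob_measures X"
    and g: "\<And>k. g k \<in> Cb X" "\<And>k x. x \<in> topspace X \<Longrightarrow> 0 \<le> g k x"
      "\<And>k x. x \<in> topspace X \<Longrightarrow> g k x \<le> g (Suc k) x"
      "\<And>x. x \<in> topspace X \<Longrightarrow> (SUP k. ennreal (g k x)) = h x"
  shows "(\<integral>\<^sup>+x. h x \<partial>\<mu>) = (SUP k. ennreal (\<integral>x. g k x \<partial>\<mu>))"
proof -
  note sp = borel_prob_measuresD(3)[OF \<mu>]
  have "(\<integral>\<^sup>+x. h x \<partial>\<mu>) = (\<integral>\<^sup>+x. (SUP k. ennreal (g k x)) \<partial>\<mu>)"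
    by (rule nn_integral_cong) (simp add: sp g)
  also have "\<dots> = (SUP k. \<integral>\<^sup>+x. ennreal (g k x) \<partial>\<mu>)"
    using g(1,3) Cb_measurable[OF \<mu>] sp
    by (intro nn_integral_monotone_convergence_SUP_AE) (auto intro!: ennreal_leI simp: Cb_def)
  finally show ?thesis
    using nn_integral_Cb[OF \<mu> g(1,2)] by simp
qed

lemma topspace_weak_topology: "topspace (weak_topology X) = borel_prob_measures X"
proof -
  have "\<mu> \<in> \<Union>{{\<mu> \<in> borel_prob_measures X. (\<integral>x. f x \<partial>\<mu>) \<in> U} |f U. f \<in> Cb X \<and> open U}"
    if "\<mu> \<in> borel_prob_measures X" for \<mu>
    using that Cb_const[of 0 X] open_UNIV by (intro UnionI[of "{\<mu> \<in> borel_prob_measures X. (\<integral>x. 0 \<partial>\<mu>) \<in> (UNIV::real set)}"]) blast+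
  then show ?thesis
    unfolding weak_topology_def topology_generated_by_topspace by blast
qed

lemma openin_weak_integral:
  assumes "f \<in> Cb X" "open U"
  shows "openin (weak_topology X) {\<mu> \<in> borel_prob_measures X. (\<integral>x. f x \<partial>\<mu>) \<in> U}"
  unfolding weak_topology_def by (rule topology_generated_by_Basis) (use assms in blast)

text \<open>One half of the portmanteau theorem: the integral of \<open>h\<close> is a supremum of
  integrals of functions in \<open>Cb X\<close>, so it depends lower semicontinuously on the
  measure.\<close>

lemma openin_weak_nn_integral:
  fixes h :: "'a \<Rightarrow> ennreal"
  assumes X: "metrizable_space X" and h: "lsc_on X h"
  shows "openin (weak_topology X) {\<mu> \<in> borel_prob_measures X. c < (\<integral>\<^sup>+x. h x \<partial>\<mu>)}"
proof -
  obtain g :: "nat \<Rightarrow> 'a \<Rightarrow> real" where g: "\<And>k. g k \<in> Cb X" "\<And>k x. x \<in> topspace X \<Longrightarrow> 0 \<le> g k x"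
    "\<And>k x. x \<in> topspace X \<Longrightarrow> g k x \<le> g (Suc k) x"
    "\<And>x. x \<in> topspace X \<Longrightarrow> (SUP k. ennreal (g k x)) = h x"
    using lsc_on_approx[OF X h] by blast
  have "{\<mu> \<in> borel_prob_measures X. c < (\<integral>\<^sup>+x. h x \<partial>\<mu>)} =
      (\<Union>k. {\<mu> \<in> borel_prob_measures X. (\<integral>x. g k x \<partial>\<mu>) \<in> ennreal -` {c<..}})"
    using nn_integral_lsc_eq_SUP[of _ X g h] g by (auto simp: less_SUP_iff)
  moreover have "open (ennreal -` {c<..})"
    by (intro open_vimage continuous_on_ennreal continuous_on_id) auto
  ultimately show ?thesis
    using openin_weak_integral[OF g(1), of "ennreal -` {c<..}"] by (simp only:) (rule openin_Union, blast)
qed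

text \<open>Convergence in an initial topology is tested on the subbase; the induction over
  generated open sets carries it to all of them.\<close>

lemma weak_topology_eventually:
  assumes "\<mu> \<in> W" "openin (weak_topology X) W"
    and F: "eventually (\<lambda>\<nu>. \<nu> \<in> borel_prob_measures X) F"
      "\<And>f. f \<in> Cb X \<Longrightarrow> ((\<lambda>\<nu>. \<integral>x. f x \<partial>\<nu>) \<longlongrightarrow> (\<integral>x. f x \<partial>\<mu>)) F"
  shows "eventually (\<lambda>\<nu>. \<nu> \<in> W) F"
proof -
  have "generate_topology_on {{\<mu> \<in> borel_prob_measures X. (\<integral>x. f x \<partial>\<mu>) \<in> U} |f U. f \<in> Cb X \<and> open U} W"
    using assms(2) unfolding weak_topology_def by (rule openin_topology_generated_by)
  then show ?thesis
    using assms(1)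
  proof induction
    case (Int a b)
    then show ?case by (auto intro: eventually_conj)
  next
    case (UN K)
    then obtain k where k: "k \<in> K" "\<mu> \<in> k" by auto
    with UN have "eventually (\<lambda>\<nu>. \<nu> \<in> k) F" by auto
    then show ?case by eventually_elim (use k in auto)
  next
    case (Basis s)
    then obtain f U where s: "s = {\<mu> \<in> borel_prob_measures X. (\<integral>x. f x \<partial>\<mu>) \<in> U}" "f \<in> Cb X" "open U"
      by auto
    with Basis have "eventually (\<lambda>\<nu>. (\<integral>x. f x \<partial>\<nu>) \<in> U) F"
      by (intro topological_tendstoD[OF F(2)]) auto
    with F(1) show ?case
      by eventually_elim (simp add: s)
  qed auto
qed

subsection \<open>The Daniell representation theorem on a metrizable space\<close>

text \<open>\<open>L_smooth\<close> is sigma-smoothness, which rules out mass escaping to infinity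
  and stands in for compact supports. Functions of \<open>Cb X\<close> may be arbitrary off
  \<open>topspace X\<close>; \<open>L_nonneg\<close>, applied to a difference and its negative,
  shows that \<open>L\<close> does not see this.\<close>

locale daniell_functional =
  fixes X :: "'a topology" and L :: "('a \<Rightarrow> real) \<Rightarrow> real"
  assumes metrizable: "metrizable_space X"
    and L_add: "\<And>f g. f \<in> Cb X \<Longrightarrow> g \<in> Cb X \<Longrightarrow> L (\<lambda>x. f x + g x) = L f + L g"
    and L_cmult: "\<And>f c. f \<in> Cb X \<Longrightarrow> L (\<lambda>x. c * f x) = c * L f"
    and L_nonneg: "\<And>f. f \<in> Cb X \<Longrightarrow> (\<And>x. x \<in> topspace X \<Longrightarrow> 0 \<le> f x) \<Longrightarrow> 0 \<le> L f"
    and L_one: "L (\<lambda>_. 1) = 1"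
    and L_smooth: "\<And>f. (\<And>n. f n \<in> Cb X) \<Longrightarrow> (\<And>n x. x \<in> topspace X \<Longrightarrow> f (Suc n) x \<le> f n x) \<Longrightarrow>
      (\<And>x. x \<in> topspace X \<Longrightarrow> (\<lambda>n. f n x) \<longlonglongrightarrow> 0) \<Longrightarrow> (\<lambda>n. L (f n)) \<longlonglongrightarrow> 0"
begin

lemma L_diff: "f \<in> Cb X \<Longrightarrow> g \<in> Cb X \<Longrightarrow> L (\<lambda>x. f x - g x) = L f - L g"
  using L_add[of f "\<lambda>x. - 1 * g x"] L_cmult[of g "-1"] Cb_cmult[of g X "-1"] by simp

lemma L_mono:
  "f \<in> Cb X \<Longrightarrow> g \<in> Cb X \<Longrightarrow> (\<And>x. x \<in> topspace X \<Longrightarrow> f x \<le> g x) \<Longrightarrow> L f \<le> L g"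
  using L_nonneg[of "\<lambda>x. g x - f x"] L_diff[of g f] Cb_diff[of g X f] by auto

lemma L_const: "L (\<lambda>_. c) = c"
  using L_cmult[of "\<lambda>_. 1" c] L_one by simp

lemma L_sum: "(\<And>i. i \<in> I \<Longrightarrow> f i \<in> Cb X) \<Longrightarrow> L (\<lambda>x. \<Sum>i\<in>I. f i x) = (\<Sum>i\<in>I. L (f i))"
  by (induction I rule: infinite_finite_induct) (auto simp: L_const L_add Cb_sum)

lemma L_incseq:
  assumes "\<And>n. f n \<in> Cb X" "g \<in> Cb X" "\<And>n x. x \<in> topspace X \<Longrightarrow> f n x \<le> f (Suc n) x"
    and "\<And>x. x \<in> topspace X \<Longrightarrow> (\<lambda>n. f n x) \<longlonglongrightarrow> g x"
  shows "(\<lambda>n. L (f n)) \<longlonglongrightarrow> L g"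
proof -
  have "(\<lambda>n. L (\<lambda>x. g x - f n x)) \<longlonglongrightarrow> 0"
  proof (rule L_smooth)
    show "(\<lambda>n. g x - f n x) \<longlonglongrightarrow> 0" if "x \<in> topspace X" for x
      using tendsto_diff[OF tendsto_const assms(4)[OF that], of "g x"] by simp
  qed (auto intro!: Cb_diff assms)
  then have "(\<lambda>n. L g - (L g - L (f n))) \<longlonglongrightarrow> L g - 0"
    using assms by (intro tendsto_diff tendsto_const) (simp add: L_diff)
  then show ?thesis by simp
qed

section \<open>The outer measure induced by a Daniell functional\<close>

definition below_set :: "'a set \<Rightarrow> ('a \<Rightarrow> real) set" where
  "below_set U = {f \<in> Cb X. \<forall>x\<in>topspace X. 0 \<le> f x \<and> f x \<le> indicator U x}"

text \<open>As in the Riesz representation theorem, open sets are measured from inside by functions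
  below the indicator, and arbitrary sets from outside by open sets.\<close>

definition open_measure :: "'a set \<Rightarrow> ennreal" where
  "open_measure U = (SUP f\<in>below_set U. ennreal (L f))"

definition outer :: "'a set \<Rightarrow> ennreal" where
  "outer E = (INF U\<in>{U. openin X U \<and> E \<subseteq> U}. open_measure U)"

lemma open_measure_upper: "f \<in> below_set U \<Longrightarrow> ennreal (L f) \<le> open_measure U"
  unfolding open_measure_def by (rule SUP_upper)

lemma open_measure_mono: "U \<subseteq> V \<Longrightarrow> open_measure U \<le> open_measure V"
  unfolding open_measure_def
proof (rule SUP_subset_mono)
  assume "U \<subseteq> V"
  then have "indicator U x \<le> (indicator V x :: real)" for x
    by (auto simp: indicator_def)
  then show "below_set U \<subseteq> below_set V"
    unfolding below_set_def by (auto intro: order_trans)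
qed simp

lemma open_measure_le_1: "open_measure U \<le> 1"
  unfolding open_measure_def
proof (rule SUP_least)
  fix f assume f: "f \<in> below_set U"
  have "L f \<le> L (\<lambda>_. 1)"
    using f by (intro L_mono) (auto simp: below_set_def intro: order_trans[OF _ indicator_le_1])
  then show "ennreal (L f) \<le> 1"
    by (simp add: L_one)
qed

lemma open_measure_topspace: "open_measure (topspace X) = 1"
  using open_measure_upper[of "\<lambda>_. 1" "topspace X"] open_measure_le_1
  by (auto simp: below_set_def L_one intro: antisym)

lemma outer_open: "openin X U \<Longrightarrow> outer U = open_measure U"
  unfolding outer_def by (rule antisym) (auto intro: INF_lower INF_greatest open_measure_mono)

lemma outer_mono: "E \<subseteq> F \<Longrightarrow> outer E \<le> outer F"
  unfolding outer_def by (rule INF_superset_mono) auto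

lemma outer_empty: "outer {} = 0"
proof -
  have "L f \<le> L (\<lambda>_. 0)" if "f \<in> below_set {}" for f
    using that by (intro L_mono) (auto simp: below_set_def)
  then have "open_measure {} \<le> 0"
    unfolding open_measure_def by (intro SUP_least) (auto simp: L_const ennreal_neg)
  then show ?thesis by (simp add: outer_open)
qed

text \<open>Countable subadditivity is where sigma-smoothness enters, through
  \<open>L_incseq\<close>. The indicator of each \<open>U i\<close> is approximated from below by
  continuous \<open>g i k\<close>, and \<open>f\<close> is the increasing limit of its minima with
  finite sums of these.\<close>

lemma open_measure_Union:
  fixes U :: "nat \<Rightarrow> 'a set"
  assumes U: "\<And>i. openin X (U i)"
  shows "open_measure (\<Union>i. U i) \<le> (\<Sum>i. open_measure (U i))"
  unfolding open_measure_def[of "\<Union>i. U i"]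
proof (rule SUP_least)
  fix f assume "f \<in> below_set (\<Union>i. U i)"
  then have f: "f \<in> Cb X" "\<And>x. x \<in> topspace X \<Longrightarrow> 0 \<le> f x"
      "\<And>x. x \<in> topspace X \<Longrightarrow> f x \<le> indicator (\<Union>i. U i) x"
    by (auto simp: below_set_def)
  have "\<exists>g :: nat \<Rightarrow> 'a \<Rightarrow> real. (\<forall>k. g k \<in> below_set (U i)) \<and>
      (\<forall>k. \<forall>x\<in>topspace X. g k x \<le> g (Suc k) x) \<and>
      (\<forall>x\<in>topspace X. (\<lambda>k. g k x) \<longlonglongrightarrow> indicator (U i) x)" for i
  proof -
    obtain g :: "nat \<Rightarrow> 'a \<Rightarrow> real" where g: "\<And>k. g k \<in> Cb X" "\<And>k x. x \<in> topspace X \<Longrightarrow> 0 \<le> g k x"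
      "\<And>k x. x \<in> topspace X \<Longrightarrow> g k x \<le> g (Suc k) x"
      "\<And>x. x \<in> topspace X \<Longrightarrow> (SUP k. ennreal (g k x)) = indicator (U i) x"
      using lsc_on_approx[OF metrizable lsc_on_indicator[OF U[of i]]] by blast
    have lim: "(\<lambda>k. g k x) \<longlonglongrightarrow> indicator (U i) x" if x: "x \<in> topspace X" for x
    proof -
      have "(\<lambda>k. ennreal (g k x)) \<longlonglongrightarrow> (SUP k. ennreal (g k x))"
        using g(3)[OF x] by (intro LIMSEQ_SUP incseq_SucI ennreal_leI) auto
      then have "(\<lambda>k. ennreal (g k x)) \<longlonglongrightarrow> ennreal (indicator (U i) x)"
        using g(4)[OF x] by (simp add: ennreal_indicator)
      then show ?thesis
        using g(2)[OF x] by (subst (asm) tendsto_ennreal_iff) auto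
    qed
    have "g k x \<le> indicator (U i) x" if x: "x \<in> topspace X" for k x
      by (rule incseq_le[OF incseq_SucI lim[OF x]]) (rule g(3)[OF x])
    then show ?thesis
      using g lim by (intro exI[of _ g]) (auto simp: below_set_def)
  qed
  then obtain g :: "nat \<Rightarrow> nat \<Rightarrow> 'a \<Rightarrow> real" where g: "\<And>i k. g i k \<in> below_set (U i)"
      "\<And>i k x. x \<in> topspace X \<Longrightarrow> g i k x \<le> g i (Suc k) x"
      "\<And>i x. x \<in> topspace X \<Longrightarrow> (\<lambda>k. g i k x) \<longlonglongrightarrow> indicator (U i) x"
    by metis
  have gC: "g i k \<in> Cb X" and g0: "x \<in> topspace X \<Longrightarrow> 0 \<le> g i k x" for i k x
    using g(1)[of i k] by (auto simp: below_set_def)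
  \<comment> \<open>Diagonal choice: the number of summands and the quality of each approximation
    grow with the same index, so one increasing sequence results.\<close>
  define F where "F n x = min (f x) (\<Sum>i<n. g i n x)" for n x
  have FC: "F n \<in> Cb X" for n
    unfolding F_def by (intro Cb_min f Cb_sum gC)
  have "(\<lambda>n. L (F n)) \<longlonglongrightarrow> L f"
  proof (rule L_incseq[OF FC f(1)])
    fix n x assume x: "x \<in> topspace X"
    have "(\<Sum>i<n. g i n x) \<le> (\<Sum>i<Suc n. g i (Suc n) x)"
      using g(2)[OF x] g0[OF x] by (auto intro!: add_increasing2 sum_mono)
    then show "F n x \<le> F (Suc n) x"
      unfolding F_def by (intro min.mono) auto
  next
    fix x assume x: "x \<in> topspace X"
    show "(\<lambda>n. F n x) \<longlonglongrightarrow> f x"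
    proof (cases "x \<in> (\<Union>i. U i)")
      case True
      then obtain j where j: "x \<in> U j" by auto
      \<comment> \<open>A single set containing \<open>x\<close> suffices, since its approximations
        tend to 1 and \<open>f x \<le> 1\<close>.\<close>
      have "(\<lambda>n. min (f x) (g j n x)) \<longlonglongrightarrow> min (f x) 1"
        using g(3)[OF x, of j] j by (intro tendsto_min tendsto_const) simp
      then have lim: "(\<lambda>n. min (f x) (g j n x)) \<longlonglongrightarrow> f x"
        using f(3)[OF x] True by (simp add: min_def)
      show ?thesis
      proof (rule tendsto_sandwich[OF _ _ lim tendsto_const])
        have "g j n x \<le> (\<Sum>i<n. g i n x)" if "n > j" for n
          using that g0[OF x] by (intro member_le_sum) auto
        then show "\<forall>\<^sub>F n in sequentially. min (f x) (g j n x) \<le> F n x"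
          unfolding F_def by (intro eventually_mono[OF eventually_gt_at_top[of j]] min.mono) auto
        show "\<forall>\<^sub>F n in sequentially. F n x \<le> f x"
          by (simp add: F_def)
      qed
    next
      case False
      then have "f x = 0" using f(2,3)[OF x] by simp
      moreover have "0 \<le> (\<Sum>i<n. g i n x)" for n
        using g0[OF x] by (intro sum_nonneg) auto
      ultimately have "F n x = f x" for n
        by (simp add: F_def min_absorb1)
      then show ?thesis by simp
    qed
  qed
  then have lim: "(\<lambda>n. ennreal (L (F n))) \<longlonglongrightarrow> ennreal (L f)"
    by (rule tendsto_ennrealI)
  have "ennreal (L (F n)) \<le> (\<Sum>i. open_measure (U i))" for n
  proof -
    have "L (F n) \<le> L (\<lambda>x. \<Sum>i<n. g i n x)"
      by (intro L_mono FC Cb_sum gC) (simp add: F_def)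
    then have "ennreal (L (F n)) \<le> ennreal (\<Sum>i<n. L (g i n))"
      by (subst (asm) L_sum) (auto intro: gC ennreal_leI)
    also have "\<dots> = (\<Sum>i<n. ennreal (L (g i n)))"
      by (intro sum_ennreal[symmetric] L_nonneg gC g0)
    also have "\<dots> \<le> (\<Sum>i<n. open_measure (U i))"
      by (intro sum_mono open_measure_upper g)
    also have "\<dots> \<le> (\<Sum>i. open_measure (U i))"
      by (rule sum_le_suminf) auto
    finally show ?thesis .
  qed
  then show "ennreal (L f) \<le> (\<Sum>i. open_measure (U i))"
    by (intro LIMSEQ_le_const2[OF lim]) auto
qed

lemma outer_Union:
  fixes E :: "nat \<Rightarrow> 'a set"
  assumes E: "\<And>i. E i \<subseteq> topspace X"
  shows "outer (\<Union>i. E i) \<le> (\<Sum>i. outer (E i))"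
proof (rule ennreal_le_epsilon)
  fix e :: real assume e: "0 < e"
  have "\<exists>U. openin X U \<and> E i \<subseteq> U \<and> open_measure U \<le> outer (E i) + ennreal e * ennreal ((1/2) ^ Suc i)" for i
  proof -
    have "outer (E i) \<le> outer (topspace X)"
      by (rule outer_mono[OF E])
    then have "outer (E i) < top"
      using open_measure_topspace by (simp add: outer_open order.strict_trans1)
    then have "outer (E i) < outer (E i) + ennreal e * ennreal ((1/2) ^ Suc i)"
      using e by (simp add: ennreal_mult[symmetric] less_top)
    then show ?thesis
      unfolding outer_def[of "E i"] INF_less_iff by (auto intro: less_imp_le)
  qed
  then obtain U where U: "\<And>i. openin X (U i)" "\<And>i. E i \<subseteq> U i"
      "\<And>i. open_measure (U i) \<le> outer (E i) + ennreal e * ennreal ((1/2) ^ Suc i)"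
    by metis
  have "outer (\<Union>i. E i) \<le> outer (\<Union>i. U i)"
    using U(2) by (intro outer_mono) blast
  also have "\<dots> = open_measure (\<Union>i. U i)"
    using U(1) by (intro outer_open openin_Union) auto
  also have "\<dots> \<le> (\<Sum>i. open_measure (U i))"
    by (rule open_measure_Union[OF U(1)])
  also have "\<dots> \<le> (\<Sum>i. outer (E i) + ennreal e * ennreal ((1/2) ^ Suc i))"
    by (intro suminf_le U) auto
  also have "\<dots> = (\<Sum>i. outer (E i)) + (\<Sum>i. ennreal e * ennreal ((1/2) ^ Suc i))"
    by (rule suminf_add[symmetric]) auto
  also have "(\<Sum>i. ennreal e * ennreal ((1/2) ^ Suc i)) = ennreal e"
    unfolding ennreal_suminf_cmult
    by (subst suminf_ennreal_eq[OF zero_le_power power_half_series]) auto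
  finally show "outer (\<Union>i. E i) \<le> (\<Sum>i. outer (E i)) + ennreal e" .
qed

lemma outer_measure_space_outer: "outer_measure_space (Pow (topspace X)) outer"
  unfolding outer_measure_space_def positive_def increasing_def countably_subadditive_def
  using outer_empty outer_mono outer_Union by (simp add: image_subset_iff)

text \<open>\<open>V - U\<close> need not be open, but a function \<open>f\<close> below
  \<open>V \<inter> U\<close> vanishes there, so it lies in the open part \<open>W\<close> of
  \<open>V\<close> where \<open>f < \<delta>\<close>. If \<open>h\<close> is below \<open>W\<close>,
  then \<open>f + h\<close> is at most \<open>1 + \<delta>\<close> on \<open>V\<close> and vanishes
  elsewhere on the space; dividing by \<open>1 + \<delta>\<close> gives a function below
  \<open>V\<close>. Then \<open>\<delta>\<close> tends to 0, and the supremum over \<open>f\<close>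
  is taken last.\<close>

lemma open_split:
  assumes U: "openin X U" and V: "openin X V"
  shows "open_measure (V \<inter> U) + outer (V - U) \<le> open_measure V"
proof -
  have *: "ennreal (L f) + outer (V - U) \<le> open_measure V" if "f \<in> below_set (V \<inter> U)" for f
  proof -
    have f: "f \<in> Cb X" "\<And>x. x \<in> topspace X \<Longrightarrow> 0 \<le> f x"
      "\<And>x. x \<in> topspace X \<Longrightarrow> f x \<le> indicator (V \<inter> U) x"
      using that by (auto simp: below_set_def)
    have Lf: "0 \<le> L f" using f by (intro L_nonneg)
    have bound: "ennreal (L f) + outer (V - U) \<le> ennreal (1 + \<delta>) * open_measure V" if \<delta>: "\<delta> > 0" for \<delta>
    proof -
      define W where "W = V \<inter> {x \<in> topspace X. f x \<in> {..<\<delta>}}"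
      have "openin X {x \<in> topspace X. f x \<in> {..<\<delta>}}"
        using f(1) by (intro openin_continuous_map_preimage[of X euclideanreal]) (auto simp: Cb_def)
      then have W: "openin X W"
        unfolding W_def using V by (intro openin_Int)
      have "V - U \<subseteq> W"
        using openin_subset[OF V] f(3) \<delta> by (force simp: W_def indicator_def)
      then have "outer (V - U) \<le> open_measure W"
        using outer_mono[of "V - U" W] outer_open[OF W] by simp
      also have "\<dots> \<le> ennreal (1 + \<delta>) * open_measure V - ennreal (L f)"
        unfolding open_measure_def[of W]
      proof (rule SUP_least)
        fix h assume "h \<in> below_set W"
        then have h: "h \<in> Cb X" "\<And>x. x \<in> topspace X \<Longrightarrow> 0 \<le> h x"
            "\<And>x. x \<in> topspace X \<Longrightarrow> h x \<le> indicator W x"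
          by (auto simp: below_set_def)
        have "f x + h x \<le> (1 + \<delta>) * indicator V x" if x: "x \<in> topspace X" for x
          using f(2,3)[OF x] h(2,3)[OF x] x \<delta>
          by (auto simp: W_def indicator_def of_bool_def split: if_splits)
        then have "(\<lambda>x. (1 / (1 + \<delta>)) * (f x + h x)) \<in> below_set V"
          unfolding below_set_def using \<delta> f h
          by (auto intro!: Cb_cmult[where c = "1 / (1 + \<delta>)", simplified] Cb_add add_nonneg_nonneg divide_nonneg_nonneg
              simp: divide_le_eq mult.commute)
        from open_measure_upper[OF this]
        have "ennreal ((1 / (1 + \<delta>)) * (L f + L h)) \<le> open_measure V"
          by (subst (asm) L_cmult) (auto simp: L_add f h intro: Cb_add)
        then have "ennreal (1 + \<delta>) * ennreal ((1 / (1 + \<delta>)) * (L f + L h)) \<le> ennreal (1 + \<delta>) * open_measure V"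
          by (rule mult_left_mono) auto
        moreover have "0 \<le> L h" using h by (intro L_nonneg)
        ultimately have "ennreal (L f + L h) \<le> ennreal (1 + \<delta>) * open_measure V"
          using \<delta> Lf by (simp add: ennreal_mult[symmetric] del: ennreal_plus)
        then have "ennreal (L h) + ennreal (L f) \<le> ennreal (1 + \<delta>) * open_measure V"
          using Lf \<open>0 \<le> L h\<close> by (simp add: ennreal_plus[symmetric] add.commute del: ennreal_plus)
        then show "ennreal (L h) \<le> ennreal (1 + \<delta>) * open_measure V - ennreal (L f)"
          by (simp add: ennreal_le_minus_iff)
      qed
      finally have "outer (V - U) + ennreal (L f) \<le> ennreal (1 + \<delta>) * open_measure V - ennreal (L f) + ennreal (L f)"
        by (rule add_right_mono)
      also have "\<dots> = ennreal (1 + \<delta>) * open_measure V"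
      proof (rule diff_add_cancel_ennreal)
        have "ennreal (L f) \<le> open_measure (V \<inter> U)"
          by (rule open_measure_upper[OF \<open>f \<in> below_set (V \<inter> U)\<close>])
        also have "\<dots> \<le> 1 * open_measure V"
          by (simp add: open_measure_mono)
        also have "\<dots> \<le> ennreal (1 + \<delta>) * open_measure V"
          using \<delta> by (intro mult_right_mono) auto
        finally show "ennreal (L f) \<le> ennreal (1 + \<delta>) * open_measure V" .
      qed
      finally show ?thesis by (simp add: add.commute)
    qed
    show ?thesis
    proof (rule ennreal_le_epsilon)
      fix e :: real assume e: "0 < e"
      have "ennreal (1 + e) * open_measure V = open_measure V + ennreal e * open_measure V"
        using e by (simp add: ennreal_plus distrib_right)
      also have "\<dots> \<le> open_measure V + ennreal e * 1"
        using open_measure_le_1 by (intro add_left_mono mult_left_mono) auto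
      finally show "ennreal (L f) + outer (V - U) \<le> open_measure V + ennreal e"
        using order_trans[OF bound[OF e]] by simp
    qed
  qed
  have "open_measure (V \<inter> U) \<le> open_measure V - outer (V - U)"
    unfolding open_measure_def[of "V \<inter> U"]
    by (rule SUP_least) (use * in \<open>simp add: ennreal_le_minus_iff\<close>)
  then have "open_measure (V \<inter> U) + outer (V - U) \<le> open_measure V - outer (V - U) + outer (V - U)"
    by (rule add_right_mono)
  also have "\<dots> = open_measure V"
    using outer_mono[of "V - U" V] by (intro diff_add_cancel_ennreal) (simp add: outer_open[OF V])
  finally show ?thesis .
qed

text \<open>Passing to open sets \<open>V\<close> around an arbitrary test set \<open>E\<close>
  reduces Caratheodory's condition to \<open>open_split\<close>; the reverse inequality is
  subadditivity for a sequence padded with empty sets.\<close>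

lemma open_in_lambda_system:
  assumes U: "openin X U"
  shows "U \<in> lambda_system (topspace X) (Pow (topspace X)) outer"
proof -
  have "outer (U \<inter> E) + outer ((topspace X - U) \<inter> E) = outer E" if E: "E \<subseteq> topspace X" for E
  proof (rule antisym)
    show "outer (U \<inter> E) + outer ((topspace X - U) \<inter> E) \<le> outer E"
      unfolding outer_def[of E]
    proof (rule INF_greatest)
      fix V assume V: "V \<in> {U. openin X U \<and> E \<subseteq> U}"
      then have "outer (U \<inter> E) + outer ((topspace X - U) \<inter> E) \<le> outer (V \<inter> U) + outer (V - U)"
        by (intro add_mono outer_mono) auto
      also have "\<dots> \<le> open_measure V"
        using open_split[OF U, of V] outer_open[OF openin_Int[OF _ U], of V] V by auto
      finally show "outer (U \<inter> E) + outer ((topspace X - U) \<inter> E) \<le> open_measure V" .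
    qed
    have "outer (\<Union>i. if i = 0 then U \<inter> E else if i = (1::nat) then (topspace X - U) \<inter> E else {})
      \<le> (\<Sum>i. outer (if i = 0 then U \<inter> E else if i = (1::nat) then (topspace X - U) \<inter> E else {}))"
      using E by (intro outer_Union) auto
    also have "\<dots> = (\<Sum>i\<in>{0, 1}. outer (if i = 0 then U \<inter> E else if i = (1::nat) then (topspace X - U) \<inter> E else {}))"
      by (rule suminf_finite) (auto simp: outer_empty)
    also have "(\<Union>i. if i = 0 then U \<inter> E else if i = (1::nat) then (topspace X - U) \<inter> E else {}) = E"
      using E by (auto split: if_splits)
    finally show "outer E \<le> outer (U \<inter> E) + outer ((topspace X - U) \<inter> E)"
      by simp
  qed
  then show ?thesis
    using openin_subset[OF U] by (auto simp: lambda_system_def)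
qed

lemma ex_measure_open:
  obtains \<mu> where "\<mu> \<in> borel_prob_measures X" "\<And>U. openin X U \<Longrightarrow> emeasure \<mu> U = open_measure U"
proof -
  interpret sigma_algebra "topspace X" "Pow (topspace X)"
    by (rule sigma_algebra_Pow)
  define \<Lambda> where "\<Lambda> = lambda_system (topspace X) (Pow (topspace X)) outer"
  have sub: "{U. openin X U} \<subseteq> Pow (topspace X)"
    by (auto dest: openin_subset)
  define B where "B = sigma_sets (topspace X) {U. openin X U}"
  have \<Lambda>: "sigma_algebra (topspace X) \<Lambda>" "positive \<Lambda> outer" "countably_additive \<Lambda> outer"
    using caratheodory_lemma[OF outer_measure_space_outer] by (auto simp: \<Lambda>_def measure_space_def)
  have B\<Lambda>: "B \<subseteq> \<Lambda>"
    unfolding B_def using open_in_lambda_system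
    by (intro sigma_algebra.sigma_sets_subset[OF \<Lambda>(1)]) (auto simp: \<Lambda>_def)
  have B: "sigma_algebra (topspace X) B"
    unfolding B_def by (rule sigma_algebra_sigma_sets[OF sub])
  \<comment> \<open>Caratheodory's sigma-algebra \<open>\<Lambda>\<close> may be larger than the
    Borel one, whereas \<open>borel_prob_measures\<close> asks for exactly the Borel sets, so
    \<open>outer\<close> is restricted to \<open>B\<close>.\<close>
  define \<mu> where "\<mu> = measure_of (topspace X) B outer"
  have em: "emeasure \<mu> S = outer S" if "S \<in> B" for S
    unfolding \<mu>_def
  proof (rule emeasure_measure_of_sigma[OF B _ _ that])
    show "positive B outer" using \<Lambda>(2) by (auto simp: positive_def)
    show "countably_additive B outer"
      using \<Lambda>(3) B\<Lambda> unfolding countably_additive_def by blast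
  qed
  have sets: "sets \<mu> = B"
    unfolding \<mu>_def by (rule sigma_algebra.sets_measure_of_eq[OF B])
  have space: "space \<mu> = topspace X"
    unfolding \<mu>_def by (rule sigma_algebra.space_measure_of_eq[OF B])
  have open_B: "U \<in> B" if "openin X U" for U
    unfolding B_def using that by auto
  show ?thesis
  proof
    show "emeasure \<mu> U = open_measure U" if "openin X U" for U
      using em[OF open_B[OF that]] outer_open[OF that] by simp
    have "emeasure \<mu> (space \<mu>) = 1"
      using em[OF open_B[OF openin_topspace]] by (simp add: space outer_open open_measure_topspace)
    then have "prob_space \<mu>"
      by (rule prob_spaceI)
    then show "\<mu> \<in> borel_prob_measures X"
      by (simp add: borel_prob_measures_def sets B_def sets_measure_of[OF sub])
  qed
qed

text \<open>A layer-cake argument. A function with values in \<open>[0, 1]\<close> is cut into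
  \<open>n\<close> layers \<open>s k\<close> of height \<open>1 / n\<close>. On the space,
  \<open>n * s k\<close> is at most the indicator of \<open>{f > k / n}\<close> and at least that of
  \<open>{f > (k + 1) / n}\<close>, so \<open>L\<close> of a layer is compared with the integral of
  the layer below it.\<close>

theorem Daniell_representation:
  obtains \<mu> where "\<mu> \<in> borel_prob_measures X" "\<And>f. f \<in> Cb X \<Longrightarrow> (\<integral>x. f x \<partial>\<mu>) = L f"
proof -
  obtain \<mu> where \<mu>: "\<mu> \<in> borel_prob_measures X" "\<And>U. openin X U \<Longrightarrow> emeasure \<mu> U = open_measure U"
    using ex_measure_open by blast
  interpret prob_space \<mu> using \<mu>(1) borel_prob_measuresD by blast
  note sp = borel_prob_measuresD(3)[OF \<mu>(1)]
  note int = Cb_integrable[OF \<mu>(1)]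
  have le: "L f \<le> (\<integral>x. f x \<partial>\<mu>)"
    if f: "f \<in> Cb X" "\<And>x. x \<in> topspace X \<Longrightarrow> 0 \<le> f x" "\<And>x. x \<in> topspace X \<Longrightarrow> f x \<le> 1" for f
  proof -
    have "L f \<le> (\<integral>x. f x \<partial>\<mu>) + 1 / real n" if n: "n > 0" for n :: nat
    proof -
      define s where "s k x = min (f x) (real (Suc k) / real n) - min (f x) (real k / real n)" for k x
      have s_nn: "0 \<le> s k x" for k x
        unfolding s_def using divide_right_mono[of "real k" "real (Suc k)" "real n"] by (simp add: min_def)
      have sC: "s k \<in> Cb X" for k
        unfolding s_def by (intro Cb_diff Cb_min f) auto
      have "(\<Sum>k<n. s k x) = f x" if "x \<in> topspace X" for x
        unfolding s_def using f(2,3)[OF that] n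
        by (subst sum_lessThan_telescope[of "\<lambda>k. min (f x) (real k / real n)"]) (simp add: min_def)
      then have "L f \<le> L (\<lambda>x. \<Sum>k<n. s k x)"
        by (intro L_mono f Cb_sum sC) simp
      also have "\<dots> = (\<Sum>k<n. L (s k))"
        by (rule L_sum[OF sC])
      \<comment> \<open>The comparison shifts the index by one; the bottom layer has no predecessor
        and costs \<open>1 / n\<close>, which disappears in the limit.\<close>
      also have "\<dots> \<le> (\<Sum>k<n. case k of 0 \<Rightarrow> 1 / real n | Suc j \<Rightarrow> \<integral>x. s j x \<partial>\<mu>)"
      proof (rule sum_mono)
        fix k
        define U where "U = {x \<in> topspace X. f x \<in> {real k / real n<..}}"
        have U: "openin X U"
          unfolding U_def using f(1)
          by (intro openin_continuous_map_preimage[of X euclideanreal]) (auto simp: Cb_def)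
        have "(\<lambda>x. real n * s k x) \<in> below_set U"
          using n Cb_cmult[OF sC, of "real n" k]
          by (auto simp: below_set_def) (auto simp: s_def U_def indicator_def min_def field_simps)
        from open_measure_upper[OF this] have "ennreal (real n * L (s k)) \<le> emeasure \<mu> U"
          by (simp add: L_cmult[OF sC] \<mu>(2)[OF U])
        then have *: "real n * L (s k) \<le> measure \<mu> U"
          by (simp add: emeasure_eq_measure)
        show "L (s k) \<le> (case k of 0 \<Rightarrow> 1 / real n | Suc j \<Rightarrow> \<integral>x. s j x \<partial>\<mu>)"
        proof (cases k)
          case 0
          then show ?thesis
            using order_trans[OF * prob_le_1] n by (simp add: field_simps)
        next
          case (Suc j)
          have "measure \<mu> U = (\<integral>x. indicator U x \<partial>\<mu>)"
            using borel_prob_measuresD(4)[OF \<mu>(1) U] by simp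
          also have "\<dots> \<le> (\<integral>x. real n * s j x \<partial>\<mu>)"
          proof (rule integral_mono)
            show "integrable \<mu> (indicator U :: 'a \<Rightarrow> real)"
              using borel_prob_measuresD(4)[OF \<mu>(1) U] by (simp add: integrable_indicator_iff less_top[symmetric])
            show "integrable \<mu> (\<lambda>x. real n * s j x)"
              by (intro int Cb_cmult sC)
            show "indicator U x \<le> real n * s j x" for x
              unfolding s_def U_def using n Suc by (auto simp: indicator_def min_def field_simps)
          qed
          finally have "real n * L (s k) \<le> real n * (\<integral>x. s j x \<partial>\<mu>)"
            using * by simp
          then show ?thesis
            using n Suc by simp
        qed
      qed
      also have "\<dots> \<le> (\<Sum>k<Suc n. case k of 0 \<Rightarrow> 1 / real n | Suc j \<Rightarrow> \<integral>x. s j x \<partial>\<mu>)"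
        using n by (intro sum_mono2) (auto split: nat.split intro!: Bochner_Integration.integral_nonneg s_nn)
      also have "\<dots> = 1 / real n + (\<Sum>j<n. \<integral>x. s j x \<partial>\<mu>)"
        by (subst sum.lessThan_Suc_shift) simp
      also have "(\<Sum>j<n. \<integral>x. s j x \<partial>\<mu>) = (\<integral>x. (\<Sum>j<n. s j x) \<partial>\<mu>)"
        by (rule Bochner_Integration.integral_sum[symmetric]) (rule int[OF sC])
      also have "\<dots> = (\<integral>x. f x \<partial>\<mu>)"
        using \<open>\<And>x. x \<in> topspace X \<Longrightarrow> (\<Sum>k<n. s k x) = f x\<close>
        by (intro Bochner_Integration.integral_cong) (auto simp: sp)
      finally show ?thesis by simp
    qed
    then have "\<forall>\<^sub>F n in sequentially. L f \<le> (\<integral>x. f x \<partial>\<mu>) + 1 / real n"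
      by (intro eventually_mono[OF eventually_gt_at_top[of 0]]) auto
    moreover have "(\<lambda>n. (\<integral>x. f x \<partial>\<mu>) + 1 / real n) \<longlonglongrightarrow> (\<integral>x. f x \<partial>\<mu>) + 0"
      by (intro tendsto_add tendsto_const lim_1_over_n)
    ultimately show ?thesis
      using tendsto_lowerbound[of "\<lambda>n. (\<integral>x. f x \<partial>\<mu>) + 1 / real n" "\<integral>x. f x \<partial>\<mu>" sequentially "L f"]
      by simp
  qed
  have eq: "(\<integral>x. f x \<partial>\<mu>) = L f"
    if f: "f \<in> Cb X" "\<And>x. x \<in> topspace X \<Longrightarrow> 0 \<le> f x" "\<And>x. x \<in> topspace X \<Longrightarrow> f x \<le> 1" for f
  proof (rule antisym)
    \<comment> \<open>The one-sided estimate applied to \<open>1 - f\<close> gives the other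
      side.\<close>
    have "L (\<lambda>x. 1 - f x) \<le> (\<integral>x. 1 - f x \<partial>\<mu>)"
      using f by (intro le Cb_diff) auto
    then show "(\<integral>x. f x \<partial>\<mu>) \<le> L f"
      using f int[OF f(1)] by (simp add: L_diff L_one prob_space)
  qed (rule le[OF f])
  show ?thesis
  proof (rule that[OF \<mu>(1)])
    fix f assume f: "f \<in> Cb X"
    obtain C where C: "0 < C" "\<And>x. x \<in> topspace X \<Longrightarrow> \<bar>f x\<bar> \<le> C"
      using Cb_obtain_bound[OF f] by metis
    \<comment> \<open>An affine change maps the range \<open>[- C, C]\<close> of \<open>f\<close>
      into \<open>[0, 1]\<close>.\<close>
    have b: "0 \<le> 1 / (2 * C) * (f x + C)" "1 / (2 * C) * (f x + C) \<le> 1" if "x \<in> topspace X" for x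
      using C(2)[OF that] C(1) by (auto simp: field_simps abs_le_iff)
    have "(\<integral>x. 1 / (2 * C) * (f x + C) \<partial>\<mu>) = L (\<lambda>x. 1 / (2 * C) * (f x + C))"
      using b by (intro eq Cb_cmult Cb_add f) auto
    also have "\<dots> = 1 / (2 * C) * (L f + C)"
      by (subst L_cmult) (auto simp: L_add f L_const intro: Cb_add)
    also have "(\<integral>x. 1 / (2 * C) * (f x + C) \<partial>\<mu>) = 1 / (2 * C) * ((\<integral>x. f x \<partial>\<mu>) + C)"
      using int[OF f] by (simp add: prob_space)
    finally show "(\<integral>x. f x \<partial>\<mu>) = L f"
      using C(1) by simp
  qed
qed

end

subsection \<open>Topologies generated by seminorms\<close>

lemma openin_seminorm_nbhd:
  assumes "finite F" "F \<subseteq> P" "e > 0"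
  shows "openin (seminorm_topology P) {y. \<forall>p\<in>F. p (y - x) < e}"
  using assms
proof (induction F)
  case empty
  then show ?case
    using openin_topspace[of "seminorm_topology P"] by simp
next
  case (insert p F)
  have "openin (seminorm_topology P) {y. p (y - x) < e}"
    unfolding seminorm_topology_def by (rule topology_generated_by_Basis) (use insert in blast)
  then have "openin (seminorm_topology P) ({y. p (y - x) < e} \<inter> {y. \<forall>p\<in>F. p (y - x) < e})"
    using insert by (intro openin_Int) auto
  moreover have "{y. p (y - x) < e} \<inter> {y. \<forall>p\<in>F. p (y - x) < e} = {y. \<forall>p\<in>insert p F. p (y - x) < e}"
    by auto
  ultimately show ?case by simp
qed

lemma openin_seminorm_topology:
  assumes P: "\<forall>p\<in>P. seminorm p"
  shows "openin (seminorm_topology P) U \<longleftrightarrow>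
    (\<forall>x\<in>U. \<exists>F e. finite F \<and> F \<subseteq> P \<and> e > 0 \<and> {y. \<forall>p\<in>F. p (y - x) < e} \<subseteq> U)"
proof (intro iffI ballI)
  fix x assume "openin (seminorm_topology P) U" and x: "x \<in> U"
  then have "generate_topology_on (insert UNIV {{y. p (y - x) < e} |p x e. p \<in> P \<and> e > 0}) U"
    unfolding seminorm_topology_def by (intro openin_topology_generated_by)
  then show "\<exists>F e. finite F \<and> F \<subseteq> P \<and> e > 0 \<and> {y. \<forall>p\<in>F. p (y - x) < e} \<subseteq> U"
    using x
  proof induction
    case (Int a b)
    then have x: "x \<in> a" "x \<in> b" by auto
    obtain F e where "finite F" "F \<subseteq> P" "e > 0" "{y. \<forall>p\<in>F. p (y - x) < e} \<subseteq> a"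
      using Int.IH(1)[OF x(1)] by blast
    moreover obtain G d where "finite G" "G \<subseteq> P" "d > 0" "{y. \<forall>p\<in>G. p (y - x) < d} \<subseteq> b"
      using Int.IH(2)[OF x(2)] by blast
    ultimately show ?case
      by (intro exI[of _ "F \<union> G"] exI[of _ "min e d"]) auto
  next
    case (UN K)
    then obtain k where k: "k \<in> K" "x \<in> k" by auto
    obtain F e where "finite F" "F \<subseteq> P" "e > 0" "{y. \<forall>p\<in>F. p (y - x) < e} \<subseteq> k"
      using UN.IH[OF k] by blast
    then show ?case using k by (intro exI[of _ F] exI[of _ e]) auto
  next
    case (Basis s)
    then consider "s = UNIV" | p z e where "s = {y. p (y - z) < e}" "p \<in> P" "e > 0"
      by auto
    then show ?case
    proof cases
      case 1
      then show ?thesis by (intro exI[of _ "{}"] exI[of _ 1]) auto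
    next
      case 2
      have "p (y - z) < e" if "p (y - x) < e - p (x - z)" for y
        using seminormD(7)[OF bspec[OF P 2(2)], of y z x] that by simp
      then show ?thesis
        using 2 Basis(2) by (intro exI[of _ "{p}"] exI[of _ "e - p (x - z)"]) auto
    qed
  qed auto
next
  assume *: "\<forall>x\<in>U. \<exists>F e. finite F \<and> F \<subseteq> P \<and> e > 0 \<and> {y. \<forall>p\<in>F. p (y - x) < e} \<subseteq> U"
  show "openin (seminorm_topology P) U"
  proof (subst openin_subopen, intro ballI)
    fix x assume x: "x \<in> U"
    obtain F e where F: "finite F" "F \<subseteq> P" "e > 0" "{y. \<forall>p\<in>F. p (y - x) < e} \<subseteq> U"
      using bspec[OF * x] by blast
    have "x \<in> {y. \<forall>p\<in>F. p (y - x) < e}"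
      using F P by (auto simp: seminormD(3) subset_iff)
    then show "\<exists>T. openin (seminorm_topology P) T \<and> x \<in> T \<and> T \<subseteq> U"
      using openin_seminorm_nbhd[OF F(1-3), of x] F(4) by blast
  qed
qed

lemma openin_seminorm_topologyE:
  assumes "\<forall>p\<in>P. seminorm p" "openin (seminorm_topology P) U" "x \<in> U"
  obtains F e where "finite F" "F \<subseteq> P" "e > 0" "{y. \<forall>p\<in>F. p (y - x) < e} \<subseteq> U"
proof -
  have "\<exists>F e. finite F \<and> F \<subseteq> P \<and> e > 0 \<and> {y. \<forall>p\<in>F. p (y - x) < e} \<subseteq> U"
    using iffD1[OF openin_seminorm_topology[OF assms(1)] assms(2)] assms(3) by (rule bspec)
  then show ?thesis using that by blast
qed

lemma continuous_map_seminorm_topology: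
  fixes f :: "'a::real_vector \<Rightarrow> real"
  assumes P: "\<forall>p\<in>P. seminorm p" and q: "q \<in> P" and f: "\<And>x y. \<bar>f y - f x\<bar> \<le> q (y - x)"
  shows "continuous_map (seminorm_topology P) euclideanreal f"
  unfolding continuous_map_def
proof (intro conjI allI impI)
  fix S :: "real set" assume "openin euclideanreal S"
  then have S: "open S" by simp
  show "openin (seminorm_topology P) {x \<in> topspace (seminorm_topology P). f x \<in> S}"
    unfolding openin_seminorm_topology[OF P]
  proof
    fix x assume "x \<in> {x \<in> topspace (seminorm_topology P). f x \<in> S}"
    then have "f x \<in> S" by simp
    then obtain e where e: "e > 0" "\<And>y. dist y (f x) < e \<Longrightarrow> y \<in> S"
      using S unfolding open_dist by blast
    have "f y \<in> S" if "q (y - x) < e" for y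
      using e(2)[of "f y"] f[of y x] that by (auto simp: dist_real_def)
    then show "\<exists>F e. finite F \<and> F \<subseteq> P \<and> 0 < e \<and>
        {y. \<forall>p\<in>F. p (y - x) < e} \<subseteq> {x \<in> topspace (seminorm_topology P). f x \<in> S}"
      using e(1) q by (intro exI[of _ "{q}"] exI[of _ e]) auto
  qed
qed simp

lemma summable_on_half_powers:
  assumes "countable Q"
  shows "(\<lambda>q. (1/2 :: real) ^ to_nat_on Q q) summable_on Q"
proof -
  have "(\<lambda>n. (1/2 :: real) ^ n) summable_on (UNIV :: nat set)"
    by (rule norm_summable_imp_summable_on) (simp add: summable_geometric)
  then have "(\<lambda>n. (1/2 :: real) ^ n) summable_on (to_nat_on Q ` Q)"
    by (rule summable_on_subset_banach) simp
  then show ?thesis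
    by (subst (asm) summable_on_reindex[OF inj_on_to_nat_on[OF assms]]) (simp add: o_def)
qed

lemma summable_on_seminorm_dist:
  assumes "countable Q" "\<forall>q\<in>Q. seminorm q"
  shows "(\<lambda>q. (1/2) ^ to_nat_on Q q * min 1 (q z)) summable_on Q"
  by (rule summable_on_comparison_test[OF summable_on_half_powers[OF assms(1)]])
    (use assms(2) in \<open>auto simp: mult_le_cancel_left1 min_le_iff_disj seminormD(5)\<close>)

lemma seminorm_le_seminorm_dist:
  assumes "countable Q" "\<forall>q\<in>Q. seminorm q" "q \<in> Q"
  shows "(1/2) ^ to_nat_on Q q * min 1 (q (x - y)) \<le> seminorm_dist Q x y"
proof -
  have "sum (\<lambda>q. (1/2) ^ to_nat_on Q q * min 1 (q (x - y))) {q} \<le> seminorm_dist Q x y"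
    unfolding seminorm_dist_def
    using assms(3) seminormD(5)[OF bspec[OF assms(2)]]
    by (intro finite_sum_le_infsum summable_on_seminorm_dist assms) auto
  then show ?thesis by simp
qed

text \<open>The weights are summable and the seminorms are cut off at 1, so all but finitely many
  seminorms contribute little, whatever the points are.\<close>

lemma seminorm_dist_less:
  assumes Q: "countable Q" "\<forall>q\<in>Q. seminorm q" and e: "e > 0"
  obtains F \<delta> where "finite F" "F \<subseteq> Q" "\<delta> > 0"
    "\<And>x y. (\<And>q. q \<in> F \<Longrightarrow> q (x - y) < \<delta>) \<Longrightarrow> seminorm_dist Q x y < e"
proof -
  define w where "w q = (1/2 :: real) ^ to_nat_on Q q" for q
  have w: "w summable_on Q"
    unfolding w_def by (rule summable_on_half_powers[OF Q(1)])
  obtain F where F: "finite F" "F \<subseteq> Q" "dist (sum w F) (infsum w Q) \<le> e / 4"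
    using infsum_finite_approximation[OF w, of "e / 4"] e by auto
  \<comment> \<open>With this choice the part over \<open>F\<close> is at most
    \<open>card F * \<delta> \<le> e / 4\<close>, and so is the tail; \<open>1 +\<close> allows for
    an empty \<open>F\<close>.\<close>
  define \<delta> where "\<delta> = e / (4 * (1 + card F))"
  show ?thesis
  proof
    show "finite F" "F \<subseteq> Q" by fact+
    show "\<delta> > 0" using e by (simp add: \<delta>_def add_pos_nonneg)
    fix x y assume less: "\<And>q. q \<in> F \<Longrightarrow> q (x - y) < \<delta>"
    define g where "g q = w q * min 1 (q (x - y))" for q
    have g: "g summable_on Q"
      unfolding g_def w_def by (rule summable_on_seminorm_dist[OF Q])
    have Un: "F \<union> (Q - F) = Q" using F by auto
    have split: "infsum f Q = sum f F + infsum f (Q - F)" if "f summable_on Q" for f :: "_ \<Rightarrow> real"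
      using infsum_Un_disjoint[of f F "Q - F"] F that summable_on_subset_banach[OF that, of "Q - F"]
      unfolding Un by auto
    have "sum g F \<le> (\<Sum>q\<in>F. \<delta>)"
    proof (rule sum_mono)
      fix q assume q: "q \<in> F"
      have "w q * min 1 (q (x - y)) \<le> 1 * q (x - y)"
        unfolding w_def using seminormD(5)[OF bspec[OF Q(2)]] F q by (intro mult_mono) (auto simp: power_le_one)
      then show "g q \<le> \<delta>" using less[OF q] by (simp add: g_def)
    qed
    also have "\<dots> \<le> e / 4"
      using e by (simp add: \<delta>_def field_simps)
    finally have 1: "sum g F \<le> e / 4" .
    have "infsum g (Q - F) \<le> infsum w (Q - F)"
      using summable_on_subset_banach[OF g, of "Q - F"] summable_on_subset_banach[OF w, of "Q - F"]
      by (intro infsum_mono) (auto simp: g_def w_def mult_le_cancel_left1)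
    also have "\<dots> \<le> e / 4"
      using split[OF w] F(3) by (simp add: dist_real_def)
    finally have "infsum g Q \<le> e / 2"
      using split[OF g] 1 by simp
    then show "seminorm_dist Q x y < e"
      using e unfolding seminorm_dist_def g_def w_def by linarith
  qed
qed

section \<open>The convex set with a fixed metrizing family \<open>Q\<close>, and its continuous
  linear functionals\<close>

locale bccsm =
  fixes P :: "('a::real_vector \<Rightarrow> real) set" and A :: "'a set" and Q :: "('a \<Rightarrow> real) set"
  assumes seminorm_P: "\<forall>p\<in>P. seminorm p"
    and bounded_A: "\<forall>p\<in>P. bounded (p ` A)"
    and convex_A: "convex A"
    and separable: "separable_space (subtopology (seminorm_topology P) A)"
    and Q: "Q \<subseteq> P" "countable Q"
    and topology_Q: "subtopology (seminorm_topology P) A = subtopology (seminorm_topology Q) A"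
    and metric_Q: "Metric_space A (seminorm_dist Q)"
    and complete_Q: "Metric_space.mcomplete A (seminorm_dist Q)"
begin

sublocale Metric_space A "seminorm_dist Q"
  by (rule metric_Q)

abbreviation X where "X \<equiv> subtopology (seminorm_topology P) A"

abbreviation \<M> where "\<M> \<equiv> borel_prob_measures X"

lemma topspace_X: "topspace X = A"
  by simp

lemma seminorm: "p \<in> P \<Longrightarrow> seminorm p"
  using seminorm_P by blast

lemma seminorm_Q: "\<forall>q\<in>Q. seminorm q"
  using seminorm_P Q by auto

lemma X_eq_mtopology: "X = mtopology"
  unfolding topology_Q topology_eq
proof (intro allI iffI)
  fix U
  assume "openin (subtopology (seminorm_topology Q) A) U"
  then obtain T where T: "openin (seminorm_topology Q) T" "U = T \<inter> A"
    by (auto simp: openin_subtopology)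
  have "\<exists>r>0. mball x r \<subseteq> U" if x: "x \<in> U" for x
  proof -
    have "x \<in> T" using x T by auto
    then obtain F e where F: "finite F" "F \<subseteq> Q" "e > 0" "{y. \<forall>q\<in>F. q (y - x) < e} \<subseteq> T"
      using openin_seminorm_topologyE[OF seminorm_Q T(1)] by blast
    \<comment> \<open>Distance below the weight of \<open>q\<close> times \<open>min 1 e\<close>
      forces \<open>q\<close> of the difference below \<open>e\<close>; the inserted 1 keeps the
      minimum meaningful for empty \<open>F\<close>.\<close>
    define r where "r = Min (insert 1 ((\<lambda>q. (1/2) ^ to_nat_on Q q * min 1 e) ` F))"
    have "r > 0"
      unfolding r_def using F by (subst Min_gr_iff) auto
    moreover have "mball x r \<subseteq> U"
    proof
      fix y assume "y \<in> mball x r"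
      then have y: "y \<in> A" "seminorm_dist Q y x < r" by (auto simp: commute)
      have "q (y - x) < e" if q: "q \<in> F" for q
      proof -
        have "r \<le> (1/2) ^ to_nat_on Q q * min 1 e"
          unfolding r_def using F q by (intro Min_le) auto
        then have "(1/2) ^ to_nat_on Q q * min 1 (q (y - x)) < (1/2) ^ to_nat_on Q q * min 1 e"
          using seminorm_le_seminorm_dist[OF Q(2) seminorm_Q subsetD[OF F(2) q], of y x] y(2) by linarith
        then show ?thesis by (simp add: min_def split: if_splits)
      qed
      then show "y \<in> U" using F T y by auto
    qed
    ultimately show ?thesis by auto
  qed
  then show "openin mtopology U"
    using T by (auto simp: openin_mtopology)
next
  fix U
  assume U: "openin mtopology U"
  \<comment> \<open>Metric balls give information on \<open>A\<close> only; \<open>T\<close> is the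
    largest open set of the whole space whose trace on \<open>A\<close> is contained in
    \<open>U\<close>.\<close>
  define T where "T = \<Union>{V. openin (seminorm_topology Q) V \<and> V \<inter> A \<subseteq> U}"
  have "openin (seminorm_topology Q) T"
    unfolding T_def by (rule openin_Union) auto
  moreover have "U = T \<inter> A"
  proof
    show "U \<subseteq> T \<inter> A"
    proof
      fix x assume x: "x \<in> U"
      then obtain r where r: "r > 0" "mball x r \<subseteq> U" "x \<in> A"
        using U unfolding openin_mtopology by blast
      obtain F \<delta> where F: "finite F" "F \<subseteq> Q" "\<delta> > 0"
        "\<And>x y. (\<And>q. q \<in> F \<Longrightarrow> q (x - y) < \<delta>) \<Longrightarrow> seminorm_dist Q x y < r"
        using seminorm_dist_less[OF Q(2) seminorm_Q r(1)] by blast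
      have "{y. \<forall>q\<in>F. q (y - x) < \<delta>} \<inter> A \<subseteq> U"
        using F(4)[of _ x] r by (auto simp: commute intro!: subsetD[OF r(2)])
      moreover have "x \<in> {y. \<forall>q\<in>F. q (y - x) < \<delta>}"
        using F seminorm_Q by (auto simp: seminormD(3) subset_iff)
      ultimately show "x \<in> T \<inter> A"
        using openin_seminorm_nbhd[OF F(1-3), of x] r unfolding T_def by blast
    qed
  qed (auto simp: T_def)
  ultimately show "openin (subtopology (seminorm_topology Q) A) U"
    by (auto simp: openin_subtopology)
qed

lemma metrizable_X: "metrizable_space X"
  unfolding X_eq_mtopology by (rule metrizable_space_mtopology)

lemma limitin_tendsto:
  assumes "limitin X \<sigma> x F" "continuous_map X euclideanreal f"
  shows "((\<lambda>n. f (\<sigma> n)) \<longlongrightarrow> f x) F"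
  using continuous_map_limit[OF assms(2,1)] by (simp add: o_def)

definition dual :: "('a \<Rightarrow> real) set" where
  "dual = {l. linear l \<and> continuous_map (seminorm_topology P) euclideanreal l}"

lemma seminorm_minus_continuous: "q \<in> P \<Longrightarrow> continuous_map X euclideanreal (\<lambda>y. q (y - a))"
proof (rule continuous_map_from_subtopology)
  assume q: "q \<in> P"
  show "continuous_map (seminorm_topology P) euclideanreal (\<lambda>y. q (y - a))"
  proof (rule continuous_map_seminorm_topology[OF seminorm_P q])
    show "\<bar>q (y - a) - q (x - a)\<bar> \<le> q (y - x)" for x y
      using seminormD(7)[OF seminorm[OF q], of y a x] seminormD(7)[OF seminorm[OF q], of x a y]
        seminormD(6)[OF seminorm[OF q], of x y] by simp
  qed
qed

lemma dualI: "linear l \<Longrightarrow> q \<in> P \<Longrightarrow> (\<And>x. \<bar>l x\<bar> \<le> q x) \<Longrightarrow> l \<in> dual"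
  unfolding dual_def
  by (auto intro!: continuous_map_seminorm_topology[OF seminorm_P] simp flip: linear_diff)

text \<open>Continuity bounds \<open>l\<close> by 1 on a basic neighbourhood of 0, given by finitely
  many seminorms, and this neighbourhood absorbs the bounded set \<open>A\<close>.\<close>

lemma dual_Cb:
  assumes "l \<in> dual"
  shows "l \<in> Cb X"
proof -
  have l: "linear l" "continuous_map (seminorm_topology P) euclideanreal l"
    using assms by (auto simp: dual_def)
  have op: "openin (seminorm_topology P) {x \<in> topspace (seminorm_topology P). l x \<in> {-1<..<1}}"
    using l(2) by (rule openin_continuous_map_preimage) simp
  have "0 \<in> {x \<in> topspace (seminorm_topology P). l x \<in> {-1<..<1}}"
    by (simp add: linear_0[OF l(1)])
  then obtain F e where F: "finite F" "F \<subseteq> P" "e > 0"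
      "{y. \<forall>p\<in>F. p (y - 0) < e} \<subseteq> {x \<in> topspace (seminorm_topology P). l x \<in> {-1<..<1}}"
    using openin_seminorm_topologyE[OF seminorm_P op] by blast
  have "\<forall>p\<in>F. \<exists>B. \<forall>y\<in>A. p y \<le> B"
  proof
    fix p assume "p \<in> F"
    then obtain B where "\<forall>z\<in>p ` A. norm z \<le> B"
      using F(2) bounded_A unfolding bounded_iff by blast
    then show "\<exists>B. \<forall>y\<in>A. p y \<le> B"
      by (intro exI[of _ B]) fastforce
  qed
  then obtain B where B: "\<And>p y. p \<in> F \<Longrightarrow> y \<in> A \<Longrightarrow> p y \<le> B p" by metis
  \<comment> \<open>A common bound of the finitely many seminorms on \<open>A\<close>, kept positive
    by the 1, so that scaling by \<open>e / (2 * C)\<close> moves \<open>A\<close> into the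
    neighbourhood.\<close>
  define C where "C = Max (insert 1 (B ` F))"
  have C: "C \<ge> 1" "\<And>p y. p \<in> F \<Longrightarrow> y \<in> A \<Longrightarrow> p y \<le> C"
  proof -
    show "C \<ge> 1" unfolding C_def using F by (intro Max_ge) auto
    fix p y assume p: "p \<in> F" "y \<in> A"
    have "B p \<le> C" unfolding C_def using F p by (intro Max_ge) auto
    then show "p y \<le> C" using B[OF p] by simp
  qed
  have "\<bar>l y\<bar> \<le> 2 * C / e" if y: "y \<in> A" for y
  proof -
    have "p ((e / (2 * C)) *\<^sub>R y) < e" if p: "p \<in> F" for p
    proof -
      have "p ((e / (2 * C)) *\<^sub>R y) = e / (2 * C) * p y"
        using seminormD(2)[OF seminorm, of p] p F C by auto
      also have "\<dots> \<le> e / (2 * C) * C"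
        using C F p y by (intro mult_left_mono) auto
      also have "\<dots> < e" using C F by simp
      finally show ?thesis .
    qed
    then have "(e / (2 * C)) *\<^sub>R y \<in> {y. \<forall>p\<in>F. p (y - 0) < e}" by auto
    then have "\<bar>l ((e / (2 * C)) *\<^sub>R y)\<bar> < 1"
      using F(4) by (auto simp: abs_less_iff subset_iff)
    then show ?thesis
      using C F by (simp add: linear_scale[OF l(1)] abs_mult field_simps)
  qed
  then show ?thesis
    using l(2) by (auto simp: Cb_iff intro: continuous_map_from_subtopology)
qed

text \<open>The ambient space may fail to be Hausdorff. That \<open>seminorm_dist Q\<close> is a
  metric on \<open>A\<close> yields a seminorm of \<open>Q\<close> that tells the two points apart,
  and Hahn-Banach turns it into a functional.\<close>

lemma dual_separates:
  assumes "x \<in> A" "y \<in> A" "\<And>l. l \<in> dual \<Longrightarrow> l x = l y"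
  shows "x = y"
proof (rule ccontr)
  assume "x \<noteq> y"
  then have "seminorm_dist Q x y \<noteq> 0"
    using assms by simp
  then obtain q where q: "q \<in> Q" "q (x - y) \<noteq> 0"
    unfolding seminorm_dist_def by (metis (no_types, lifting) infsum_0 min.absorb2 mult_zero_right zero_le_one)
  obtain l where l: "linear l" "\<And>z. \<bar>l z\<bar> \<le> q z" "l (x - y) = q (x - y)"
    using Hahn_Banach_seminorm[OF bspec[OF seminorm_Q q(1)]] by blast
  have "l \<in> dual"
    using l q Q by (intro dualI[of l q]) auto
  then have "l x = l y"
    by (rule assms(3))
  with l(3) q(2) show False
    by (simp add: linear_diff[OF l(1)])
qed

text \<open>The relational form allows existence to be proved first; the \<open>THE\<close> in
  \<open>barycenter\<close> has meaning only afterwards.\<close>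

definition has_barycenter :: "'a measure \<Rightarrow> 'a \<Rightarrow> bool" where
  "has_barycenter \<mu> b \<longleftrightarrow> b \<in> A \<and> (\<forall>l\<in>dual. l b = (\<integral>x. l x \<partial>\<mu>))"

lemma barycenter_eqI:
  assumes "has_barycenter \<mu> b"
  shows "barycenter P A \<mu> = b"
  unfolding barycenter_def
proof (rule the_equality)
  fix c assume c: "c \<in> A \<and> (\<forall>l. linear l \<and> continuous_map (seminorm_topology P) euclideanreal l \<longrightarrow>
      l c = (\<integral>x. l x \<partial>\<mu>))"
  then show "c = b"
    using assms by (intro dual_separates) (auto simp: has_barycenter_def dual_def)
qed (use assms in \<open>auto simp: has_barycenter_def dual_def\<close>)

subsection \<open>Barycenters and Jensen's inequality\<close>

text \<open>The atoms of the partition generated by the first \<open>n\<close> base sets, indexed by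
  membership pattern; \<open>cells\<close> keeps the patterns of nonempty atoms.\<close>

definition cell :: "(nat \<Rightarrow> 'a set) \<Rightarrow> nat \<Rightarrow> nat set \<Rightarrow> 'a set" where
  "cell B n S = {x \<in> A. {i \<in> {..<n}. x \<in> B i} = S}"

definition cells :: "(nat \<Rightarrow> 'a set) \<Rightarrow> nat \<Rightarrow> nat set set" where
  "cells B n = (\<lambda>x. {i \<in> {..<n}. x \<in> B i}) ` A"

lemma finite_cells: "finite (cells B n)"
  by (rule finite_subset[of _ "Pow {..<n}"]) (auto simp: cells_def)

text \<open>Stated over a semiring because it is used for real sums and, in Jensen's inequality, for
  \<open>ennreal\<close> sums.\<close>

lemma sum_cells:
  fixes f :: "nat set \<Rightarrow> 'b::semiring_1"
  assumes "x \<in> A"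
  shows "(\<Sum>S\<in>cells B n. indicator (cell B n S) x * f S) = f {i \<in> {..<n}. x \<in> B i}"
proof -
  have "(\<Sum>S\<in>cells B n. indicator (cell B n S) x * f S) =
      (\<Sum>S\<in>cells B n. if S = {i \<in> {..<n}. x \<in> B i} then f S else 0)"
    using assms by (intro sum.cong) (auto simp: cell_def)
  also have "\<dots> = f {i \<in> {..<n}. x \<in> B i}"
    using assms by (subst sum.delta[OF finite_cells]) (auto simp: cells_def)
  finally show ?thesis .
qed

text \<open>The barycenter of the discrete measure that moves the mass of each cell to its
  representative \<open>r n S\<close>.\<close>

definition discretize ::
    "(nat \<Rightarrow> 'a set) \<Rightarrow> (nat \<Rightarrow> nat set \<Rightarrow> 'a) \<Rightarrow> 'a measure \<Rightarrow> nat \<Rightarrow> 'a" where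
  "discretize B r \<mu> n = (\<Sum>S\<in>cells B n. measure \<mu> (cell B n S) *\<^sub>R r n S)"

lemma cell_sets:
  assumes \<mu>: "\<mu> \<in> \<M>" and B: "\<And>i. openin X (B i)"
  shows "cell B n S \<in> sets \<mu>"
proof -
  note sp = borel_prob_measuresD(3)[OF \<mu>, unfolded topspace_X]
  have [measurable]: "B i \<in> sets \<mu>" for i
    by (rule borel_prob_measuresD(4)[OF \<mu> B])
  have "cell B n S = (if S \<subseteq> {..<n} then {x \<in> space \<mu>. \<forall>i\<in>{..<n}. x \<in> B i \<longleftrightarrow> i \<in> S} else {})"
    by (auto simp: cell_def sp)
  moreover have "{x \<in> space \<mu>. \<forall>i\<in>{..<n}. x \<in> B i \<longleftrightarrow> i \<in> S} \<in> sets \<mu>"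
    by measurable
  ultimately show ?thesis by auto
qed

lemma sum_measure_cells:
  assumes \<mu>: "\<mu> \<in> \<M>" and B: "\<And>i. openin X (B i)"
  shows "(\<Sum>S\<in>cells B n. measure \<mu> (cell B n S)) = 1"
proof -
  interpret prob_space \<mu> using \<mu> borel_prob_measuresD by blast
  note sp = borel_prob_measuresD(3)[OF \<mu>, unfolded topspace_X]
  have "(\<Sum>S\<in>cells B n. measure \<mu> (cell B n S)) = measure \<mu> (\<Union>S\<in>cells B n. cell B n S)"
    using cell_sets[OF \<mu> B] finite_cells
    by (intro finite_measure_finite_Union[symmetric]) (auto simp: disjoint_family_on_def cell_def)
  also have "(\<Union>S\<in>cells B n. cell B n S) = space \<mu>"
    by (auto simp: sp cell_def cells_def)
  finally show ?thesis by (simp add: prob_space)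
qed

text \<open>Each point eventually lies in every set of the base that contains it, and so does its cell,
  so arbitrary representatives of the cells of \<open>x\<close> converge to \<open>x\<close>.\<close>

lemma representatives_limit:
  assumes B: "\<And>i. openin X (B i)" "\<And>U x. openin X U \<Longrightarrow> x \<in> U \<Longrightarrow> \<exists>i. x \<in> B i \<and> B i \<subseteq> U"
    and r: "\<And>n S. S \<in> cells B n \<Longrightarrow> r n S \<in> cell B n S"
    and x: "x \<in> A"
  shows "limitin X (\<lambda>n. r n {i \<in> {..<n}. x \<in> B i}) x sequentially"
  unfolding limitin_def
proof (intro conjI allI impI)
  show "x \<in> topspace X" using x by simp
  fix U assume "openin X U \<and> x \<in> U"
  then obtain i where i: "x \<in> B i" "B i \<subseteq> U" using B(2) by blast
  have "r n {i \<in> {..<n}. x \<in> B i} \<in> U" if "n > i" for n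
  proof -
    have "r n {i \<in> {..<n}. x \<in> B i} \<in> cell B n {i \<in> {..<n}. x \<in> B i}"
      using x by (intro r) (auto simp: cells_def)
    then show ?thesis using i that by (auto simp: cell_def)
  qed
  then show "\<forall>\<^sub>F n in sequentially. r n {i \<in> {..<n}. x \<in> B i} \<in> U"
    by (intro eventually_mono[OF eventually_gt_at_top[of i]]) auto
qed

text \<open>Existence of barycenters, with an approximation that Jensen's inequality reuses; hence
  the freedom in \<open>r\<close>. Convexity keeps the discrete barycenters in \<open>A\<close>,
  dominated convergence makes them Cauchy in every seminorm, and completeness of \<open>A\<close>
  gives the limit, whose values under functionals are the right integrals.\<close>

lemma discretize_limit:
  assumes \<mu>: "\<mu> \<in> \<M>"
    and B: "\<And>i. openin X (B i)" "\<And>U x. openin X U \<Longrightarrow> x \<in> U \<Longrightarrow> \<exists>i. x \<in> B i \<and> B i \<subseteq> U"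
    and r: "\<And>n S. S \<in> cells B n \<Longrightarrow> r n S \<in> cell B n S"
  obtains b where "has_barycenter \<mu> b" "limitin X (discretize B r \<mu>) b sequentially"
proof -
  interpret prob_space \<mu> using \<mu> borel_prob_measuresD by blast
  note sp = borel_prob_measuresD(3)[OF \<mu>, unfolded topspace_X]
  define s where "s n x = r n {i \<in> {..<n}. x \<in> B i}" for n x
  have s_A: "s n x \<in> A" if "x \<in> A" for n x
    using r[of "{i \<in> {..<n}. x \<in> B i}" n] that by (auto simp: s_def cells_def cell_def)
  have s_lim: "limitin X (\<lambda>n. s n x) x sequentially" if "x \<in> A" for x
    unfolding s_def by (rule representatives_limit[OF B r that])
  note [measurable] = cell_sets[OF \<mu> B(1)]
  \<comment> \<open>On each cell the first argument is constant, so measurability is needed only for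
    each fixed value of it; the vector space itself carries no measurable structure here.\<close>
  have s_meas: "(\<lambda>x. F (s n x) x) \<in> borel_measurable \<mu>"
    if F [measurable]: "\<And>a. F a \<in> borel_measurable \<mu>" for F :: "'a \<Rightarrow> 'a \<Rightarrow> real" and n
  proof -
    have "(\<lambda>x. \<Sum>S\<in>cells B n. indicator (cell B n S) x * F (r n S) x) \<in> borel_measurable \<mu>"
      by measurable
    then show ?thesis
      by (rule measurable_cong[THEN iffD1, rotated]) (simp add: sum_cells s_def sp)
  qed
  define b where "b = discretize B r \<mu>"
  have b_A: "b n \<in> A" for n
    unfolding b_def discretize_def using r sum_measure_cells[OF \<mu> B(1)]
    by (intro convex_sum finite_cells convex_A) (auto simp: cell_def)
  have l_b: "l (b n) = (\<integral>x. l (s n x) \<partial>\<mu>)" if l: "l \<in> dual" for l n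
  proof -
    have "l (b n) = (\<Sum>S\<in>cells B n. measure \<mu> (cell B n S) * l (r n S))"
      using l by (simp add: b_def discretize_def dual_def linear_sum linear_scale)
    also have "\<dots> = (\<Sum>S\<in>cells B n. \<integral>x. indicator (cell B n S) x * l (r n S) \<partial>\<mu>)"
      by simp
    also have "\<dots> = (\<integral>x. (\<Sum>S\<in>cells B n. indicator (cell B n S) x * l (r n S)) \<partial>\<mu>)"
      by (rule Bochner_Integration.integral_sum[symmetric])
        (auto intro!: integrable_mult_left integrable_real_indicator simp: less_top[symmetric])
    also have "\<dots> = (\<integral>x. l (s n x) \<partial>\<mu>)"
      by (rule Bochner_Integration.integral_cong) (simp_all add: sum_cells s_def sp)
    finally show ?thesis .
  qed
  \<comment> \<open>The mean displacement, measured by \<open>q\<close>, when points are moved to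
    their representatives.\<close>
  define g where "g q n = (\<integral>x. q (s n x - x) \<partial>\<mu>)" for q :: "'a \<Rightarrow> real" and n
  have q_int: "(\<lambda>x. q (s n x - x)) \<in> borel_measurable \<mu>" if q: "q \<in> P" for q n
  proof -
    have "(\<lambda>x. q (x - a)) \<in> borel_measurable \<mu>" for a
      by (rule Cb_measurable[OF \<mu> seminorm_minus_continuous[OF q]])
    then show ?thesis
      by (intro s_meas[of "\<lambda>a x. q (a - x)"]) (subst seminormD(6)[OF seminorm[OF q]])
  qed
  have q_bound: "\<exists>C. \<forall>x\<in>A. \<forall>y\<in>A. norm (q (x - y)) \<le> C" if q: "q \<in> P" for q
  proof -
    obtain C where C: "\<forall>z\<in>q ` A. norm z \<le> C"
      using bounded_A q unfolding bounded_iff by blast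
    have "norm (q (x - y)) \<le> 2 * C" if "x \<in> A" "y \<in> A" for x y
      using seminormD(7)[OF seminorm[OF q], of x y 0] seminormD(4,5)[OF seminorm[OF q]] C that
        bspec[OF C, of "q x"] bspec[OF C, of "q y"] by fastforce
    then show ?thesis by blast
  qed
  have integrable_q: "integrable \<mu> (\<lambda>x. q (s n x - x))" if q: "q \<in> P" for q n
  proof -
    obtain C where "\<forall>x\<in>A. \<forall>y\<in>A. norm (q (x - y)) \<le> C"
      using q_bound[OF q] by blast
    then show ?thesis
      using s_A by (intro integrable_const_bound[where B = C] q_int q) (auto simp: sp)
  qed
  have g_lim: "g q \<longlonglongrightarrow> 0" if q: "q \<in> P" for q
  proof -
    obtain C where C: "\<forall>x\<in>A. \<forall>y\<in>A. norm (q (x - y)) \<le> C"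
      using q_bound[OF q] by blast
    have lim: "(\<lambda>n. q (s n x - x)) \<longlonglongrightarrow> 0" if x: "x \<in> A" for x
      using limitin_tendsto[OF s_lim[OF x] seminorm_minus_continuous[OF q, of x]]
      by (simp add: seminormD(3)[OF seminorm[OF q]])
    have "(\<lambda>n. \<integral>x. q (s n x - x) \<partial>\<mu>) \<longlonglongrightarrow> (\<integral>x. 0 \<partial>\<mu>)"
    proof (rule integral_dominated_convergence[where w = "\<lambda>_. C"])
      show "AE x in \<mu>. (\<lambda>n. q (s n x - x)) \<longlonglongrightarrow> 0"
        by (intro AE_I2 lim) (simp add: sp)
      show "AE x in \<mu>. norm (q (s n x - x)) \<le> C" for n
        using C s_A by (intro AE_I2) (auto simp: sp)
    qed (auto intro: q_int[OF q])
    then show ?thesis by (simp add: g_def[abs_def])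
  qed
  have l_int: "integrable \<mu> l" if "l \<in> dual" for l
    by (rule Cb_integrable[OF \<mu> dual_Cb[OF that]])
  have ls_bound: "\<exists>C. \<forall>x\<in>A. norm (l x) \<le> C" if "l \<in> dual" for l
    using Cb_obtain_bound[OF dual_Cb[OF that]] by (metis real_norm_def topspace_X)
  have ls_int: "integrable \<mu> (\<lambda>x. l (s n x))" if l: "l \<in> dual" for l n
  proof -
    obtain C where "\<forall>x\<in>A. norm (l x) \<le> C"
      using ls_bound[OF l] by blast
    then show ?thesis
      using s_A by (intro integrable_const_bound[where B = C] s_meas[of "\<lambda>a _. l a"]) (auto simp: sp)
  qed
  have near: "\<bar>l (b n) - (\<integral>x. l x \<partial>\<mu>)\<bar> \<le> g q n"
    if q: "q \<in> P" and l: "linear l" "\<And>x. \<bar>l x\<bar> \<le> q x" for l q n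
  proof -
    have ld: "l \<in> dual" by (rule dualI[OF l(1) q l(2)])
    have "l (b n) - (\<integral>x. l x \<partial>\<mu>) = (\<integral>x. l (s n x) - l x \<partial>\<mu>)"
      using ls_int[OF ld] l_int[OF ld] by (simp add: l_b[OF ld])
    also have "\<bar>\<dots>\<bar> \<le> (\<integral>x. \<bar>l (s n x) - l x\<bar> \<partial>\<mu>)"
      by (rule integral_abs_bound)
    also have "\<dots> \<le> g q n"
      unfolding g_def using ls_int[OF ld] l_int[OF ld] l
      by (intro integral_mono integrable_q q integrable_abs Bochner_Integration.integrable_diff)
        (simp_all flip: linear_diff)
    finally show ?thesis .
  qed
  \<comment> \<open>A functional dominated by \<open>q\<close> and equal to it at
    \<open>b n - b m\<close> replaces a vector valued integral estimate.\<close>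
  have q_b: "q (b n - b m) \<le> g q n + g q m" if q: "q \<in> P" for q n m
  proof -
    obtain l where l: "linear l" "\<And>x. \<bar>l x\<bar> \<le> q x" "l (b n - b m) = q (b n - b m)"
      using Hahn_Banach_seminorm[OF seminorm[OF q]] by blast
    show ?thesis
      using near[OF q l(1,2), of n] near[OF q l(1,2), of m] l(3) unfolding linear_diff[OF l(1)] by linarith
  qed
  have "MCauchy b"
    unfolding MCauchy_def
  proof (intro conjI allI impI)
    show "range b \<subseteq> A" using b_A by auto
    fix e :: real assume e: "e > 0"
    obtain F \<delta> where F: "finite F" "F \<subseteq> Q" "\<delta> > 0"
      "\<And>x y. (\<And>q. q \<in> F \<Longrightarrow> q (x - y) < \<delta>) \<Longrightarrow> seminorm_dist Q x y < e"
      using seminorm_dist_less[OF Q(2) seminorm_Q e] by blast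
    have "\<forall>\<^sub>F n in sequentially. \<forall>q\<in>F. g q n < \<delta> / 2"
      unfolding eventually_ball_finite_distrib[OF F(1)]
      using F(2,3) Q(1) by (intro ballI order_tendstoD(2)[OF g_lim]) auto
    then obtain N where N: "\<And>n q. n \<ge> N \<Longrightarrow> q \<in> F \<Longrightarrow> g q n < \<delta> / 2"
      unfolding eventually_sequentially by blast
    have "seminorm_dist Q (b n) (b m) < e" if "N \<le> n" "N \<le> m" for n m
    proof (rule F(4))
      fix q assume "q \<in> F"
      then show "q (b n - b m) < \<delta>"
        using q_b[of q n m] N[of n q] N[of m q] that F(2) Q(1) by (simp add: subset_iff)
    qed
    then show "\<exists>N. \<forall>n n'. N \<le> n \<longrightarrow> N \<le> n' \<longrightarrow> seminorm_dist Q (b n) (b n') < e"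
      by blast
  qed
  then obtain c where c: "limitin X b c sequentially"
    using complete_Q unfolding mcomplete_def X_eq_mtopology by blast
  have "l c = (\<integral>x. l x \<partial>\<mu>)" if l: "l \<in> dual" for l
  proof -
    obtain C where C: "\<forall>x\<in>A. norm (l x) \<le> C"
      using ls_bound[OF l] by blast
    have cont: "continuous_map X euclideanreal l"
      using dual_Cb[OF l] by (simp add: Cb_def)
    have "(\<lambda>n. \<integral>x. l (s n x) \<partial>\<mu>) \<longlonglongrightarrow> (\<integral>x. l x \<partial>\<mu>)"
    proof (rule integral_dominated_convergence[where w = "\<lambda>_. C"])
      show "AE x in \<mu>. (\<lambda>n. l (s n x)) \<longlonglongrightarrow> l x"
        by (intro AE_I2 limitin_tendsto[OF s_lim cont]) (simp add: sp)
      show "AE x in \<mu>. norm (l (s n x)) \<le> C" for n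
        using C s_A by (intro AE_I2) (auto simp: sp)
    qed (use l_int[OF l] ls_int[OF l] in auto)
    then have "(\<lambda>n. l (b n)) \<longlonglongrightarrow> (\<integral>x. l x \<partial>\<mu>)"
      by (simp add: l_b[OF l])
    then show ?thesis
      using limitin_tendsto[OF c cont] by (rule LIMSEQ_unique[rotated])
  qed
  then have "has_barycenter \<mu> c"
    using limitin_topspace[OF c] by (simp add: has_barycenter_def)
  then show ?thesis
    using c unfolding b_def by (rule that)
qed

lemma ex_base:
  obtains B :: "nat \<Rightarrow> 'a set" where "\<And>i. openin X (B i)"
    "\<And>U x. openin X U \<Longrightarrow> x \<in> U \<Longrightarrow> \<exists>i. x \<in> B i \<and> B i \<subseteq> U"
proof (rule second_countable_if_separable_metrizable[OF metrizable_X separable])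
  fix B :: "nat \<Rightarrow> 'a set"
  assume "\<And>i. openin X (B i)" "\<And>U x. openin X U \<Longrightarrow> x \<in> U \<Longrightarrow> \<exists>i. x \<in> B i \<and> B i \<subseteq> U"
  then show thesis by (rule that)
qed

lemma has_barycenter_barycenter:
  assumes \<mu>: "\<mu> \<in> \<M>"
  shows "has_barycenter \<mu> (barycenter P A \<mu>)"
proof -
  obtain B :: "nat \<Rightarrow> 'a set" where B: "\<And>i. openin X (B i)"
    "\<And>U x. openin X U \<Longrightarrow> x \<in> U \<Longrightarrow> \<exists>i. x \<in> B i \<and> B i \<subseteq> U"
    using ex_base by blast
  define r where "r n S = (SOME x. x \<in> cell B n S)" for n S
  have r: "r n S \<in> cell B n S" if "S \<in> cells B n" for n S
    unfolding r_def using that by (intro someI_ex[of "\<lambda>x. x \<in> cell B n S"]) (auto simp: cells_def cell_def)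
  obtain b where "has_barycenter \<mu> b"
    using discretize_limit[OF \<mu> B r] by blast
  then show ?thesis
    using barycenter_eqI by simp
qed

lemma barycenter_in: "\<mu> \<in> \<M> \<Longrightarrow> barycenter P A \<mu> \<in> A"
  using has_barycenter_barycenter by (auto simp: has_barycenter_def)

definition ennreal_convex :: "('a \<Rightarrow> ennreal) \<Rightarrow> bool" where
  "ennreal_convex h \<longleftrightarrow> (\<forall>x\<in>A. \<forall>y\<in>A. \<forall>u\<ge>0. \<forall>v\<ge>0. u + v = 1 \<longrightarrow>
     h (u *\<^sub>R x + v *\<^sub>R y) \<le> ennreal u * h x + ennreal v * h y)"

lemma ennreal_convex_sum:
  assumes h: "ennreal_convex h"
    and "finite S" "(\<Sum>i\<in>S. a i) = 1" "\<And>i. i \<in> S \<Longrightarrow> 0 \<le> a i" "\<And>i. i \<in> S \<Longrightarrow> y i \<in> A"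
  shows "h (\<Sum>i\<in>S. a i *\<^sub>R y i) \<le> (\<Sum>i\<in>S. ennreal (a i) * h (y i))"
  using assms(2-)
proof (induction S arbitrary: a)
  case empty
  then show ?case by simp
next
  case (insert i S)
  have nn: "0 \<le> sum a S" by (rule sum_nonneg) (use insert in auto)
  have sum: "a i + sum a S = 1" using insert by simp
  show ?case
  proof (cases "sum a S = 0")
    case True
    then have "\<forall>j\<in>S. a j = 0"
      using insert by (subst (asm) sum_nonneg_eq_0_iff) auto
    then show ?thesis using insert True sum by simp
  next
    case False
    define c where "c = sum a S"
    have c: "c > 0" using False nn by (simp add: c_def)
    have IH: "h (\<Sum>j\<in>S. (a j / c) *\<^sub>R y j) \<le> (\<Sum>j\<in>S. ennreal (a j / c) * h (y j))"
      using insert c by (intro insert.IH) (auto simp: sum_divide_distrib[symmetric] c_def)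
    have "(\<Sum>j\<in>S. (a j / c) *\<^sub>R y j) \<in> A"
      using insert c by (intro convex_sum convex_A) (auto simp: sum_divide_distrib[symmetric] c_def)
    moreover have "(\<Sum>j\<in>insert i S. a j *\<^sub>R y j) = a i *\<^sub>R y i + c *\<^sub>R (\<Sum>j\<in>S. (a j / c) *\<^sub>R y j)"
      using insert c by (simp add: scaleR_sum_right)
    ultimately have "h (\<Sum>j\<in>insert i S. a j *\<^sub>R y j)
        \<le> ennreal (a i) * h (y i) + ennreal c * h (\<Sum>j\<in>S. (a j / c) *\<^sub>R y j)"
      using h insert sum c unfolding ennreal_convex_def by (simp add: c_def)
    also have "\<dots> \<le> ennreal (a i) * h (y i) + ennreal c * (\<Sum>j\<in>S. ennreal (a j / c) * h (y j))"
      by (intro add_left_mono mult_left_mono IH) simp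
    also have "ennreal c * (\<Sum>j\<in>S. ennreal (a j / c) * h (y j)) = (\<Sum>j\<in>S. ennreal (a j) * h (y j))"
      using c insert by (auto simp: sum_distrib_left mult.assoc[symmetric] ennreal_mult[symmetric] intro!: sum.cong)
    finally show ?thesis using insert by simp
  qed
qed

text \<open>Were \<open>h\<close> above its average everywhere on \<open>C\<close>, integration over
  \<open>C\<close> would give a strict inequality of a finite number with itself. Multiplying by the
  measure instead of dividing includes null sets, where every point qualifies.\<close>

lemma ex_below_average:
  assumes \<mu>: "\<mu> \<in> \<M>" and C: "C \<in> sets \<mu>" "C \<noteq> {}"
    and h [measurable]: "h \<in> borel_measurable \<mu>" and fin: "(\<integral>\<^sup>+x\<in>C. h x \<partial>\<mu>) < \<top>"
  obtains x where "x \<in> C" "ennreal (measure \<mu> C) * h x \<le> (\<integral>\<^sup>+x\<in>C. h x \<partial>\<mu>)"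
proof (rule ccontr)
  interpret prob_space \<mu> using \<mu> borel_prob_measuresD by blast
  note [measurable] = C(1)
  define J where "J = (\<integral>\<^sup>+x\<in>C. h x \<partial>\<mu>)"
  assume "\<not> thesis"
  then have "\<not> (x \<in> C \<and> ennreal (measure \<mu> C) * h x \<le> J)" for x
    using that unfolding J_def by blast
  then have gt: "J < ennreal (measure \<mu> C) * h x" if "x \<in> C" for x
    using that by (simp add: not_le)
  define m where "m = measure \<mu> C"
  have m: "m > 0"
  proof (rule ccontr)
    obtain x where "x \<in> C" using C(2) by blast
    moreover assume "\<not> m > 0"
    then have "m = 0" by (simp add: m_def zero_less_measure_iff)
    ultimately show False using gt[of x] by (simp add: m_def)
  qed
  have less: "ennreal (1 / m) * J < h x" if "x \<in> C" for x
  proof -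
    have "ennreal (1 / m) * J < ennreal (1 / m) * (ennreal m * h x)"
      using gt[OF that] m by (intro ennreal_mult_strict_left_mono) (auto simp: m_def)
    also have "\<dots> = h x"
      using m by (simp add: mult.assoc[symmetric] ennreal_mult[symmetric])
    finally show ?thesis .
  qed
  have eq: "(\<integral>\<^sup>+x. ennreal (1 / m) * J * indicator C x \<partial>\<mu>) = J"
  proof -
    have "(\<integral>\<^sup>+x. ennreal (1 / m) * J * indicator C x \<partial>\<mu>) = ennreal (1 / m) * J * emeasure \<mu> C"
      by (rule nn_integral_cmult_indicator[OF C(1)])
    also have "\<dots> = J * (ennreal (1 / m) * ennreal m)"
      by (simp add: emeasure_eq_measure m_def ac_simps)
    also have "ennreal (1 / m) * ennreal m = 1"
      using m by (simp flip: ennreal_mult)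
    finally show ?thesis by simp
  qed
  have "(\<integral>\<^sup>+x. ennreal (1 / m) * J * indicator C x \<partial>\<mu>) < (\<integral>\<^sup>+x\<in>C. h x \<partial>\<mu>)"
  proof (rule nn_integral_less)
    show "(\<integral>\<^sup>+x. ennreal (1 / m) * J * indicator C x \<partial>\<mu>) \<noteq> \<infinity>"
      using fin unfolding eq by (simp add: J_def less_top)
    show "AE x in \<mu>. ennreal (1 / m) * J * indicator C x \<le> h x * indicator C x"
      using less by (intro AE_I2) (auto simp: indicator_def intro: less_imp_le)
    show "\<not> (AE x in \<mu>. h x * indicator C x \<le> ennreal (1 / m) * J * indicator C x)"
    proof
      assume "AE x in \<mu>. h x * indicator C x \<le> ennreal (1 / m) * J * indicator C x"
      then have "AE x in \<mu>. x \<notin> C"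
        by eventually_elim (use less in \<open>auto simp: indicator_def not_le[symmetric] split: if_splits\<close>)
      then have "emeasure \<mu> C = 0"
        by (subst (asm) AE_iff_measurable[of C]) (auto dest: sets.sets_into_space[OF C(1), THEN subsetD])
      then show False using m by (simp add: m_def measure_def)
    qed
  qed measurable
  then show False unfolding eq by (simp add: J_def)
qed

text \<open>The representative of every cell is chosen below the average of \<open>h\<close> over the cell; no
  separation theorem is needed.\<close>

theorem Jensen_barycenter:
  assumes \<mu>: "\<mu> \<in> \<M>" and lsc: "lsc_on X h" and conv: "ennreal_convex h"
  shows "h (barycenter P A \<mu>) \<le> (\<integral>\<^sup>+x. h x \<partial>\<mu>)"
proof (rule ccontr)
  interpret prob_space \<mu> using \<mu> borel_prob_measuresD by blast
  note sp = borel_prob_measuresD(3)[OF \<mu>, unfolded topspace_X]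
  define I where "I = (\<integral>\<^sup>+x. h x \<partial>\<mu>)"
  assume "\<not> h (barycenter P A \<mu>) \<le> (\<integral>\<^sup>+x. h x \<partial>\<mu>)"
  then have gt: "I < h (barycenter P A \<mu>)" by (simp add: I_def)
  have h [measurable]: "h \<in> borel_measurable \<mu>"
    by (rule lsc_measurable[OF \<mu> lsc])
  obtain B :: "nat \<Rightarrow> 'a set" where B: "\<And>i. openin X (B i)"
    "\<And>U x. openin X U \<Longrightarrow> x \<in> U \<Longrightarrow> \<exists>i. x \<in> B i \<and> B i \<subseteq> U"
    using ex_base by blast
  note [measurable] = cell_sets[OF \<mu> B(1)]
  have ex: "\<exists>x. x \<in> cell B n S \<and> ennreal (measure \<mu> (cell B n S)) * h x \<le> (\<integral>\<^sup>+x\<in>cell B n S. h x \<partial>\<mu>)"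
    if S: "S \<in> cells B n" for n S
  proof -
    have "(\<integral>\<^sup>+x\<in>cell B n S. h x \<partial>\<mu>) \<le> I"
      unfolding I_def by (intro nn_integral_mono) (auto simp: indicator_def)
    \<comment> \<open>The strict inequality assumed for contradiction supplies the
      finiteness.\<close>
    also have "I < \<top>"
      using gt by (rule less_le_trans) simp
    finally have fin: "(\<integral>\<^sup>+x\<in>cell B n S. h x \<partial>\<mu>) < \<top>" .
    have "cell B n S \<noteq> {}" using S by (auto simp: cells_def cell_def)
    from ex_below_average[OF \<mu> cell_sets[OF \<mu> B(1)] this h fin] show ?thesis
      by blast
  qed
  define r where "r n S = (SOME x. x \<in> cell B n S \<and>
    ennreal (measure \<mu> (cell B n S)) * h x \<le> (\<integral>\<^sup>+x\<in>cell B n S. h x \<partial>\<mu>))" for n S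
  have r: "r n S \<in> cell B n S"
      "ennreal (measure \<mu> (cell B n S)) * h (r n S) \<le> (\<integral>\<^sup>+x\<in>cell B n S. h x \<partial>\<mu>)"
    if "S \<in> cells B n" for n S
    unfolding r_def using someI_ex[OF ex[OF that]] by blast+
  have le: "h (discretize B r \<mu> n) \<le> I" for n
  proof -
    have "h (discretize B r \<mu> n) \<le> (\<Sum>S\<in>cells B n. ennreal (measure \<mu> (cell B n S)) * h (r n S))"
      unfolding discretize_def using r(1)
      by (intro ennreal_convex_sum conv finite_cells sum_measure_cells[OF \<mu> B(1)]) (auto simp: cell_def)
    also have "\<dots> \<le> (\<Sum>S\<in>cells B n. \<integral>\<^sup>+x\<in>cell B n S. h x \<partial>\<mu>)"
      by (intro sum_mono r)
    also have "\<dots> = (\<integral>\<^sup>+x. (\<Sum>S\<in>cells B n. indicator (cell B n S) x * h x) \<partial>\<mu>)"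
      by (subst nn_integral_sum) (auto simp: mult.commute)
    also have "\<dots> = I"
      unfolding I_def by (intro nn_integral_cong sum_cells) (simp add: sp)
    finally show ?thesis .
  qed
  obtain b where b: "has_barycenter \<mu> b" "limitin X (discretize B r \<mu>) b sequentially"
    using discretize_limit[OF \<mu> B r(1)] by blast
  \<comment> \<open>Lower semicontinuity makes this an open neighbourhood of the barycenter; the
    discrete barycenters must enter it, although \<open>h\<close> is at most \<open>I\<close> at
    each of them.\<close>
  have "b \<in> {x \<in> topspace X. I < h x}"
    using gt barycenter_eqI[OF b(1)] b(1) by (simp add: has_barycenter_def)
  moreover have "openin X {x \<in> topspace X. I < h x}"
    using lsc by (simp add: lsc_on_def)
  ultimately have "\<forall>\<^sub>F n in sequentially. discretize B r \<mu> n \<in> {x \<in> topspace X. I < h x}"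
    using b(2) unfolding limitin_def by blast
  then obtain n where "I < h (discretize B r \<mu> n)"
    using eventually_happens by fastforce
  then show False using leD[OF le[of n]] by blast
qed

subsection \<open>The roof of a lower semicontinuous function\<close>

abbreviation borel_X where "borel_X \<equiv> sigma A {U. openin X U}"

lemma sets_\<M>: "\<mu> \<in> \<M> \<Longrightarrow> sets \<mu> = sets borel_X"
  by (simp add: borel_prob_measuresD(2))

lemma space_borel_X: "space borel_X = A"
  using openin_subset[of X] by (subst space_measure_of) auto

lemma return_in: "x \<in> A \<Longrightarrow> return borel_X x \<in> \<M>"
  by (simp add: borel_prob_measures_def prob_space_return space_borel_X)

lemma has_barycenter_return:
  assumes x: "x \<in> A"
  shows "has_barycenter (return borel_X x) x"
  unfolding has_barycenter_def
proof (intro conjI ballI x)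
  fix l assume "l \<in> dual"
  then have "l \<in> borel_measurable (return borel_X x)"
    using Cb_measurable[OF return_in[OF x]] dual_Cb by (auto simp: Cb_def)
  then show "l x = (\<integral>y. l y \<partial>return borel_X x)"
    using x by (subst integral_return) (simp_all add: space_borel_X)
qed

text \<open>The mixture is the bind of a Bernoulli choice between the two measures, so the integral
  formulas for bind apply both to \<open>ennreal\<close> integrands and to continuous linear
  functionals.\<close>

lemma ex_mixture:
  assumes \<mu>: "\<mu> \<in> \<M>" and \<nu>: "\<nu> \<in> \<M>" and uv: "0 \<le> u" "0 \<le> v" "u + v = 1"
  obtains \<rho> where "\<rho> \<in> \<M>"
    "barycenter P A \<rho> = u *\<^sub>R barycenter P A \<mu> + v *\<^sub>R barycenter P A \<nu>"
    "\<And>h. h \<in> borel_measurable borel_X \<Longrightarrow>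
      (\<integral>\<^sup>+x. h x \<partial>\<rho>) = ennreal u * (\<integral>\<^sup>+x. h x \<partial>\<mu>) + ennreal v * (\<integral>\<^sup>+x. h x \<partial>\<nu>)"
proof -
  define N where "N = (\<lambda>b. if b then \<mu> else \<nu>)"
  define p where "p = measure_pmf (bernoulli_pmf u)"
  have v: "v = 1 - u" and u1: "u \<le> 1" using uv by auto
  have prob: "prob_space (N b)" and sets_N: "sets (N b) = sets borel_X" for b
    using \<mu> \<nu> sets_\<M> borel_prob_measuresD(1) by (auto simp: N_def)
  have N: "N \<in> measurable p (subprob_algebra borel_X)"
    unfolding p_def using prob sets_N by (simp add: space_subprob_algebra prob_space_imp_subprob_space)
  define \<rho> where "\<rho> = p \<bind> N"
  have \<rho>: "\<rho> \<in> \<M>"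
    unfolding borel_prob_measures_def
  proof (intro CollectI conjI)
    show "prob_space \<rho>"
      unfolding \<rho>_def p_def
      by (rule measure_pmf.prob_space_bind[OF AE_I2]) (use prob N in \<open>simp_all add: p_def\<close>)
    show "sets \<rho> = sets (sigma (topspace X) {U. openin X U})"
      unfolding \<rho>_def p_def by (subst sets_bind[of _ _ borel_X]) (simp_all add: sets_N)
  qed
  show ?thesis
  proof (rule that[OF \<rho>])
    show "(\<integral>\<^sup>+x. h x \<partial>\<rho>) = ennreal u * (\<integral>\<^sup>+x. h x \<partial>\<mu>) + ennreal v * (\<integral>\<^sup>+x. h x \<partial>\<nu>)"
      if h: "h \<in> borel_measurable borel_X" for h
      unfolding \<rho>_def nn_integral_bind[OF h N] unfolding p_def
      using uv u1 by (simp add: N_def v mult.commute)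
    have "has_barycenter \<rho> (u *\<^sub>R barycenter P A \<mu> + v *\<^sub>R barycenter P A \<nu>)"
      unfolding has_barycenter_def
    proof (intro conjI ballI)
      show "u *\<^sub>R barycenter P A \<mu> + v *\<^sub>R barycenter P A \<nu> \<in> A"
        using convexD[OF convex_A barycenter_in[OF \<mu>] barycenter_in[OF \<nu>] uv] .
      fix l assume l: "l \<in> dual"
      obtain C where C: "\<And>x. x \<in> A \<Longrightarrow> \<bar>l x\<bar> \<le> C"
        using Cb_obtain_bound[OF dual_Cb[OF l]] by (metis topspace_X)
      have "l \<in> borel_measurable \<mu>"
        using Cb_measurable[OF \<mu>] dual_Cb[OF l] by (auto simp: Cb_def)
      then have lm: "l \<in> borel_measurable borel_X"
        using measurable_cong_sets[OF sets_\<M>[OF \<mu>] refl] by blast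
      have "(\<integral>x. l x \<partial>\<rho>) = (\<integral>b. (\<integral>x. l x \<partial>N b) \<partial>p)"
        unfolding \<rho>_def
        by (rule integral_bind[OF lm _ N, where B = C and B' = 1])
          (auto simp: space_borel_X C p_def prob_space.emeasure_space_1[OF prob] measure_pmf.finite_measure)
      also have "\<dots> = u * (\<integral>x. l x \<partial>\<mu>) + v * (\<integral>x. l x \<partial>\<nu>)"
        unfolding p_def using uv u1 by (simp add: N_def v mult.commute)
      finally show "l (u *\<^sub>R barycenter P A \<mu> + v *\<^sub>R barycenter P A \<nu>) = (\<integral>x. l x \<partial>\<rho>)"
        using has_barycenter_barycenter[OF \<mu>] has_barycenter_barycenter[OF \<nu>] l
        by (simp add: has_barycenter_def dual_def linear_add linear_scale)
    qed
    then show "barycenter P A \<rho> = u *\<^sub>R barycenter P A \<mu> + v *\<^sub>R barycenter P A \<nu>"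
      by (rule barycenter_eqI)
  qed
qed

definition roof :: "('a \<Rightarrow> ennreal) \<Rightarrow> 'a \<Rightarrow> ennreal" where
  "roof h x = (INF \<mu>\<in>{\<mu> \<in> \<M>. barycenter P A \<mu> = x}. \<integral>\<^sup>+y. h y \<partial>\<mu>)"

lemma roof_lower: "\<mu> \<in> \<M> \<Longrightarrow> roof h (barycenter P A \<mu>) \<le> (\<integral>\<^sup>+y. h y \<partial>\<mu>)"
  unfolding roof_def by (rule INF_lower) simp

lemma roof_lessE:
  assumes "roof h x < c"
  obtains \<mu> where "\<mu> \<in> \<M>" "barycenter P A \<mu> = x" "(\<integral>\<^sup>+y. h y \<partial>\<mu>) < c"
  using assms unfolding roof_def INF_less_iff by auto

lemma roof_mono: "(\<And>x. x \<in> A \<Longrightarrow> h x \<le> h' x) \<Longrightarrow> roof h x \<le> roof h' x"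
  unfolding roof_def
  by (rule INF_superset_mono[OF order_refl], rule nn_integral_mono) (auto simp: borel_prob_measuresD(3))

lemma lsc_measurable_borel_X:
  fixes h :: "'a \<Rightarrow> ennreal"
  assumes "lsc_on X h" shows "h \<in> borel_measurable borel_X"
proof (cases "A = {}")
  case True
  then show ?thesis by (simp add: space_borel_X measurable_def)
next
  case False
  then obtain x where "x \<in> A" by auto
  then show ?thesis
    using lsc_measurable[OF return_in assms] by simp
qed

lemma roof_le:
  assumes "lsc_on X h" "x \<in> A"
  shows "roof h x \<le> h x"
  using roof_lower[OF return_in[OF assms(2)], of h] barycenter_eqI[OF has_barycenter_return[OF assms(2)]]
    nn_integral_return[OF _ lsc_measurable_borel_X[OF assms(1)], of x] assms(2)
  by (simp add: space_borel_X)

text \<open>Nearly optimal measures for \<open>x\<close> and \<open>y\<close> are mixed with the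
  weights \<open>u\<close> and \<open>v\<close>.\<close>

lemma roof_convex:
  assumes h: "lsc_on X h"
  shows "ennreal_convex (roof h)"
  unfolding ennreal_convex_def
proof (intro ballI allI impI)
  fix x y and u v :: real
  assume xy: "x \<in> A" "y \<in> A" and uv: "0 \<le> u" "0 \<le> v" "u + v = 1"
  \<comment> \<open>With a zero weight, finiteness of the right-hand side would say nothing about
    the corresponding roof, as \<open>0 * \<infinity> = 0\<close>.\<close>
  consider "u = 0" | "v = 0" | "u > 0" "v > 0" using uv by linarith
  then show "roof h (u *\<^sub>R x + v *\<^sub>R y) \<le> ennreal u * roof h x + ennreal v * roof h y"
  proof cases
    case 3
    show ?thesis
    proof (rule ennreal_le_epsilon)
      fix e :: real
      assume fin: "ennreal u * roof h x + ennreal v * roof h y < top" and e: "0 < e"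
      from fin have "ennreal u * roof h x < top" "ennreal v * roof h y < top"
        by (simp_all only: ennreal_add_less_top)
      moreover have "ennreal u \<noteq> 0" "ennreal v \<noteq> 0"
        using 3 by simp_all
      ultimately have "roof h x \<noteq> top" "roof h y \<noteq> top"
        unfolding ennreal_mult_less_top by auto
      then have less: "roof h x < roof h x + ennreal e" "roof h y < roof h y + ennreal e"
        using e by (simp_all add: less_top)
      obtain \<mu> where \<mu>: "\<mu> \<in> \<M>" "barycenter P A \<mu> = x" "(\<integral>\<^sup>+y. h y \<partial>\<mu>) < roof h x + ennreal e"
        using roof_lessE[OF less(1)] by blast
      obtain \<nu> where \<nu>: "\<nu> \<in> \<M>" "barycenter P A \<nu> = y" "(\<integral>\<^sup>+y. h y \<partial>\<nu>) < roof h y + ennreal e"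
        using roof_lessE[OF less(2)] by blast
      obtain \<rho> where \<rho>: "\<rho> \<in> \<M>" "barycenter P A \<rho> = u *\<^sub>R barycenter P A \<mu> + v *\<^sub>R barycenter P A \<nu>"
        "(\<integral>\<^sup>+x. h x \<partial>\<rho>) = ennreal u * (\<integral>\<^sup>+x. h x \<partial>\<mu>) + ennreal v * (\<integral>\<^sup>+x. h x \<partial>\<nu>)"
        using ex_mixture[OF \<mu>(1) \<nu>(1) uv] lsc_measurable_borel_X[OF h] by blast
      have "roof h (u *\<^sub>R x + v *\<^sub>R y) \<le> ennreal u * (\<integral>\<^sup>+x. h x \<partial>\<mu>) + ennreal v * (\<integral>\<^sup>+x. h x \<partial>\<nu>)"
        using roof_lower[OF \<rho>(1), of h] by (simp only: \<rho>(2,3) \<mu>(2) \<nu>(2))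
      also have "\<dots> \<le> ennreal u * (roof h x + ennreal e) + ennreal v * (roof h y + ennreal e)"
        by (rule add_mono; rule mult_left_mono) (use \<mu>(3) \<nu>(3) in \<open>simp_all add: less_imp_le\<close>)
      also have "\<dots> = ennreal u * roof h x + ennreal v * roof h y + (ennreal u + ennreal v) * ennreal e"
        by (simp only: distrib_left distrib_right ac_simps)
      also have "ennreal u + ennreal v = 1"
        using uv by (simp flip: ennreal_plus)
      finally show "roof h (u *\<^sub>R x + v *\<^sub>R y) \<le> ennreal u * roof h x + ennreal v * roof h y + ennreal e"
        by simp
    qed
  qed (use uv in auto)
qed

text \<open>A convergent sequence of barycenters together with its limit is compact, so the measures
  have a weak cluster point. Functionals of \<open>dual\<close> identify its barycenter, and
  semicontinuity of the integral transfers the bounds. A varying \<open>f n\<close> serves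
  increasing limits, a constant one the closedness of the roof.\<close>

lemma mu_compact_cluster:
  assumes comp: "mu_compact P A"
    and f: "\<And>n. lsc_on X (f n :: 'a \<Rightarrow> ennreal)" "\<And>n x. x \<in> A \<Longrightarrow> f n x \<le> f (Suc n) x"
    and \<mu>: "\<And>n. \<mu> n \<in> \<M>" "limitin X (\<lambda>n. barycenter P A (\<mu> n)) x sequentially"
    and le: "\<And>n. (\<integral>\<^sup>+y. f n y \<partial>\<mu> n) \<le> c"
  obtains \<nu> where "\<nu> \<in> \<M>" "barycenter P A \<nu> = x" "\<And>m. (\<integral>\<^sup>+y. f m y \<partial>\<nu>) \<le> c"
proof -
  define K where "K = insert x (range (\<lambda>n. barycenter P A (\<mu> n)))"
  have "compactin X K"
    unfolding K_def using barycenter_in[OF \<mu>(1)]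
    by (intro compactin_sequence_with_limit[OF \<mu>(2)]) auto
  then have comp': "compactin (weak_topology X) {\<nu> \<in> \<M>. barycenter P A \<nu> \<in> K}"
    using comp by (simp add: mu_compact_def Let_def)
  obtain \<nu> where \<nu>: "\<nu> \<in> {\<nu> \<in> \<M>. barycenter P A \<nu> \<in> K}"
    "\<And>U. openin (weak_topology X) U \<Longrightarrow> \<nu> \<in> U \<Longrightarrow> frequently (\<lambda>z. z \<in> U) (filtermap \<mu> sequentially)"
    by (rule compactin_imp_cluster[OF comp', of "filtermap \<mu> sequentially"])
      (auto simp: filtermap_bot_iff eventually_filtermap \<mu> K_def)
  then have \<nu>M: "\<nu> \<in> \<M>" by simp
  have freq: "\<exists>\<^sub>F n in sequentially. \<mu> n \<in> U" if "openin (weak_topology X) U" "\<nu> \<in> U" for U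
    using \<nu>(2)[OF that] by (simp add: frequently_def eventually_filtermap)
  show ?thesis
  proof (rule that[OF \<nu>M])
    show "barycenter P A \<nu> = x"
    proof (rule dual_separates)
      show "barycenter P A \<nu> \<in> A" by (rule barycenter_in[OF \<nu>M])
      show "x \<in> A" using limitin_topspace[OF \<mu>(2)] by simp
      fix l assume l: "l \<in> dual"
      have int: "l (barycenter P A \<nu>') = (\<integral>x. l x \<partial>\<nu>')" if "\<nu>' \<in> \<M>" for \<nu>'
        using has_barycenter_barycenter[OF that] l by (simp add: has_barycenter_def)
      show "l (barycenter P A \<nu>) = l x"
      proof (rule ccontr)
        assume ne: "l (barycenter P A \<nu>) \<noteq> l x"
        \<comment> \<open>Half the distance makes the two balls disjoint.\<close>
        define e where "e = dist (l (barycenter P A \<nu>)) (l x) / 2"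
        have e: "e > 0" using ne by (simp add: e_def)
        have "(\<lambda>n. l (barycenter P A (\<mu> n))) \<longlonglongrightarrow> l x"
          using dual_Cb[OF l] by (intro limitin_tendsto[OF \<mu>(2)]) (simp add: Cb_def)
        then have "\<forall>\<^sub>F n in sequentially. dist (l (barycenter P A (\<mu> n))) (l x) < e"
          using e by (rule tendstoD)
        then obtain N where N: "\<And>n. n \<ge> N \<Longrightarrow> dist (l (barycenter P A (\<mu> n))) (l x) < e"
          unfolding eventually_sequentially by blast
        have "\<exists>\<^sub>F n in sequentially. \<mu> n \<in> {\<nu>' \<in> \<M>. (\<integral>x. l x \<partial>\<nu>') \<in> ball (l (barycenter P A \<nu>)) e}"
          using e \<nu>M int[OF \<nu>M] by (intro freq openin_weak_integral dual_Cb l) auto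
        then obtain n where n: "n \<ge> N" "(\<integral>x. l x \<partial>\<mu> n) \<in> ball (l (barycenter P A \<nu>)) e"
          unfolding frequently_sequentially by blast
        then show False
          using N[OF n(1)] dist_triangle[of "l (barycenter P A \<nu>)" "l x" "l (barycenter P A (\<mu> n))"]
          unfolding int[OF \<mu>(1)[of n]] mem_ball e_def by linarith
      qed
    qed
    show "(\<integral>\<^sup>+y. f m y \<partial>\<nu>) \<le> c" for m
    proof (rule ccontr)
      assume "\<not> (\<integral>\<^sup>+y. f m y \<partial>\<nu>) \<le> c"
      then have "\<exists>\<^sub>F n in sequentially. \<mu> n \<in> {\<nu> \<in> \<M>. c < (\<integral>\<^sup>+y. f m y \<partial>\<nu>)}"
        using \<nu>M by (intro freq openin_weak_nn_integral metrizable_X f) auto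
      \<comment> \<open>Past \<open>m\<close> the integrand \<open>f m\<close> is dominated by
        \<open>f n\<close>, for which the bound along the sequence is known.\<close>
      then obtain n where n: "n \<ge> m" "c < (\<integral>\<^sup>+y. f m y \<partial>\<mu> n)"
        unfolding frequently_sequentially by auto
      have "(\<integral>\<^sup>+y. f m y \<partial>\<mu> n) \<le> (\<integral>\<^sup>+y. f n y \<partial>\<mu> n)"
      proof (rule nn_integral_mono)
        fix y assume "y \<in> space (\<mu> n)"
        then have "y \<in> A" using borel_prob_measuresD(3)[OF \<mu>(1)] by simp
        then show "f m y \<le> f n y"
          using lift_Suc_mono_le[of "\<lambda>n. f n y", OF f(2) n(1)] by blast
      qed
      with n(2) le[of n] show False by simp
    qed
  qed
qed

text \<open>As \<open>X\<close> is metrizable, sublevel sets can be tested on sequences. The bound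
  is relaxed to \<open>c' > c\<close> to obtain actual measures from the infimum, and
  \<open>c'\<close> is then lowered to \<open>c\<close>.\<close>

lemma roof_lsc:
  assumes comp: "mu_compact P A" and h: "lsc_on X h"
  shows "lsc_on X (roof h)"
  unfolding lsc_on_def
proof
  fix c
  have "closedin mtopology {x \<in> A. roof h x \<le> c}"
    unfolding metric_closedin_iff_sequentially_closed
  proof (intro conjI allI impI, blast)
    fix \<sigma> x
    assume *: "range \<sigma> \<subseteq> {x \<in> A. roof h x \<le> c} \<and> limitin mtopology \<sigma> x sequentially"
    have "roof h x \<le> c'" if "c < c'" for c'
    proof -
      have "roof h (\<sigma> n) < c'" for n
        using * that by (auto intro: le_less_trans)
      then have "\<exists>\<mu>. \<mu> \<in> \<M> \<and> barycenter P A \<mu> = \<sigma> n \<and> (\<integral>\<^sup>+y. h y \<partial>\<mu>) < c'" for n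
        by (rule roof_lessE) blast
      then obtain \<mu> where \<mu>: "\<And>n. \<mu> n \<in> \<M>" "\<And>n. barycenter P A (\<mu> n) = \<sigma> n"
        "\<And>n. (\<integral>\<^sup>+y. h y \<partial>\<mu> n) < c'"
        by metis
      obtain \<nu> where "\<nu> \<in> \<M>" "barycenter P A \<nu> = x" "(\<integral>\<^sup>+y. h y \<partial>\<nu>) \<le> c'"
      proof (rule mu_compact_cluster[OF comp, of "\<lambda>_. h" \<mu> x c'])
        show "limitin X (\<lambda>n. barycenter P A (\<mu> n)) x sequentially"
          using * by (simp add: \<mu>(2) X_eq_mtopology)
        show "(\<integral>\<^sup>+y. h y \<partial>\<mu> n) \<le> c'" for n
          using \<mu>(3) by (rule less_imp_le)
      qed (use h \<mu>(1) in auto)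
      then show ?thesis using roof_lower[of \<nu> h] by auto
    qed
    then have "roof h x \<le> c" by (rule dense_ge)
    then show "x \<in> {x \<in> A. roof h x \<le> c}"
      using * limitin_topspace[of mtopology \<sigma> x] by auto
  qed
  then have "openin X (topspace X - {x \<in> A. roof h x \<le> c})"
    unfolding X_eq_mtopology by (intro openin_diff openin_topspace)
  moreover have "topspace X - {x \<in> A. roof h x \<le> c} = {x \<in> topspace X. c < roof h x}"
    by auto
  ultimately show "openin X {x \<in> topspace X. c < roof h x}" by simp
qed

end

subsection \<open>Shifting lower bounded functions into the nonnegative range\<close>

text \<open>A Galois connection between shifting down with truncation at 0 and shifting back. It
  carries semicontinuity, suprema and inequalities across the shift without case distinctions on
  infinities.\<close>

lemma e2ennreal_minus_le_iff: "e2ennreal (t - ereal c) \<le> R \<longleftrightarrow> t \<le> enn2ereal R + ereal c"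
proof (cases "t - ereal c \<le> 0")
  case True
  then have "t \<le> ereal c" by (cases t) auto
  moreover have "ereal c \<le> enn2ereal R + ereal c"
    using add_right_mono[OF enn2ereal_nonneg[of R], of "ereal c"] by simp
  ultimately show ?thesis using True by (simp add: e2ennreal_neg)
next
  case False
  then have "e2ennreal (t - ereal c) \<le> R \<longleftrightarrow> t - ereal c \<le> enn2ereal R"
    by (simp add: less_eq_ennreal.rep_eq enn2ereal_e2ennreal)
  then show ?thesis by (cases t; cases "enn2ereal R") (auto simp: algebra_simps)
qed

lemma less_enn2ereal_plus_iff:
  "d < enn2ereal R + ereal c \<longleftrightarrow> d < ereal c \<or> e2ennreal (d - ereal c) < R"
proof (cases "d < ereal c")
  case True
  then have "d < enn2ereal R + ereal c"
    using add_right_mono[OF enn2ereal_nonneg[of R], of "ereal c"] by (simp add: less_le_trans)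
  with True show ?thesis by simp
next
  case False
  then have "0 \<le> d - ereal c" by (cases d) auto
  then have "e2ennreal (d - ereal c) < R \<longleftrightarrow> d - ereal c < enn2ereal R"
    by (simp add: less_ennreal.rep_eq enn2ereal_e2ennreal)
  with False show ?thesis by (cases d; cases "enn2ereal R") (auto simp: algebra_simps)
qed

lemma lsc_on_shift:
  fixes f :: "'a \<Rightarrow> ereal"
  assumes "lsc_on X f"
  shows "lsc_on X (\<lambda>x. e2ennreal (f x - ereal c))"
proof -
  have "d < e2ennreal (f x - ereal c) \<longleftrightarrow> enn2ereal d + ereal c < f x" for d x
    using e2ennreal_minus_le_iff[of "f x" c d] by (simp add: not_le[symmetric])
  then show ?thesis
    using assms unfolding lsc_on_def by simp
qed

lemma lsc_on_unshift:
  assumes "lsc_on X (h :: 'a \<Rightarrow> ennreal)"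
  shows "lsc_on X (\<lambda>x. enn2ereal (h x) + ereal c)"
  unfolding lsc_on_def
proof
  fix d :: ereal
  show "openin X {x \<in> topspace X. d < enn2ereal (h x) + ereal c}"
    using assms by (cases "d < ereal c") (auto simp: less_enn2ereal_plus_iff lsc_on_def)
qed

text \<open>The constant passes through because the weights add up to 1; zero weights are treated
  apart because of infinite values.\<close>

lemma ereal_convex_combination_shift:
  assumes "0 \<le> u" "0 \<le> v" "u + v = 1"
  shows "ereal u * (enn2ereal a + ereal c) + ereal v * (enn2ereal b + ereal c)
    = enn2ereal (ennreal u * a + ennreal v * b) + ereal c"
proof -
  have v: "v = 1 - u" using assms by simp
  consider "u = 0" | "v = 0" | "u > 0" "v > 0" using assms by linarith
  then show ?thesis
  proof cases
    case 3
    then show ?thesis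
      unfolding plus_ennreal.rep_eq times_ennreal.rep_eq enn2ereal_ennreal[OF assms(1)] enn2ereal_ennreal[OF assms(2)]
      using assms enn2ereal_nonneg[of a] enn2ereal_nonneg[of b] v distrib_left[of c u v]
      by (cases "enn2ereal a"; cases "enn2ereal b") (auto simp: algebra_simps)
  qed (use assms in \<open>auto simp flip: zero_ereal_def\<close>)
qed

section \<open>Convex closures expressed by roofs\<close>

context bccsm
begin

text \<open>Jensen's inequality for \<open>max g c - c\<close>. A minorant \<open>g\<close> may drop
  below \<open>c\<close>, but the truncation is still convex and lower semicontinuous, and it is now
  nonnegative.\<close>

lemma minorant_le_integral:
  assumes g: "g \<in> convex_closed_minorants P A f" and \<mu>: "\<mu> \<in> \<M>"
  shows "g (barycenter P A \<mu>) \<le> enn2ereal (\<integral>\<^sup>+x. e2ennreal (f x - ereal c) \<partial>\<mu>) + ereal c"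
proof -
  have g: "ereal_convex_on A g" "lsc_on X g" "\<And>x. x \<in> A \<Longrightarrow> g x \<le> f x"
    using assms by (auto simp: convex_closed_minorants_def)
  define h where "h x = e2ennreal (g x - ereal c)" for x
  have g_le: "g x \<le> enn2ereal (h x) + ereal c" for x
    using e2ennreal_minus_le_iff[of "g x" c "h x"] by (simp add: h_def)
  have "ennreal_convex h"
    unfolding ennreal_convex_def
  proof (intro ballI allI impI)
    fix x y and u v :: real
    assume *: "x \<in> A" "y \<in> A" "0 \<le> u" "0 \<le> v" "u + v = 1"
    have "g (u *\<^sub>R x + v *\<^sub>R y) \<le> ereal u * g x + ereal v * g y"
      using g(1) * by (simp add: ereal_convex_on_def)
    also have "\<dots> \<le> ereal u * (enn2ereal (h x) + ereal c) + ereal v * (enn2ereal (h y) + ereal c)"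
      using * g_le by (intro add_mono ereal_mult_left_mono) auto
    also have "\<dots> = enn2ereal (ennreal u * h x + ennreal v * h y) + ereal c"
      by (rule ereal_convex_combination_shift) fact+
    finally show "h (u *\<^sub>R x + v *\<^sub>R y) \<le> ennreal u * h x + ennreal v * h y"
      unfolding h_def[of "u *\<^sub>R x + v *\<^sub>R y"] e2ennreal_minus_le_iff .
  qed
  moreover have "lsc_on X h"
    unfolding h_def[abs_def] by (rule lsc_on_shift[OF g(2)])
  ultimately have "h (barycenter P A \<mu>) \<le> (\<integral>\<^sup>+x. h x \<partial>\<mu>)"
    by (intro Jensen_barycenter \<mu>)
  also have "\<dots> \<le> (\<integral>\<^sup>+x. e2ennreal (f x - ereal c) \<partial>\<mu>)"
    unfolding h_def using g(3)
    by (intro nn_integral_mono e2ennreal_mono ereal_minus_mono) (auto simp: borel_prob_measuresD(3)[OF \<mu>])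
  finally show ?thesis
    unfolding h_def e2ennreal_minus_le_iff .
qed

text \<open>One inequality integrates the minorants. For the other, \<open>\<mu>\<close>-compactness
  enters through \<open>roof_lsc\<close> and makes the roof, shifted back, itself a convex closed
  minorant.\<close>

theorem convex_closure_eq_roof:
  assumes comp: "mu_compact P A" and f: "lsc_on X f" "\<And>x. x \<in> A \<Longrightarrow> ereal c \<le> f x" and x: "x \<in> A"
  shows "convex_closure P A f x = enn2ereal (roof (\<lambda>y. e2ennreal (f y - ereal c)) x) + ereal c"
proof (rule antisym)
  define h where "h y = e2ennreal (f y - ereal c)" for y
  have h: "lsc_on X h"
    unfolding h_def[abs_def] by (rule lsc_on_shift[OF f(1)])
  show "convex_closure P A f x \<le> enn2ereal (roof (\<lambda>y. e2ennreal (f y - ereal c)) x) + ereal c"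
    unfolding convex_closure_def
  proof (rule SUP_least)
    fix g assume g: "g \<in> convex_closed_minorants P A f"
    have "e2ennreal (g x - ereal c) \<le> roof (\<lambda>y. e2ennreal (f y - ereal c)) x"
      unfolding roof_def
      using minorant_le_integral[OF g, of _ c] by (intro INF_greatest) (auto simp: e2ennreal_minus_le_iff)
    then show "g x \<le> enn2ereal (roof (\<lambda>y. e2ennreal (f y - ereal c)) x) + ereal c"
      by (simp only: e2ennreal_minus_le_iff)
  qed
  define G where "G y = enn2ereal (roof h y) + ereal c" for y
  have "G \<in> convex_closed_minorants P A f"
    unfolding convex_closed_minorants_def
  proof (intro CollectI conjI ballI)
    show "lsc_on X G"
      unfolding G_def[abs_def] by (intro lsc_on_unshift roof_lsc comp h)
    show "G y \<le> f y" if y: "y \<in> A" for y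
    proof -
      \<comment> \<open>Above the lower bound \<open>c\<close> the truncation changes nothing, so
        the shift can be undone.\<close>
      have "0 \<le> f y - ereal c" using f(2)[OF y] by (cases "f y") auto
      then have "enn2ereal (h y) + ereal c = f y"
        unfolding h_def by (cases "f y") (auto simp: enn2ereal_e2ennreal)
      moreover have "enn2ereal (roof h y) \<le> enn2ereal (h y)"
        using roof_le[OF h y] by (simp add: less_eq_ennreal.rep_eq)
      ultimately show ?thesis
        unfolding G_def by (metis add_right_mono)
    qed
    show "ereal_convex_on A G"
      unfolding ereal_convex_on_def
    proof (intro conjI ballI allI impI)
      show "G y \<noteq> -\<infinity>" for y
        using enn2ereal_nonneg[of "roof h y"] unfolding G_def by (cases "enn2ereal (roof h y)") auto
      fix y z and u v :: real
      assume *: "y \<in> A" "z \<in> A" "0 \<le> u" "0 \<le> v" "u + v = 1"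
      have "roof h (u *\<^sub>R y + v *\<^sub>R z) \<le> ennreal u * roof h y + ennreal v * roof h z"
        using roof_convex[OF h] * by (simp add: ennreal_convex_def)
      then have "G (u *\<^sub>R y + v *\<^sub>R z) \<le> enn2ereal (ennreal u * roof h y + ennreal v * roof h z) + ereal c"
        unfolding G_def by (intro add_right_mono) (simp add: less_eq_ennreal.rep_eq)
      also have "\<dots> = ereal u * G y + ereal v * G z"
        unfolding G_def by (rule ereal_convex_combination_shift[symmetric]) fact+
      finally show "G (u *\<^sub>R y + v *\<^sub>R z) \<le> ereal u * G y + ereal v * G z" .
    qed
  qed
  then have "G x \<le> convex_closure P A f x"
    unfolding convex_closure_def by (rule SUP_upper)
  then show "enn2ereal (roof (\<lambda>y. e2ennreal (f y - ereal c)) x) + ereal c \<le> convex_closure P A f x"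
    by (simp add: G_def h_def[abs_def])
qed

lemma convex_closure_tendsto:
  assumes comp: "mu_compact P A" and x: "x \<in> A"
    and f: "\<And>n. lsc_on X (f n)" "\<And>n y. y \<in> A \<Longrightarrow> ereal c \<le> f n y"
    and f0: "lsc_on X f0" "\<And>y. y \<in> A \<Longrightarrow> ereal c \<le> f0 y"
    and lim: "(\<lambda>n. roof (\<lambda>y. e2ennreal (f n y - ereal c)) x) \<longlonglongrightarrow> roof (\<lambda>y. e2ennreal (f0 y - ereal c)) x"
  shows "(\<lambda>n. convex_closure P A (f n) x) \<longlonglongrightarrow> convex_closure P A f0 x"
proof -
  have "convex_closure P A (f n) x = enn2ereal (roof (\<lambda>y. e2ennreal (f n y - ereal c)) x) + ereal c" for n
    by (rule convex_closure_eq_roof[OF comp f(1) f(2) x])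
  moreover have "convex_closure P A f0 x = enn2ereal (roof (\<lambda>y. e2ennreal (f0 y - ereal c)) x) + ereal c"
    by (rule convex_closure_eq_roof[OF comp f0 x])
  ultimately show ?thesis
  proof (simp only:, intro tendsto_cadd_ereal)
    show "enn2ereal (roof (\<lambda>y. e2ennreal (f0 y - ereal c)) x) \<noteq> -\<infinity>"
      using enn2ereal_nonneg[of "roof (\<lambda>y. e2ennreal (f0 y - ereal c)) x"] by auto
  qed (use lim in simp_all)
qed

lemma roof_increasing:
  assumes comp: "mu_compact P A"
    and h: "\<And>n. lsc_on X (h n :: 'a \<Rightarrow> ennreal)" "\<And>n y. y \<in> A \<Longrightarrow> h n y \<le> h (Suc n) y"
    and h0: "\<And>y. y \<in> A \<Longrightarrow> (SUP n. h n y) = h0 y"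
    and x: "x \<in> A"
  shows "(\<lambda>n. roof (h n) x) \<longlonglongrightarrow> roof h0 x"
proof -
  have "(SUP n. roof (h n) x) = roof h0 x"
  proof (rule antisym)
    have "h n y \<le> h0 y" if "y \<in> A" for n y
      unfolding h0[OF that, symmetric] by (rule SUP_upper) simp
    then show "(SUP n. roof (h n) x) \<le> roof h0 x"
      by (intro SUP_least roof_mono)
    show "roof h0 x \<le> (SUP n. roof (h n) x)"
    proof (rule dense_ge)
      fix d assume d: "(SUP n. roof (h n) x) < d"
      have "\<exists>\<mu>. \<mu> \<in> \<M> \<and> barycenter P A \<mu> = x \<and> (\<integral>\<^sup>+y. h n y \<partial>\<mu>) < d" for n
      proof -
        have "roof (h n) x < d"
          using d by (rule le_less_trans[rotated]) (rule SUP_upper, simp)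
        then show ?thesis by (rule roof_lessE) blast
      qed
      then obtain \<mu> where \<mu>: "\<And>n. \<mu> n \<in> \<M>" "\<And>n. barycenter P A (\<mu> n) = x" "\<And>n. (\<integral>\<^sup>+y. h n y \<partial>\<mu> n) < d"
        by metis
      \<comment> \<open>All barycenters are the fixed point \<open>x\<close>. The cluster measure
        bounds every \<open>h m\<close> at once, and monotone convergence extends the bound to
        \<open>h0\<close>.\<close>
      obtain \<nu> where \<nu>: "\<nu> \<in> \<M>" "barycenter P A \<nu> = x" "\<And>m. (\<integral>\<^sup>+y. h m y \<partial>\<nu>) \<le> d"
      proof (rule mu_compact_cluster[OF comp, where f = h and \<mu> = \<mu> and x = x and c = d])
        show "limitin X (\<lambda>n. barycenter P A (\<mu> n)) x sequentially"
          using x by (simp add: \<mu>(2))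
        show "(\<integral>\<^sup>+y. h n y \<partial>\<mu> n) \<le> d" for n
          using \<mu>(3) by (rule less_imp_le)
      qed (use \<mu>(1) h in auto)
      have "(\<integral>\<^sup>+y. h0 y \<partial>\<nu>) = (\<integral>\<^sup>+y. (SUP n. h n y) \<partial>\<nu>)"
        by (rule nn_integral_cong) (simp add: h0 borel_prob_measuresD(3)[OF \<nu>(1)])
      also have "\<dots> = (SUP n. \<integral>\<^sup>+y. h n y \<partial>\<nu>)"
        using h(2) borel_prob_measuresD(3)[OF \<nu>(1)]
        by (intro nn_integral_monotone_convergence_SUP_AE lsc_measurable[OF \<nu>(1) h(1)]) auto
      also have "\<dots> \<le> d"
        by (intro SUP_least \<nu>(3))
      finally show "roof h0 x \<le> d"
        using roof_lower[OF \<nu>(1), of h0] \<nu>(2) by simp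
    qed
  qed
  moreover have "(\<lambda>n. roof (h n) x) \<longlonglongrightarrow> (SUP n. roof (h n) x)"
    by (intro LIMSEQ_SUP incseq_SucI roof_mono h)
  ultimately show ?thesis by simp
qed

text \<open>The uniform bound on \<open>h 0\<close> makes its integral finite, as monotone
  convergence from above requires.\<close>

lemma roof_decreasing:
  assumes h: "\<And>n. lsc_on X (h n :: 'a \<Rightarrow> ennreal)" "\<And>n y. y \<in> A \<Longrightarrow> h (Suc n) y \<le> h n y"
    and h0: "\<And>y. y \<in> A \<Longrightarrow> (INF n. h n y) = h0 y"
    and bound: "\<And>y. y \<in> A \<Longrightarrow> h 0 y \<le> ennreal C"
  shows "(\<lambda>n. roof (h n) x) \<longlonglongrightarrow> roof h0 x"
proof -
  have int: "(\<integral>\<^sup>+y. h0 y \<partial>\<mu>) = (INF n. \<integral>\<^sup>+y. h n y \<partial>\<mu>)" if \<mu>: "\<mu> \<in> \<M>" for \<mu>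
  proof -
    interpret prob_space \<mu> using \<mu> borel_prob_measuresD by blast
    note sp = borel_prob_measuresD(3)[OF \<mu>]
    have "(\<integral>\<^sup>+y. h 0 y \<partial>\<mu>) \<le> (\<integral>\<^sup>+y. ennreal C \<partial>\<mu>)"
      by (rule nn_integral_mono) (simp add: bound sp)
    then have fin: "(\<integral>\<^sup>+y. h 0 y \<partial>\<mu>) < \<infinity>"
      by (simp add: emeasure_space_1 le_less_trans)
    have "(\<integral>\<^sup>+y. h0 y \<partial>\<mu>) = (\<integral>\<^sup>+y. (INF n. h n y) \<partial>\<mu>)"
      by (rule nn_integral_cong) (simp add: h0 sp)
    also have "\<dots> = (INF n. \<integral>\<^sup>+y. h n y \<partial>\<mu>)"
      using h(2) fin sp
      by (intro nn_integral_monotone_convergence_INF_AE[where i = 0] lsc_measurable[OF \<mu> h(1)]) auto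
    finally show ?thesis .
  qed
  have "roof h0 x = (INF \<mu>\<in>{\<mu> \<in> \<M>. barycenter P A \<mu> = x}. INF n. \<integral>\<^sup>+y. h n y \<partial>\<mu>)"
    unfolding roof_def by (intro INF_cong) (auto simp: int)
  also have "\<dots> = (INF n. roof (h n) x)"
    unfolding roof_def by (rule INF_commute)
  moreover have "(\<lambda>n. roof (h n) x) \<longlonglongrightarrow> (INF n. roof (h n) x)"
    by (intro LIMSEQ_INF decseq_SucI roof_mono h)
  ultimately show ?thesis by simp
qed

end

section \<open>Elementary facts on semicontinuous functions and convex closures\<close>

lemma lsc_on_ereal:
  fixes f :: "'a \<Rightarrow> real"
  assumes "lsc_on X f"
  shows "lsc_on X (\<lambda>x. ereal (f x))"
  unfolding lsc_on_def
proof
  fix d :: ereal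
  show "openin X {x \<in> topspace X. d < ereal (f x)}"
    using assms by (cases d) (auto simp: lsc_on_def)
qed

lemma Cb_lsc_on:
  assumes "f \<in> Cb X"
  shows "lsc_on X f"
  unfolding lsc_on_def
proof
  fix c :: real
  have "openin X {x \<in> topspace X. f x \<in> {c<..}}"
    using assms by (intro openin_continuous_map_preimage[of X euclideanreal]) (auto simp: Cb_def)
  then show "openin X {x \<in> topspace X. c < f x}" by simp
qed

lemma convex_closure_mono:
  "(\<And>y. y \<in> A \<Longrightarrow> f y \<le> f' y) \<Longrightarrow> convex_closure P A f x \<le> convex_closure P A f' x"
  unfolding convex_closure_def
  by (rule SUP_subset_mono) (auto simp: convex_closed_minorants_def intro: order_trans)

lemma convex_closure_ge_const:
  assumes "\<And>y. y \<in> A \<Longrightarrow> ereal c \<le> f y"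
  shows "ereal c \<le> convex_closure P A f x"
proof -
  have "openin (subtopology (seminorm_topology P) A) {x \<in> A. d < ereal c}" for d :: ereal
    using openin_topspace[of "subtopology (seminorm_topology P) A"] by (cases "d < ereal c") auto
  then have "(\<lambda>_. ereal c) \<in> convex_closed_minorants P A f"
    using assms by (auto simp: convex_closed_minorants_def ereal_convex_on_def lsc_on_def simp flip: distrib_right)
  then show ?thesis
    unfolding convex_closure_def by (rule SUP_upper)
qed

context bccsm
begin

subsection \<open>Convex closures of monotone sequences under \<open>\<mu>\<close>-compactness\<close>

lemma convex_closure_increasing:
  fixes f :: "nat \<Rightarrow> 'a \<Rightarrow> ereal"
  assumes comp: "mu_compact P A"
    and f: "\<And>n. lsc_on X (f n)" "\<And>y. y \<in> A \<Longrightarrow> ereal c \<le> f 0 y"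
      "\<And>n y. y \<in> A \<Longrightarrow> f n y \<le> f (Suc n) y"
    and lim: "\<And>y. y \<in> A \<Longrightarrow> (\<lambda>n. f n y) \<longlonglongrightarrow> f0 y"
    and x: "x \<in> A"
  shows "(\<lambda>n. convex_closure P A (f n) x) \<longlonglongrightarrow> convex_closure P A f0 x"
proof -
  have f0: "f0 y = (SUP n. f n y)" if y: "y \<in> A" for y
    using lim[OF y] by (rule LIMSEQ_unique) (intro LIMSEQ_SUP incseq_SucI f(3)[OF y])
  have ge: "ereal c \<le> f n y" if y: "y \<in> A" for n y
    by (induction n) (auto intro: f(2)[OF y] order_trans[OF _ f(3)[OF y]])
  have ge0: "ereal c \<le> f0 y" if y: "y \<in> A" for y
    unfolding f0[OF y] by (rule order_trans[OF f(2)[OF y]]) (rule SUP_upper, simp)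
  have lsc0: "lsc_on X f0"
    unfolding lsc_on_def
  proof
    fix d
    have "{x \<in> topspace X. d < f0 x} = (\<Union>n. {x \<in> topspace X. d < f n x})"
      by (auto simp: f0 less_SUP_iff)
    moreover have "openin X {x \<in> topspace X. d < f n x}" for n
      using f(1)[of n] by (simp add: lsc_on_def)
    ultimately show "openin X {x \<in> topspace X. d < f0 x}"
      by (simp only:) (rule openin_Union, blast)
  qed
  \<comment> \<open>By the Galois connection both sides have the same upper bounds.\<close>
  have SUP_eq: "(SUP n. e2ennreal (f n y - ereal c)) = e2ennreal (f0 y - ereal c)" if y: "y \<in> A" for y
  proof -
    have "(SUP n. e2ennreal (f n y - ereal c)) \<le> R \<longleftrightarrow> e2ennreal (f0 y - ereal c) \<le> R" for R
      unfolding f0[OF y] e2ennreal_minus_le_iff SUP_le_iff by simp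
    then show ?thesis by (intro antisym) blast+
  qed
  show ?thesis
  proof (rule convex_closure_tendsto[OF comp x f(1) ge lsc0 ge0])
    show "(\<lambda>n. roof (\<lambda>y. e2ennreal (f n y - ereal c)) x) \<longlonglongrightarrow> roof (\<lambda>y. e2ennreal (f0 y - ereal c)) x"
      by (rule roof_increasing[OF comp _ _ SUP_eq x])
        (auto intro!: lsc_on_shift f e2ennreal_mono ereal_minus_mono)
  qed
qed

lemma convex_closure_decreasing:
  fixes f :: "nat \<Rightarrow> 'a \<Rightarrow> real"
  assumes comp: "mu_compact P A"
    and f: "\<And>n. lsc_on X (f n)" "bounded (f 0 ` A)" "\<And>n y. y \<in> A \<Longrightarrow> f (Suc n) y \<le> f n y"
    and f0: "lsc_on X f0" "bounded (f0 ` A)"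
    and lim: "\<And>y. y \<in> A \<Longrightarrow> (\<lambda>n. f n y) \<longlonglongrightarrow> f0 y"
    and x: "x \<in> A"
  shows "(\<lambda>n. convex_closure P A (\<lambda>y. ereal (f n y)) x) \<longlonglongrightarrow> convex_closure P A (\<lambda>y. ereal (f0 y)) x"
proof -
  obtain B0 where B0: "\<forall>z\<in>f0 ` A. norm z \<le> B0"
    using f0(2) unfolding bounded_iff by blast
  obtain B where B: "\<forall>z\<in>f 0 ` A. norm z \<le> B"
    using f(2) unfolding bounded_iff by blast
  \<comment> \<open>The limit is the smallest function of the sequence, so its lower bound is a
    common shift; the upper bound comes from \<open>f 0\<close>.\<close>
  define c where "c = - B0"
  have ge0: "ereal c \<le> ereal (f0 y)" if y: "y \<in> A" for y
    using bspec[OF B0 imageI[OF y]] by (auto simp: c_def)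
  have f0_le: "f0 y \<le> f n y" if y: "y \<in> A" for n y
    by (rule decseq_ge[OF decseq_SucI lim[OF y]]) (rule f(3)[OF y])
  have ge: "ereal c \<le> ereal (f n y)" if y: "y \<in> A" for n y
    using ge0[OF y] f0_le[OF y, of n] by simp
  have INF_eq: "(INF n. e2ennreal (ereal (f n y) - ereal c)) = e2ennreal (ereal (f0 y) - ereal c)"
    if y: "y \<in> A" for y
  proof (rule LIMSEQ_unique)
    show "(\<lambda>n. e2ennreal (ereal (f n y) - ereal c)) \<longlonglongrightarrow> (INF n. e2ennreal (ereal (f n y) - ereal c))"
      by (intro LIMSEQ_INF decseq_SucI e2ennreal_mono ereal_minus_mono) (simp_all add: f(3)[OF y])
    show "(\<lambda>n. e2ennreal (ereal (f n y) - ereal c)) \<longlonglongrightarrow> e2ennreal (ereal (f0 y) - ereal c)"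
      by (simp, intro tendsto_ennrealI tendsto_diff lim[OF y] tendsto_const)
  qed
  show ?thesis
  proof (rule convex_closure_tendsto[OF comp x lsc_on_ereal[OF f(1)] ge lsc_on_ereal[OF f0(1)] ge0])
    show "(\<lambda>n. roof (\<lambda>y. e2ennreal (ereal (f n y) - ereal c)) x)
        \<longlonglongrightarrow> roof (\<lambda>y. e2ennreal (ereal (f0 y) - ereal c)) x"
    proof (rule roof_decreasing[OF _ _ INF_eq])
      show "lsc_on X (\<lambda>y. e2ennreal (ereal (f n y) - ereal c))" for n
        by (intro lsc_on_shift lsc_on_ereal f)
      show "e2ennreal (ereal (f (Suc n) y) - ereal c) \<le> e2ennreal (ereal (f n y) - ereal c)" if "y \<in> A" for n y
        using f(3)[OF that] by (intro e2ennreal_mono ereal_minus_mono) auto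
      show "e2ennreal (ereal (f 0 y) - ereal c) \<le> ennreal (B - c)" if "y \<in> A" for y
        using bspec[OF B imageI[OF that]] by (auto intro!: ennreal_leI)
    qed
  qed
qed

subsection \<open>\<open>\<mu>\<close>-compactness from continuous increasing sequences\<close>

text \<open>Dini's argument: the sets \<open>V n\<close> are open because convex closures are closed
  functions, they increase with \<open>n\<close>, and they cover \<open>K\<close>, so a single
  \<open>V N\<close> contains \<open>K\<close>. There Jensen's inequality gives
  \<open>- e < C N b \<le> - (\<integral>x. f N x \<partial>\<mu>)\<close> at the barycenter
  \<open>b\<close>.\<close>

lemma integral_uniformly_small:
  fixes f :: "nat \<Rightarrow> 'a \<Rightarrow> real"
  assumes K: "compactin X K"
    and f: "\<And>n. f n \<in> Cb X" "\<And>n y. y \<in> A \<Longrightarrow> f (Suc n) y \<le> f n y"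
    and lim: "\<And>y. y \<in> A \<Longrightarrow>
      (\<lambda>n. convex_closure P A (\<lambda>z. ereal (- f n z)) y) \<longlonglongrightarrow> convex_closure P A (\<lambda>z. ereal 0) y"
    and e: "0 < e"
  obtains N where "\<And>\<mu>. \<mu> \<in> \<M> \<Longrightarrow> barycenter P A \<mu> \<in> K \<Longrightarrow> (\<integral>x. f N x \<partial>\<mu>) < e"
proof -
  define C where "C n = convex_closure P A (\<lambda>z. ereal (- f n z))" for n
  define V where "V n = {x \<in> A. ereal (- e) < C n x}" for n
  have bound: "\<exists>B. \<forall>x\<in>A. \<bar>f n x\<bar> \<le> B" for n
    using f(1)[of n] by (auto simp: Cb_iff)
  have minorant: "C n \<in> convex_closed_minorants P A (\<lambda>z. ereal (- f n z))" for n
  proof -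
    obtain B where B: "\<forall>x\<in>A. \<bar>f n x\<bar> \<le> B" using bound by blast
    show ?thesis
      unfolding C_def
    proof (rule convex_closure_maximal(1)[OF convex_A])
      show "ereal (- B) \<le> ereal (- f n x)" if "x \<in> A" for x
        using bspec[OF B that] by auto
    qed
  qed
  have V_open: "openin X (V n)" for n
    using minorant[of n] by (simp add: convex_closed_minorants_def lsc_on_def V_def)
  have V_mono: "V n \<subseteq> V (Suc n)" for n
  proof -
    have "C n x \<le> C (Suc n) x" for x
      unfolding C_def using f(2) by (intro convex_closure_mono) auto
    then show ?thesis unfolding V_def by (auto intro: less_le_trans)
  qed
  have KA: "K \<subseteq> A" using compactin_subset_topspace[OF K] by simp
  have "K \<subseteq> \<Union>(range V)"
  proof
    fix x assume "x \<in> K"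
    then have x: "x \<in> A" using KA by auto
    have "ereal (- e) < ereal 0" using e by simp
    also have "\<dots> \<le> convex_closure P A (\<lambda>z. ereal 0) x"
      by (rule convex_closure_ge_const) simp
    finally have "\<forall>\<^sub>F n in sequentially. ereal (- e) < C n x"
      unfolding C_def by (rule order_tendstoD(1)[OF lim[OF x]])
    then obtain n where "ereal (- e) < C n x"
      using eventually_happens by fastforce
    then show "x \<in> \<Union>(range V)" using x by (auto simp: V_def)
  qed
  then obtain \<F> where \<F>: "finite \<F>" "\<F> \<subseteq> range V" "K \<subseteq> \<Union>\<F>"
    using compactinD[OF K, of "range V"] V_open by blast
  obtain T where T: "finite T" "\<F> = V ` T"
    using finite_subset_image[OF \<F>(1,2)] by blast
  obtain N where N: "\<forall>n\<in>T. n \<le> N"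
    using T(1) finite_nat_set_iff_bounded_le by blast
  have "V n \<subseteq> V N" if "n \<in> T" for n
    using lift_Suc_mono_le[of V n N, OF V_mono] N that by blast
  then have KV: "K \<subseteq> V N" using \<F>(3) T(2) by blast
  show ?thesis
  proof (rule that[of N])
    fix \<mu> assume \<mu>: "\<mu> \<in> \<M>" "barycenter P A \<mu> \<in> K"
    interpret prob_space \<mu> using \<mu> borel_prob_measuresD by blast
    obtain B where B: "\<forall>x\<in>A. \<bar>f N x\<bar> \<le> B" using bound by blast
    \<comment> \<open>The bound \<open>B\<close> of \<open>f N\<close> provides the shift
      \<open>- B\<close> that makes \<open>- f N\<close> nonnegative.\<close>
    have nn: "0 \<le> B - f N x" if "x \<in> topspace X" for x
      using bspec[OF B, of x] that by auto
    have BC: "(\<lambda>x. B - f N x) \<in> Cb X" by (intro Cb_diff f) simp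
    have "(\<integral>\<^sup>+x. e2ennreal (ereal (- f N x) - ereal (- B)) \<partial>\<mu>) = (\<integral>\<^sup>+x. ennreal (B - f N x) \<partial>\<mu>)"
      by (rule nn_integral_cong) (simp add: algebra_simps)
    also have "\<dots> = ennreal (\<integral>x. B - f N x \<partial>\<mu>)"
      by (rule nn_integral_Cb[OF \<mu>(1) BC nn])
    also have "(\<integral>x. B - f N x \<partial>\<mu>) = B - (\<integral>x. f N x \<partial>\<mu>)"
      using Cb_integrable[OF \<mu>(1) f(1)] by (simp add: prob_space)
    finally have eq: "(\<integral>\<^sup>+x. e2ennreal (ereal (- f N x) - ereal (- B)) \<partial>\<mu>) = ennreal (B - (\<integral>x. f N x \<partial>\<mu>))" .
    have "(\<integral>x. f N x \<partial>\<mu>) \<le> (\<integral>x. B \<partial>\<mu>)"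
      using nn borel_prob_measuresD(3)[OF \<mu>(1)] by (intro integral_mono Cb_integrable[OF \<mu>(1) f(1)]) auto
    then have "0 \<le> B - (\<integral>x. f N x \<partial>\<mu>)" by (simp add: prob_space)
    then have "C N (barycenter P A \<mu>) \<le> ereal (B - (\<integral>x. f N x \<partial>\<mu>)) + ereal (- B)"
      using minorant_le_integral[OF minorant \<mu>(1), of N "- B"] unfolding eq by simp
    moreover have "ereal (- e) < C N (barycenter P A \<mu>)"
      using KV \<mu>(2) by (auto simp: V_def)
    ultimately have "ereal (- e) < ereal (B - (\<integral>x. f N x \<partial>\<mu>)) + ereal (- B)"
      by (rule less_le_trans[rotated])
    then show "(\<integral>x. f N x \<partial>\<mu>) < e" by simp
  qed
qed

text \<open>On \<open>C(X)\<close> the functionals \<open>f \<mapsto> \<integral>f d\<mu>\<close> live in a product of compact intervals, one for each \<open>f\<close>, so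
  Tychonoff's theorem provides the cluster point.\<close>

lemma ex_limit_functional:
  assumes F: "F \<noteq> bot" "eventually (\<lambda>\<mu>. \<mu> \<in> \<M>) F"
  obtains G L where "G \<noteq> bot" "G \<le> F" "\<And>f. f \<in> Cb X \<Longrightarrow> ((\<lambda>\<mu>. \<integral>x. f x \<partial>\<mu>) \<longlongrightarrow> L f) G"
proof -
  have "\<exists>B\<ge>0. f \<in> Cb X \<longrightarrow> (\<forall>x\<in>A. \<bar>f x\<bar> \<le> B)" for f :: "'a \<Rightarrow> real"
  proof (cases "f \<in> Cb X")
    case True
    then obtain B where "0 < B" "\<And>x. x \<in> topspace X \<Longrightarrow> \<bar>f x\<bar> \<le> B"
      by (rule Cb_obtain_bound) blast
    then show ?thesis by (intro exI[of _ B]) auto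
  qed auto
  then obtain B where B: "\<And>f :: 'a \<Rightarrow> real. 0 \<le> B f" "\<And>f x. f \<in> Cb X \<Longrightarrow> x \<in> A \<Longrightarrow> \<bar>f x\<bar> \<le> B f"
    by metis
  \<comment> \<open>The product is indexed by all functions; the default 0 keeps the coordinates
    outside \<open>Cb X\<close> within their intervals.\<close>
  define \<Phi> where "\<Phi> \<mu> f = (if f \<in> Cb X then \<integral>x. f x \<partial>\<mu> else 0)" for \<mu> and f :: "'a \<Rightarrow> real"
  define T where "T = PiE UNIV (\<lambda>f :: 'a \<Rightarrow> real. {- B f..B f})"
  have "compactin (product_topology (\<lambda>_. euclideanreal) UNIV) T"
    unfolding T_def by (simp add: compactin_PiE)
  then have T: "compact T"
    by (simp add: euclidean_product_topology)
  have "\<Phi> \<mu> \<in> T" if \<mu>: "\<mu> \<in> \<M>" for \<mu>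
  proof -
    interpret prob_space \<mu> using \<mu> borel_prob_measuresD by blast
    have "\<bar>\<integral>x. f x \<partial>\<mu>\<bar> \<le> B f" if f: "f \<in> Cb X" for f
    proof -
      have "\<bar>\<integral>x. f x \<partial>\<mu>\<bar> \<le> (\<integral>x. \<bar>f x\<bar> \<partial>\<mu>)" by (rule integral_abs_bound)
      also have "\<dots> \<le> (\<integral>x. B f \<partial>\<mu>)"
        using B(2)[OF f] Cb_integrable[OF \<mu> f] borel_prob_measuresD(3)[OF \<mu>]
        by (intro integral_mono) auto
      finally show ?thesis by (simp add: prob_space)
    qed
    then show ?thesis using B(1) by (auto simp: T_def \<Phi>_def abs_le_iff minus_le_iff)
  qed
  then have "eventually (\<lambda>\<phi>. \<phi> \<in> T) (filtermap \<Phi> F)"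
    using F(2) by (auto simp: eventually_filtermap elim: eventually_mono)
  moreover have "filtermap \<Phi> F \<noteq> bot" using F(1) by (simp add: filtermap_bot_iff)
  ultimately obtain L where L: "inf (nhds L) (filtermap \<Phi> F) \<noteq> bot"
    using T unfolding compact_filter by blast
  \<comment> \<open>Refining \<open>F\<close> by the preimages of the neighbourhoods of the cluster
    point \<open>L\<close> turns clustering into convergence.\<close>
  define G where "G = inf F (filtercomap \<Phi> (nhds L))"
  have "G \<noteq> bot"
  proof
    assume "G = bot"
    then have "eventually (\<lambda>_. False) G" by simp
    then obtain R S where RS: "eventually R F" "eventually S (filtercomap \<Phi> (nhds L))" "\<And>\<mu>. R \<mu> \<Longrightarrow> S \<mu> \<Longrightarrow> False"
      unfolding G_def eventually_inf by blast
    obtain S' where S': "eventually S' (nhds L)" "\<And>\<mu>. S' (\<Phi> \<mu>) \<Longrightarrow> S \<mu>"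
      using RS(2) unfolding eventually_filtercomap by blast
    have "eventually (\<lambda>\<phi>. \<exists>\<mu>. R \<mu> \<and> \<phi> = \<Phi> \<mu>) (filtermap \<Phi> F)"
      unfolding eventually_filtermap using RS(1) by (auto elim: eventually_mono)
    then have "eventually (\<lambda>_. False) (inf (nhds L) (filtermap \<Phi> F))"
      unfolding eventually_inf using S' RS(3) by blast
    with L show False by (simp add: eventually_False)
  qed
  moreover have "G \<le> F" by (simp add: G_def)
  moreover have "((\<lambda>\<mu>. \<integral>x. f x \<partial>\<mu>) \<longlongrightarrow> L f) G" if f: "f \<in> Cb X" for f
  proof -
    have "filterlim \<Phi> (nhds L) G"
      unfolding G_def filterlim_def by (metis filtermap_filtercomap filtermap_mono inf.cobounded2 order_trans)
    then have "((\<lambda>\<mu>. \<Phi> \<mu> f) \<longlongrightarrow> L f) G"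
      using continuous_on_tendsto_compose[OF continuous_on_product_coordinates[of f], of \<Phi> L G] by simp
    then show ?thesis using f by (simp add: \<Phi>_def)
  qed
  ultimately show ?thesis by (rule that)
qed

lemma mu_compact_if_convex_closure_continuous:
  assumes ii: "\<And>(f :: nat \<Rightarrow> 'a \<Rightarrow> real) f0 x. (\<And>n. f n \<in> Cb X) \<Longrightarrow> f0 \<in> Cb X \<Longrightarrow>
      (\<And>n y. y \<in> A \<Longrightarrow> f n y \<le> f (Suc n) y) \<Longrightarrow> (\<And>y. y \<in> A \<Longrightarrow> (\<lambda>n. f n y) \<longlonglongrightarrow> f0 y) \<Longrightarrow> x \<in> A \<Longrightarrow>
      (\<lambda>n. convex_closure P A (\<lambda>y. ereal (f n y)) x) \<longlonglongrightarrow> convex_closure P A (\<lambda>y. ereal (f0 y)) x"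
  shows "mu_compact P A"
  unfolding mu_compact_def Let_def
proof (intro allI impI)
  fix K assume K: "compactin X K"
  define S where "S = {\<mu> \<in> \<M>. barycenter P A \<mu> \<in> K}"
  have "compactin (weak_topology X) S"
  proof (rule compactinI_cluster)
    show "S \<subseteq> topspace (weak_topology X)"
      by (auto simp: topspace_weak_topology S_def)
    fix F :: "'a measure filter"
    assume F: "F \<noteq> bot" "eventually (\<lambda>\<mu>. \<mu> \<in> S) F"
    have "eventually (\<lambda>\<mu>. \<mu> \<in> \<M>) F"
      using F(2) by eventually_elim (simp add: S_def)
    then obtain G L where G: "G \<noteq> bot" "G \<le> F"
      and lim: "\<And>f. f \<in> Cb X \<Longrightarrow> ((\<lambda>\<mu>. \<integral>x. f x \<partial>\<mu>) \<longlongrightarrow> L f) G"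
      using ex_limit_functional[OF F(1)] by blast
    have S: "eventually (\<lambda>\<mu>. \<mu> \<in> S) G"
      using F(2) G(2) by (rule filter_leD[rotated])
    then have M: "eventually (\<lambda>\<mu>. \<mu> \<in> \<M>) G"
      by eventually_elim (simp add: S_def)
    \<comment> \<open>Uniqueness of limits transfers linearity from integrals to
      \<open>L\<close>.\<close>
    have LI: "L f = c" if "f \<in> Cb X" "((\<lambda>\<mu>. \<integral>x. f x \<partial>\<mu>) \<longlongrightarrow> c) G" for f c
      using tendsto_unique[OF G(1) lim[OF that(1)] that(2)] .
    have L_le: "L f \<le> c" if "f \<in> Cb X" "\<And>\<mu>. \<mu> \<in> S \<Longrightarrow> (\<integral>x. f x \<partial>\<mu>) \<le> c" for f c
      using S that(2) by (intro tendsto_upperbound[OF lim[OF that(1)] _ G(1)]) (auto elim: eventually_mono)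
    have L_ge: "c \<le> L f" if "f \<in> Cb X" "\<And>\<mu>. \<mu> \<in> S \<Longrightarrow> c \<le> (\<integral>x. f x \<partial>\<mu>)" for f c
      using S that(2) by (intro tendsto_lowerbound[OF lim[OF that(1)] _ G(1)]) (auto elim: eventually_mono)
    interpret daniell_functional X L
    proof
      show "metrizable_space X" by (rule metrizable_X)
    next
      fix f g :: "'a \<Rightarrow> real" assume fg: "f \<in> Cb X" "g \<in> Cb X"
      have "\<forall>\<^sub>F \<mu> in G. (\<integral>x. f x \<partial>\<mu>) + (\<integral>x. g x \<partial>\<mu>) = (\<integral>x. f x + g x \<partial>\<mu>)"
        using M by eventually_elim (simp add: Cb_integrable fg)
      from Lim_transform_eventually[OF tendsto_add[OF lim[OF fg(1)] lim[OF fg(2)]] this]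
      show "L (\<lambda>x. f x + g x) = L f + L g"
        by (rule LI[OF Cb_add[OF fg]])
    next
      fix f :: "'a \<Rightarrow> real" and c assume f: "f \<in> Cb X"
      show "L (\<lambda>x. c * f x) = c * L f"
        using tendsto_mult_left[OF lim[OF f], of c] by (intro LI Cb_cmult f) simp
    next
      fix f :: "'a \<Rightarrow> real" assume f: "f \<in> Cb X" "\<And>x. x \<in> topspace X \<Longrightarrow> 0 \<le> f x"
      show "0 \<le> L f"
        using f by (intro L_ge Bochner_Integration.integral_nonneg_AE AE_I2) (auto simp: S_def borel_prob_measuresD(3))
    next
      have "(\<integral>x. 1 \<partial>\<mu>) = (1::real)" if "\<mu> \<in> S" for \<mu>
        using prob_space.prob_space[OF borel_prob_measuresD(1)] that by (auto simp: S_def)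
      then show "L (\<lambda>_. 1) = 1"
        by (intro antisym L_le L_ge) auto
    next
      fix f :: "nat \<Rightarrow> 'a \<Rightarrow> real"
      assume f: "\<And>n. f n \<in> Cb X" "\<And>n x. x \<in> topspace X \<Longrightarrow> f (Suc n) x \<le> f n x"
        "\<And>x. x \<in> topspace X \<Longrightarrow> (\<lambda>n. f n x) \<longlonglongrightarrow> 0"
      have f_nn: "0 \<le> f n x" if "x \<in> A" for n x
        using that by (intro decseq_ge[OF decseq_SucI f(3)]) (auto intro: f(2))
      show "(\<lambda>n. L (f n)) \<longlonglongrightarrow> 0"
      proof (rule LIMSEQ_I)
        fix e :: real assume e: "0 < e"
        have clim: "(\<lambda>n. convex_closure P A (\<lambda>z. ereal (- f n z)) y) \<longlonglongrightarrow> convex_closure P A (\<lambda>z. ereal 0) y"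
          if y: "y \<in> A" for y
        proof (rule ii[OF _ _ _ _ y])
          show "(\<lambda>z. - f n z) \<in> Cb X" for n
            using Cb_cmult[OF f(1), of "-1" n] by simp
          show "(\<lambda>n. - f n z) \<longlonglongrightarrow> 0" if "z \<in> A" for z
            using tendsto_minus[OF f(3)[of z]] that by simp
        qed (use f(2) in auto)
        \<comment> \<open>Strict bounds become weak ones in the limit, so \<open>e / 2\<close>
          leaves room for a final strict \<open>< e\<close>.\<close>
        obtain N where N: "\<And>\<mu>. \<mu> \<in> \<M> \<Longrightarrow> barycenter P A \<mu> \<in> K \<Longrightarrow> (\<integral>x. f N x \<partial>\<mu>) < e / 2"
          using integral_uniformly_small[OF K f(1) _ clim, of "e / 2"] f(2) e by auto
        have "norm (L (f n) - 0) < e" if n: "n \<ge> N" for n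
        proof -
          have "(\<integral>x. f n x \<partial>\<mu>) \<le> e / 2" if "\<mu> \<in> S" for \<mu>
          proof -
            have \<mu>: "\<mu> \<in> \<M>" "barycenter P A \<mu> \<in> K" using that by (auto simp: S_def)
            have "(\<integral>x. f n x \<partial>\<mu>) \<le> (\<integral>x. f N x \<partial>\<mu>)"
            proof (rule integral_mono[OF Cb_integrable[OF \<mu>(1) f(1)] Cb_integrable[OF \<mu>(1) f(1)]])
              fix x assume "x \<in> space \<mu>"
              then have "x \<in> topspace X" using borel_prob_measuresD(3)[OF \<mu>(1)] by simp
              then show "f n x \<le> f N x"
                using lift_Suc_antimono_le[of "\<lambda>n. f n x", OF f(2) n] by blast
            qed
            then show ?thesis using N[OF \<mu>] by simp
          qed
          then have "L (f n) \<le> e / 2" by (intro L_le f)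
          moreover have "0 \<le> L (f n)"
            using f_nn by (intro L_ge f Bochner_Integration.integral_nonneg_AE AE_I2)
              (auto simp: S_def borel_prob_measuresD(3))
          ultimately show ?thesis using e by simp
        qed
        then show "\<exists>N. \<forall>n\<ge>N. norm (L (f n) - 0) < e" by blast
      qed
    qed
    obtain \<mu> where \<mu>: "\<mu> \<in> \<M>" "\<And>f. f \<in> Cb X \<Longrightarrow> (\<integral>x. f x \<partial>\<mu>) = L f"
      using Daniell_representation by blast
    \<comment> \<open>It remains to place the barycenter of \<open>\<mu>\<close> in
      \<open>K\<close>. The barycenters cluster at some \<open>y\<close> in \<open>K\<close> along
      \<open>G\<close>, while each functional of \<open>dual\<close>, evaluated at them, converges
      to its integral under \<open>\<mu>\<close>; so \<open>y\<close> is the barycenter.\<close>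
    have "eventually (\<lambda>y. y \<in> K) (filtermap (barycenter P A) G)"
      unfolding eventually_filtermap using S by eventually_elim (simp add: S_def)
    then obtain y where y: "y \<in> K"
      "\<And>U. openin X U \<Longrightarrow> y \<in> U \<Longrightarrow> \<exists>\<^sub>F z in filtermap (barycenter P A) G. z \<in> U"
      using compactin_imp_cluster[OF K, of "filtermap (barycenter P A) G"] G(1)
      by (auto simp: filtermap_bot_iff)
    have yA: "y \<in> A" using compactin_subset_topspace[OF K] y(1) by auto
    have "l y = (\<integral>x. l x \<partial>\<mu>)" if l: "l \<in> dual" for l
    proof (rule ccontr)
      note lC = dual_Cb[OF l]
      assume "l y \<noteq> (\<integral>x. l x \<partial>\<mu>)"
      then have e: "0 < dist (l y) (L l) / 2" (is "0 < ?e") by (simp add: \<mu>(2)[OF lC])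
      have "openin X {x \<in> topspace X. l x \<in> ball (l y) ?e}"
        using lC by (intro openin_continuous_map_preimage[of X euclideanreal]) (auto simp: Cb_def)
      then have "\<exists>\<^sub>F z in filtermap (barycenter P A) G. z \<in> {x \<in> topspace X. l x \<in> ball (l y) ?e}"
        using yA e by (intro y(2)) auto
      then have "\<exists>\<^sub>F \<nu> in G. barycenter P A \<nu> \<in> {x \<in> topspace X. l x \<in> ball (l y) ?e}"
        unfolding frequently_def eventually_filtermap .
      then have freq: "\<exists>\<^sub>F \<nu> in G. l (barycenter P A \<nu>) \<in> ball (l y) ?e"
        by (rule frequently_elim1) simp
      have "\<forall>\<^sub>F \<nu> in G. dist (\<integral>x. l x \<partial>\<nu>) (L l) < ?e"
        using lim[OF lC] e by (rule tendstoD)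
      with M have "\<forall>\<^sub>F \<nu> in G. \<not> l (barycenter P A \<nu>) \<in> ball (l y) ?e"
      proof eventually_elim
        case (elim \<nu>)
        then have "dist (l (barycenter P A \<nu>)) (L l) < ?e"
          using has_barycenter_barycenter l by (simp add: has_barycenter_def)
        then show ?case
          using dist_triangle[of "l y" "L l" "l (barycenter P A \<nu>)"] unfolding mem_ball by linarith
      qed
      with freq show False by (simp add: frequently_def)
    qed
    then have "barycenter P A \<mu> = y"
      using yA by (intro barycenter_eqI) (simp add: has_barycenter_def)
    then have \<mu>S: "\<mu> \<in> S" using \<mu>(1) y(1) by (simp add: S_def)
    have "\<exists>\<^sub>F \<nu> in F. \<nu> \<in> W" if W: "openin (weak_topology X) W" "\<mu> \<in> W" for W
    proof -
      \<comment> \<open>Convergence along the finer filter \<open>G\<close> makes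
        \<open>\<mu>\<close> a cluster point of \<open>F\<close>.\<close>
      have "eventually (\<lambda>\<nu>. \<nu> \<in> W) G"
        by (rule weak_topology_eventually[OF W(2,1) M]) (simp add: \<mu>(2) lim)
      then have "\<exists>\<^sub>F \<nu> in G. \<nu> \<in> W"
        using G(1) by (rule eventually_frequently[rotated])
      then show ?thesis
        unfolding frequently_def using filter_leD[OF G(2)] by blast
    qed
    then show "\<exists>\<mu>\<in>S. \<forall>W. openin (weak_topology X) W \<longrightarrow> \<mu> \<in> W \<longrightarrow> (\<exists>\<^sub>F \<nu> in F. \<nu> \<in> W)"
      using \<mu>S by blast
  qed
  then show "compactin (weak_topology X) {\<mu> \<in> \<M>. barycenter P A \<mu> \<in> K}"
    by (simp add: S_def)
qed

end

section \<open>Assembly of the equivalences\<close>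

theorem mainTheorem1:
  fixes P :: "('a::real_vector \<Rightarrow> real) set" and A :: "'a set"
  defines "X \<equiv> subtopology (seminorm_topology P) A"
  assumes "\<forall>p\<in>P. seminorm p"
    and "bccsm_subset P A"
  shows
    "(mu_compact P A \<longleftrightarrow>
       (\<forall>(f :: nat \<Rightarrow> 'a \<Rightarrow> real) f0.
          (\<forall>n. f n \<in> Cb X) \<and> f0 \<in> Cb X \<and>
          (\<forall>n. \<forall>x\<in>A. f n x \<le> f (Suc n) x) \<and>
          (\<forall>x\<in>A. (\<lambda>n. f n x) \<longlonglongrightarrow> f0 x) \<longrightarrow>
          (\<forall>x\<in>A. (\<lambda>n. convex_closure P A (\<lambda>y. ereal (f n y)) x)
                   \<longlonglongrightarrow> convex_closure P A (\<lambda>y. ereal (f0 y)) x))) \<and>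
     (mu_compact P A \<longleftrightarrow>
       (\<forall>(f :: nat \<Rightarrow> 'a \<Rightarrow> ereal) f0.
          (\<forall>n. lsc_on X (f n) \<and> (\<exists>c::real. \<forall>x\<in>A. ereal c \<le> f n x)) \<and>
          (\<forall>n. \<forall>x\<in>A. f n x \<le> f (Suc n) x) \<and>
          (\<forall>x\<in>A. (\<lambda>n. f n x) \<longlonglongrightarrow> f0 x) \<longrightarrow>
          (\<forall>x\<in>A. (\<lambda>n. convex_closure P A (f n) x) \<longlonglongrightarrow> convex_closure P A f0 x))) \<and>
     (mu_compact P A \<longrightarrow>
       (\<forall>(f :: nat \<Rightarrow> 'a \<Rightarrow> real) f0.
          (\<forall>n. lsc_on X (f n) \<and> bounded (f n ` A)) \<and> lsc_on X f0 \<and> bounded (f0 ` A) \<and>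
          (\<forall>n. \<forall>x\<in>A. f (Suc n) x \<le> f n x) \<and>
          (\<forall>x\<in>A. (\<lambda>n. f n x) \<longlonglongrightarrow> f0 x) \<longrightarrow>
          (\<forall>x\<in>A. (\<lambda>n. convex_closure P A (\<lambda>y. ereal (f n y)) x)
                   \<longlonglongrightarrow> convex_closure P A (\<lambda>y. ereal (f0 y)) x)))"
proof -
  obtain Q where "Q \<subseteq> P" "countable Q"
    "subtopology (seminorm_topology P) A = subtopology (seminorm_topology Q) A"
    "Metric_space A (seminorm_dist Q)" "Metric_space.mcomplete A (seminorm_dist Q)"
    using assms(3) by (auto simp: bccsm_subset_def)
  then interpret bccsm P A Q
    using assms(2,3) by unfold_locales (auto simp: bccsm_subset_def Metric_space_def)
  have X: "X = subtopology (seminorm_topology P) A"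
    by (simp add: X_def)
  let ?ii = "\<forall>(f :: nat \<Rightarrow> 'a \<Rightarrow> real) f0.
      (\<forall>n. f n \<in> Cb X) \<and> f0 \<in> Cb X \<and>
      (\<forall>n. \<forall>x\<in>A. f n x \<le> f (Suc n) x) \<and>
      (\<forall>x\<in>A. (\<lambda>n. f n x) \<longlonglongrightarrow> f0 x) \<longrightarrow>
      (\<forall>x\<in>A. (\<lambda>n. convex_closure P A (\<lambda>y. ereal (f n y)) x)
        \<longlonglongrightarrow> convex_closure P A (\<lambda>y. ereal (f0 y)) x)"
  let ?iii = "\<forall>(f :: nat \<Rightarrow> 'a \<Rightarrow> ereal) f0.
      (\<forall>n. lsc_on X (f n) \<and> (\<exists>c::real. \<forall>x\<in>A. ereal c \<le> f n x)) \<and>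
      (\<forall>n. \<forall>x\<in>A. f n x \<le> f (Suc n) x) \<and>
      (\<forall>x\<in>A. (\<lambda>n. f n x) \<longlonglongrightarrow> f0 x) \<longrightarrow>
      (\<forall>x\<in>A. (\<lambda>n. convex_closure P A (f n) x) \<longlonglongrightarrow> convex_closure P A f0 x)"
  have 1: ?iii if comp: "mu_compact P A"
  proof (intro allI impI ballI, elim conjE)
    fix f :: "nat \<Rightarrow> 'a \<Rightarrow> ereal" and f0 x
    assume x: "x \<in> A" and f: "\<forall>n. lsc_on X (f n) \<and> (\<exists>c::real. \<forall>x\<in>A. ereal c \<le> f n x)"
      "\<forall>n. \<forall>x\<in>A. f n x \<le> f (Suc n) x" "\<forall>x\<in>A. (\<lambda>n. f n x) \<longlonglongrightarrow> f0 x"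
    obtain c where "\<forall>y\<in>A. ereal c \<le> f 0 y" using f(1) by blast
    then show "(\<lambda>n. convex_closure P A (f n) x) \<longlonglongrightarrow> convex_closure P A f0 x"
      using f x by (intro convex_closure_increasing[OF comp, where c = c]) (auto simp: X)
  qed
  have 2: ?ii if iii: ?iii
  proof (intro allI impI, elim conjE)
    fix f :: "nat \<Rightarrow> 'a \<Rightarrow> real" and f0
    assume f: "\<forall>n. f n \<in> Cb X" "f0 \<in> Cb X" "\<forall>n. \<forall>x\<in>A. f n x \<le> f (Suc n) x"
      "\<forall>x\<in>A. (\<lambda>n. f n x) \<longlonglongrightarrow> f0 x"
    have "\<exists>c::real. \<forall>x\<in>A. ereal c \<le> ereal (f n x)" for n
    proof -
      obtain B where "\<And>x. x \<in> topspace X \<Longrightarrow> \<bar>f n x\<bar> \<le> B"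
        using Cb_obtain_bound[of "f n" X] f(1) by blast
      then show ?thesis by (intro exI[of _ "- B"]) (auto simp: X abs_le_iff minus_le_iff)
    qed
    then have "(\<forall>n. lsc_on X (\<lambda>y. ereal (f n y)) \<and> (\<exists>c::real. \<forall>x\<in>A. ereal c \<le> ereal (f n x))) \<and>
        (\<forall>n. \<forall>x\<in>A. ereal (f n x) \<le> ereal (f (Suc n) x)) \<and>
        (\<forall>x\<in>A. (\<lambda>n. ereal (f n x)) \<longlonglongrightarrow> ereal (f0 x))"
      using f by (simp add: lsc_on_ereal Cb_lsc_on)
    from iii[THEN spec, THEN spec, THEN mp, OF this]
    show "\<forall>x\<in>A. (\<lambda>n. convex_closure P A (\<lambda>y. ereal (f n y)) x)
        \<longlonglongrightarrow> convex_closure P A (\<lambda>y. ereal (f0 y)) x" .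
  qed
  have 3: "mu_compact P A" if ?ii
    using that unfolding X by (intro mu_compact_if_convex_closure_continuous) blast
  have 4: "\<forall>(f :: nat \<Rightarrow> 'a \<Rightarrow> real) f0.
      (\<forall>n. lsc_on X (f n) \<and> bounded (f n ` A)) \<and> lsc_on X f0 \<and> bounded (f0 ` A) \<and>
      (\<forall>n. \<forall>x\<in>A. f (Suc n) x \<le> f n x) \<and>
      (\<forall>x\<in>A. (\<lambda>n. f n x) \<longlonglongrightarrow> f0 x) \<longrightarrow>
      (\<forall>x\<in>A. (\<lambda>n. convex_closure P A (\<lambda>y. ereal (f n y)) x)
        \<longlonglongrightarrow> convex_closure P A (\<lambda>y. ereal (f0 y)) x)" if comp: "mu_compact P A"
    unfolding X by (intro allI impI ballI convex_closure_decreasing[OF comp]) auto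
  \<comment> \<open>The cycle is (i) to (iii) by \<open>1\<close>, (iii) to (ii) by
    \<open>2\<close>, and (ii) to (i) by \<open>3\<close>.\<close>
  show ?thesis
    by (rule conjI[OF iffI[OF 2[OF 1] 3] conjI[OF iffI[OF 1 3[OF 2]] impI[OF 4]]])
qed

end
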